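(* Let $w\in S_n$ be a permutation. For some $k\in[n]$, let $v\in S_{n-1}$ be the permutation given by the relative ordering of $w(1),\dots,w(k-1),w(k+1),\dots,w(n)$. Set $M=\prod z_{i,j}$, where the product is over pairs $(i,j)$ with $(i,j)\in D(w)$ and ($i=k$ or $j=w(k)$). Then $$\mathfrak{F}_w(z)=M\cdot\mathfrak{F}_v(z_{i,j})_{i\in[n]\setminus\{k\},\,j\in[n]\setminus\{w(k)\}}+E,$$ where $E$ is a polynomial with non-negative coefficients.
   Context: $D(w)=\{(i,j)\in[n]^2: w(i)>j,\ w^{-1}(j)>i\}$ is the Rothe diagram. The notation $\mathfrak{F}_v(z_{i,j})_{i\in[n]\setminus\{k\},\,j\in[n]\setminus\{w(k)\}}$ means that the variables of $\mathfrak{F}_v$, indexed by $[n-1]^2$, are replaced by the variables $z_{i,j}$ with $i\ne k$, $j\neq w(k)$ via the order-preserving bijections $[n-1]\to[n]\setminus\{k\}$ on rows and $[n-1]\to[n]\setminus\{w(k)\}$ on columns. Matrix Schubert variety: for $w \in S_n$, $r_{p\times q}(w)=\#\{(i,j): i\le p,\ j\le q,\ w(i)=j\}$, and $X_w\subset\mathbb{A}^{n^2}$ is the variety of $n\times n$ complex matrices whose northwest $p\times q$ submatrix has rank at most $r_{p\times q}(w)$ for all $p,q$. It is irreducible of codimension $\ell(w)$ (the Coxeter length). Fine Schubert polynomial: let $\overline{X}_w$ be the closure of $X_w$ in $(\mathbb{P}^1)^{n^2}\supset\mathbb{A}^{n^2}$ and $[H_{i,j}]\in H^2((\mathbb{P}^1)^{n^2})$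 the class of the closure of $\{a_{i,j}=0\}$. $\mathfrak{F}_w(z)\in\mathbb{Z}[z_{i,j}:(i,j)\in[n]^2]$ is the unique polynomial, all of whose monomials are products of distinct variables, with $[\overline{X}_w]=\mathfrak{F}_w([H_{1,1}],\dots,[H_{n,n}])\cap[(\mathbb{P}^1)^{n^2}]$ (cap product). Equivalently it is homogeneous of degree $\ell(w)$, and for $|S|=\ell(w)$ the coefficient of $z^S=\prod_{(i,j)\in S}z_{i,j}$ is the degree of the coordinate projection $X_w\to\mathbb{A}^{[n]^2\setminus S}$ (zero if not dominant). *)

theory Defs
  imports
    "HOL-Library.Poly_Mapping"
    "HOL-Library.FuncSet"
    "HOL-Combinatorics.Permutations"
    "HOL-Combinatorics.Transposition"
    "Jordan_Normal_Form.DL_Rank"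
begin

section \<open>Multivariate polynomials\<close>

text \<open>The polynomial ring over \<open>'r\<close> in the variables \<open>'x\<close> is the monoid algebra of the finitely
  supported exponent vectors; addition and multiplication are those of \<^theory>\<open>HOL-Library.Poly_Mapping\<close>.\<close>

type_synonym ('x, 'r) mpolynomial = "('x \<Rightarrow>\<^sub>0 nat) \<Rightarrow>\<^sub>0 'r"

definition var :: "'x \<Rightarrow> ('x, 'r::comm_ring_1) mpolynomial" where
  "var x = Poly_Mapping.single (Poly_Mapping.single x 1) 1"

definition const :: "'r \<Rightarrow> ('x, 'r::comm_ring_1) mpolynomial" where
  "const c = Poly_Mapping.single 0 c"

definition vars_of :: "('x, 'r::comm_ring_1) mpolynomial \<Rightarrow> 'x set" where
  "vars_of p = (\<Union>m\<in>Poly_Mapping.keys p. Poly_Mapping.keys m)"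

text \<open>Substitution of \<open>a x\<close> for every variable \<open>x\<close>, the coefficients being mapped by \<open>c\<close>.\<close>

definition eval_with :: "('r::comm_ring_1 \<Rightarrow> 's::comm_ring_1) \<Rightarrow> ('x \<Rightarrow> 's) \<Rightarrow> ('x, 'r) mpolynomial \<Rightarrow> 's" where
  "eval_with c a p = (\<Sum>m\<in>Poly_Mapping.keys p. c (Poly_Mapping.lookup p m) * (\<Prod>x\<in>Poly_Mapping.keys m. a x ^ Poly_Mapping.lookup m x))"

definition poly_value :: "('x \<Rightarrow> 'r) \<Rightarrow> ('x, 'r::comm_ring_1) mpolynomial \<Rightarrow> 'r" where
  "poly_value a p = eval_with (\<lambda>c. c) a p"

definition rename_vars :: "('x \<Rightarrow> 'y) \<Rightarrow> ('x, 'r::comm_ring_1) mpolynomial \<Rightarrow> ('y, 'r) mpolynomial" where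
  "rename_vars f p = eval_with const (\<lambda>x. var (f x)) p"


section \<open>Affine spaces, coordinate projections and their degrees\<close>

definition affine_space :: "'x set \<Rightarrow> ('x \<Rightarrow> complex) set" where
  "affine_space I = I \<rightarrow>\<^sub>E UNIV"

definition zariski_closed :: "'x set \<Rightarrow> ('x \<Rightarrow> complex) set \<Rightarrow> bool" where
  "zariski_closed I Z \<longleftrightarrow>
     (\<exists>P :: ('x, complex) mpolynomial set.
        (\<forall>p\<in>P. vars_of p \<subseteq> I) \<and> Z = {a \<in> affine_space I. \<forall>p\<in>P. poly_value a p = 0})"

definition zariski_open :: "'x set \<Rightarrow> ('x \<Rightarrow> complex) set \<Rightarrow> bool" where
  "zariski_open I U \<longleftrightarrow> U \<subseteq> affine_space I \<and> zariski_closed I (affine_space I - U)"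

text \<open>Throughout, \<open>X\<close> is a subvariety of \<open>affine_space I\<close> and \<open>J \<subseteq> I\<close>; the coordinate projection
  \<open>X \<rightarrow> affine_space J\<close> is \<open>\<lambda>x. restrict x J\<close>.\<close>

definition dominant_projection :: "('x \<Rightarrow> complex) set \<Rightarrow> 'x set \<Rightarrow> bool" where
  "dominant_projection X J \<longleftrightarrow>
     (\<forall>Z. zariski_closed J Z \<and> (\<lambda>x. restrict x J) ` X \<subseteq> Z \<longrightarrow> Z = affine_space J)"

definition projection_fiber :: "('x \<Rightarrow> complex) set \<Rightarrow> 'x set \<Rightarrow> ('x \<Rightarrow> complex) \<Rightarrow> ('x \<Rightarrow> complex) set" where
  "projection_fiber X J a = {x \<in> X. restrict x J = a}"

definition general_fiber_card :: "('x \<Rightarrow> complex) set \<Rightarrow> 'x set \<Rightarrow> nat \<Rightarrow> bool" where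
  "general_fiber_card X J d \<longleftrightarrow>
     (\<exists>U. zariski_open J U \<and> U \<noteq> {} \<and>
        (\<forall>a\<in>U. finite (projection_fiber X J a) \<and> card (projection_fiber X J a) = d))"

text \<open>The degree of a dominant, generically finite map of complex varieties is the number of points
  of its general fiber. It is \<open>0\<close> for non-dominant maps. The remaining case, of a dominant map with
  infinite general fiber, also gets the value \<open>0\<close>; it does not arise for
  \<open>dim X = card J\<close>, the only situation in which the degree is used below.
  At most one \<open>d\<close> qualifies, as two nonempty open subsets of affine space intersect.\<close>

definition projection_degree :: "('x \<Rightarrow> complex) set \<Rightarrow> 'x set \<Rightarrow> nat" where
  "projection_degree X J =
     (if dominant_projection X J \<and> (\<exists>d. general_fiber_card X J d)
      then (THE d. general_fiber_card X J d) else 0)"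


section \<open>Permutations\<close>

text \<open>A permutation in \<open>S\<^sub>n\<close> is a function \<open>w\<close> with \<open>w permutes {1..n}\<close>.\<close>

definition grid :: "nat \<Rightarrow> (nat \<times> nat) set" where
  "grid n = {1..n} \<times> {1..n}"

definition coxeter_length :: "nat \<Rightarrow> (nat \<Rightarrow> nat) \<Rightarrow> nat" where
  "coxeter_length n w =
     (LEAST m. \<exists>is. length is = m \<and> set is \<subseteq> {1..<n} \<and>
        w = foldr (\<lambda>i f. Transposition.transpose i (Suc i) \<circ> f) is id)"

definition rothe_diagram :: "nat \<Rightarrow> (nat \<Rightarrow> nat) \<Rightarrow> (nat \<times> nat) set" where
  "rothe_diagram n w = {(i, j) \<in> grid n. w i > j \<and> inv_into UNIV w j > i}"

text \<open>The order-preserving bijection from \<open>{1..n-1}\<close> to \<open>{1..n} - {k}\<close>.\<close>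

definition skip :: "nat \<Rightarrow> nat \<Rightarrow> nat" where
  "skip k i = (if i < k then i else i + 1)"

text \<open>\<open>v\<close> is the permutation given by the relative ordering of the word
  \<open>w 1, \<dots>, w (k-1), w (k+1), \<dots>, w n\<close>, whose \<open>i\<close>-th letter is \<open>w (skip k i)\<close>.\<close>

definition relative_ordering_omitting :: "nat \<Rightarrow> (nat \<Rightarrow> nat) \<Rightarrow> nat \<Rightarrow> (nat \<Rightarrow> nat) \<Rightarrow> bool" where
  "relative_ordering_omitting n w k v \<longleftrightarrow>
     v permutes {1..n-1} \<and>
     (\<forall>i\<in>{1..n-1}. \<forall>i'\<in>{1..n-1}. v i < v i' \<longleftrightarrow> w (skip k i) < w (skip k i'))"


section \<open>Matrix Schubert varieties and fine Schubert polynomials\<close>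

definition rank_fun :: "nat \<Rightarrow> (nat \<Rightarrow> nat) \<Rightarrow> nat \<Rightarrow> nat \<Rightarrow> nat" where
  "rank_fun n w p q = card {(i, j) \<in> grid n. i \<le> p \<and> j \<le> q \<and> w i = j}"

text \<open>Matrices in \<open>affine_space (grid n)\<close> are indexed from 1, those of type \<open>complex mat\<close> from 0.\<close>

definition northwest :: "nat \<Rightarrow> nat \<Rightarrow> (nat \<times> nat \<Rightarrow> complex) \<Rightarrow> complex mat" where
  "northwest p q A = mat p q (\<lambda>(i, j). A (i + 1, j + 1))"

definition matrix_schubert_variety :: "nat \<Rightarrow> (nat \<Rightarrow> nat) \<Rightarrow> (nat \<times> nat \<Rightarrow> complex) set" where
  "matrix_schubert_variety n w =
     {A \<in> affine_space (grid n).
        \<forall>p\<in>{1..n}. \<forall>q\<in>{1..n}. vec_space.rank p (northwest p q A) \<le> rank_fun n w p q}"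

text \<open>The coefficient of a squarefree monomial in the class of the closure of a matrix Schubert
  variety in the product of projective lines is the degree of the projection forgetting the
  coordinates in that monomial.\<close>

definition fine_schubert :: "nat \<Rightarrow> (nat \<Rightarrow> nat) \<Rightarrow> (nat \<times> nat, int) mpolynomial" where
  "fine_schubert n w =
     (\<Sum>S\<in>{S. S \<subseteq> grid n \<and> card S = coxeter_length n w}.
        const (int (projection_degree (matrix_schubert_variety n w) (grid n - S))) * (\<Prod>s\<in>S. var s))"

end

theory Submission
  imports Defs "HOL-Computational_Algebra.Fundamental_Theorem_Algebra"
begin

text \<open>The coefficient of \<open>M z\<^sup>T\<close> in \<open>F\<^sub>w\<close> is the degree of a projection of \<open>X\<^sub>w\<close>, and it suffices to bound it
  below by the degree of the corresponding projection of \<open>X\<^sub>v\<close>. Row and column operations map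
  \<open>X\<^sub>v \<times> \<complex>\<^sup>c\<close> to \<open>X\<^sub>w\<close>, and scaling the parameters of the operations by \<open>s\<close> gives a family of maps to the base
  of the projection of \<open>X\<^sub>w\<close>, whose member at \<open>s = 0\<close> is the projection of \<open>X\<^sub>v\<close>, up to an invertible linear
  change of the parameters. If the general fiber of \<open>X\<^sub>w\<close> had only \<open>e < d\<close> points, then a linear form would
  satisfy on \<open>X\<^sub>w\<close> an equation of degree \<open>e\<close> over the functions on the base; cancelling powers of \<open>s\<close> in its pullback
  and setting \<open>s = 0\<close> gives such an equation for \<open>X\<^sub>v\<close>, although the linear form can be chosen to take
  \<open>d\<close> values on the general fiber of \<open>X\<^sub>v\<close>.

  That the cardinality of fibers is generically constant follows from Chevalley's theorem, and that it is
  finite from a dimension count: \<open>X\<^sub>w\<close> is covered by cells, indexed by the positions of the pivots of its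
  columns, whose dimensions are compared through Bruhat order.\<close>

section \<open>Polynomial functions and generic points\<close>

text \<open>Points of a fiber are hard to follow to \<open>s = 0\<close>: they may collide or escape
  to infinity. A polynomial relation can be followed. For a linear form that separates the points of
  a fiber, the number of points is the degree of its relation, and dividing all coefficients by a
  common power of \<open>s\<close> keeps the bound on the degree, even if the leading coefficient is
  lost in the limit.

  The parameters are as many as the prescribed entries of the new row and column. Entries in the
  diagram are forgotten by the projection; the others are the pivot, the entries to its right (from
  \<open>r\<close>) and below it (from \<open>l\<close>), and one entry of the row (from
  \<open>c\<close>) and of the column (from \<open>d\<close>) for each dot of \<open>w\<close>
  northwest of \<open>(k, w k)\<close>. At \<open>s = 0\<close> these equations are linear and no
  longer disturb the old entries. They can be solved unless the pivot or the minor on those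
  northwest dots vanishes. For the minor to be nonzero on the general fiber of
  \<open>X\<^sub>v\<close>, a dimension count is required for hypersurface sections too, not only
  for the variety itself.\<close>

locale function_ring =
  fixes R :: "('a \<Rightarrow> complex) set"
  assumes const_mem: "(\<lambda>_. c) \<in> R"
    and add_mem: "f \<in> R \<Longrightarrow> g \<in> R \<Longrightarrow> (\<lambda>a. f a + g a) \<in> R"
    and mult_mem: "f \<in> R \<Longrightarrow> g \<in> R \<Longrightarrow> (\<lambda>a. f a * g a) \<in> R"

text \<open>Stands for \<open>R[t]\<close>, with one variable kept as a genuine \<open>poly\<close>
  so that division and gcds are available for every parameter \<open>a\<close>. The uniform degree
  bound leaves only finitely many coefficients to control.\<close>

definition poly_family :: "('a \<Rightarrow> complex) set \<Rightarrow> ('a \<Rightarrow> complex poly) set" where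
  "poly_family R = {P. (\<exists>d. \<forall>a. degree (P a) \<le> d) \<and> (\<forall>k. (\<lambda>a. coeff (P a) k) \<in> R)}"

lemma poly_familyI:
  "(\<And>a. degree (P a) \<le> d) \<Longrightarrow> (\<And>k. (\<lambda>a. coeff (P a) k) \<in> R) \<Longrightarrow> P \<in> poly_family R"
  unfolding poly_family_def by blast

lemma poly_family_coeff: "P \<in> poly_family R \<Longrightarrow> (\<lambda>a. coeff (P a) k) \<in> R"
  unfolding poly_family_def by blast

lemma poly_family_degree:
  assumes "P \<in> poly_family R"
  obtains d where "\<And>a. degree (P a) \<le> d"
  using assms unfolding poly_family_def by blast

lemma poly_eq_sum_coeff:
  fixes p :: "'b::comm_semiring_1 poly"
  assumes "degree p \<le> d"
  shows "poly p t = (\<Sum>i\<le>d. coeff p i * t ^ i)"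
  unfolding poly_altdef using assms
  by (intro sum.mono_neutral_left) (auto simp: coeff_eq_0)

context function_ring
begin

lemma uminus_mem: "f \<in> R \<Longrightarrow> (\<lambda>a. - f a) \<in> R"
  using mult_mem[OF const_mem[of "- 1"], of f] by simp

lemma diff_mem: "f \<in> R \<Longrightarrow> g \<in> R \<Longrightarrow> (\<lambda>a. f a - g a) \<in> R"
  using add_mem[OF _ uminus_mem, of f g] by simp

lemma sum_mem: "(\<And>i. i \<in> A \<Longrightarrow> f i \<in> R) \<Longrightarrow> (\<lambda>a. \<Sum>i\<in>A. f i a) \<in> R"
  by (induction A rule: infinite_finite_induct) (auto intro: const_mem add_mem)

lemma prod_mem: "(\<And>i. i \<in> A \<Longrightarrow> f i \<in> R) \<Longrightarrow> (\<lambda>a. \<Prod>i\<in>A. f i a) \<in> R"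
  by (induction A rule: infinite_finite_induct) (auto intro: const_mem mult_mem)

lemma power_mem: "f \<in> R \<Longrightarrow> (\<lambda>a. f a ^ n) \<in> R"
  by (induction n) (auto intro: const_mem mult_mem)

lemma if_mem: "(b \<Longrightarrow> f \<in> R) \<Longrightarrow> (\<not> b \<Longrightarrow> g \<in> R) \<Longrightarrow> (\<lambda>a. if b then f a else g a) \<in> R"
  by (cases b) auto

lemma family_monom: "f \<in> R \<Longrightarrow> (\<lambda>a. monom (f a) n) \<in> poly_family R"
  by (rule poly_familyI[of _ n]) (auto intro: degree_monom_le const_mem if_mem)

lemma family_const: "f \<in> R \<Longrightarrow> (\<lambda>a. [:f a:]) \<in> poly_family R"
  using family_monom[of f 0] by (simp add: monom_0)

lemma family_fixed: "(\<lambda>_. p) \<in> poly_family R"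
  by (rule poly_familyI[of _ "degree p"]) (auto intro: const_mem)

lemma family_add:
  assumes "P \<in> poly_family R" "Q \<in> poly_family R"
  shows "(\<lambda>a. P a + Q a) \<in> poly_family R"
proof -
  obtain d e where "\<And>a. degree (P a) \<le> d" "\<And>a. degree (Q a) \<le> e"
    using assms by (metis poly_family_degree)
  then have "degree (P a + Q a) \<le> max d e" for a
    by (meson degree_add_le_max le_trans max.mono)
  then show ?thesis
    by (rule poly_familyI) (auto intro!: add_mem poly_family_coeff assms)
qed

lemma family_mult:
  assumes "P \<in> poly_family R" "Q \<in> poly_family R"
  shows "(\<lambda>a. P a * Q a) \<in> poly_family R"
proof -
  obtain d e where "\<And>a. degree (P a) \<le> d" "\<And>a. degree (Q a) \<le> e"
    using assms by (metis poly_family_degree)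
  then have "degree (P a * Q a) \<le> d + e" for a
    by (meson degree_mult_le le_trans add_mono)
  then show ?thesis
    by (rule poly_familyI) (auto simp: coeff_mult intro!: sum_mem mult_mem poly_family_coeff assms)
qed

lemma family_uminus: "P \<in> poly_family R \<Longrightarrow> (\<lambda>a. - P a) \<in> poly_family R"
  using family_mult[OF family_fixed[of "[:- 1:]"], of P] by simp

lemma family_diff:
  "P \<in> poly_family R \<Longrightarrow> Q \<in> poly_family R \<Longrightarrow> (\<lambda>a. P a - Q a) \<in> poly_family R"
  using family_add[OF _ family_uminus, of P Q] by simp

lemma family_sum: "(\<And>i. i \<in> A \<Longrightarrow> P i \<in> poly_family R) \<Longrightarrow> (\<lambda>a. \<Sum>i\<in>A. P i a) \<in> poly_family R"
  by (induction A rule: infinite_finite_induct) (auto intro: family_fixed family_add)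

lemma family_prod: "(\<And>i. i \<in> A \<Longrightarrow> P i \<in> poly_family R) \<Longrightarrow> (\<lambda>a. \<Prod>i\<in>A. P i a) \<in> poly_family R"
  by (induction A rule: infinite_finite_induct) (auto intro: family_fixed family_mult)

lemma family_pderiv:
  assumes "P \<in> poly_family R"
  shows "(\<lambda>a. pderiv (P a)) \<in> poly_family R"
proof -
  obtain d where "\<And>a. degree (P a) \<le> d"
    using assms by (metis poly_family_degree)
  then have "degree (pderiv (P a)) \<le> d" for a
    by (metis degree_pderiv diff_le_self le_trans)
  then show ?thesis
    by (rule poly_familyI) (auto simp: coeff_pderiv intro!: mult_mem const_mem poly_family_coeff assms
        simp del: of_nat_Suc)
qed

end

lemma poly_family_mono: "R \<subseteq> S \<Longrightarrow> poly_family R \<subseteq> poly_family S"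
  unfolding poly_family_def by blast

inductive_set polyfun :: "'x set \<Rightarrow> (('x \<Rightarrow> complex) \<Rightarrow> complex) set" for J where
  polyfun_const: "(\<lambda>_. c) \<in> polyfun J"
| polyfun_coord: "x \<in> J \<Longrightarrow> (\<lambda>a. a x) \<in> polyfun J"
| polyfun_add: "f \<in> polyfun J \<Longrightarrow> g \<in> polyfun J \<Longrightarrow> (\<lambda>a. f a + g a) \<in> polyfun J"
| polyfun_mult: "f \<in> polyfun J \<Longrightarrow> g \<in> polyfun J \<Longrightarrow> (\<lambda>a. f a * g a) \<in> polyfun J"

interpretation polyfun: function_ring "polyfun J"
  by unfold_locales (auto intro: polyfun.intros)

lemma polyfun_mono: "f \<in> polyfun J \<Longrightarrow> J \<subseteq> K \<Longrightarrow> f \<in> polyfun K"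
  by (induction rule: polyfun.induct) (auto intro: polyfun.intros)

lemma polyfun_local: "f \<in> polyfun J \<Longrightarrow> (\<And>x. x \<in> J \<Longrightarrow> a x = b x) \<Longrightarrow> f a = f b"
  by (induction rule: polyfun.induct) auto

lemma polyfun_subst:
  assumes "function_ring R" "f \<in> polyfun J" "\<And>x. x \<in> J \<Longrightarrow> \<sigma> x \<in> R"
  shows "(\<lambda>a. f (\<lambda>x. \<sigma> x a)) \<in> R"
  using assms(2)
  by induction (auto intro: assms(3) function_ring.const_mem[OF assms(1)]
      function_ring.add_mem[OF assms(1)] function_ring.mult_mem[OF assms(1)])

lemma polyfun_family:
  assumes R: "function_ring R" and "f \<in> polyfun J" and \<sigma>: "\<And>x. x \<in> J \<Longrightarrow> \<sigma> x \<in> poly_family R"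
  shows "\<exists>P\<in>poly_family R. \<forall>a t. f (\<lambda>x. poly (\<sigma> x a) t) = poly (P a) t"
  using assms(2)
proof induction
  case (polyfun_const c)
  show ?case
    by (rule bexI[of _ "\<lambda>_. [:c:]"]) (auto intro: function_ring.family_fixed[OF R])
next
  case (polyfun_coord x)
  then show ?case using \<sigma> by blast
next
  case (polyfun_add f g)
  then obtain P Q where "P \<in> poly_family R" "Q \<in> poly_family R"
    "\<forall>a t. f (\<lambda>x. poly (\<sigma> x a) t) = poly (P a) t" "\<forall>a t. g (\<lambda>x. poly (\<sigma> x a) t) = poly (Q a) t"
    by blast
  then show ?case
    by (intro bexI[of _ "\<lambda>a. P a + Q a"]) (auto intro: function_ring.family_add[OF R])
next
  case (polyfun_mult f g)
  then obtain P Q where "P \<in> poly_family R" "Q \<in> poly_family R"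
    "\<forall>a t. f (\<lambda>x. poly (\<sigma> x a) t) = poly (P a) t" "\<forall>a t. g (\<lambda>x. poly (\<sigma> x a) t) = poly (Q a) t"
    by blast
  then show ?case
    by (intro bexI[of _ "\<lambda>a. P a * Q a"]) (auto intro: function_ring.family_mult[OF R])
qed

text \<open>The passage from functions of several variables to polynomials in one of them;
  eliminating a coordinate starts here.\<close>

lemma polyfun_upd_family:
  assumes "f \<in> polyfun (insert y J)"
  shows "\<exists>P\<in>poly_family (polyfun J). \<forall>a t. f (a(y := t)) = poly (P a) t"
proof -
  let ?\<sigma> = "\<lambda>x a. if x = y then [:0, 1:] else [:a x:]"
  have "?\<sigma> x \<in> poly_family (polyfun J)" if "x \<in> insert y J" for x
    using that by (cases "x = y") (auto intro: polyfun.family_fixed polyfun.family_const polyfun_coord)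
  from polyfun_family[OF polyfun.function_ring_axioms assms, of ?\<sigma>, OF this] obtain P
    where P: "P \<in> poly_family (polyfun J)" "\<forall>a t. f (\<lambda>x. poly (?\<sigma> x a) t) = poly (P a) t" by blast
  moreover have "(\<lambda>x. poly (?\<sigma> x a) t) = a(y := t)" for a and t :: complex by (auto simp: fun_eq_iff)
  ultimately show ?thesis by auto
qed

lemma polyfun_continuous:
  assumes "f \<in> polyfun J" "\<And>x. x \<in> J \<Longrightarrow> continuous_on S (\<lambda>s. c s x)"
  shows "continuous_on S (\<lambda>s. f (c s))"
  using assms(1) by induction (auto intro: continuous_intros assms(2))

section \<open>Irreducibility of affine space and the filter of generic points\<close>

lemma polyfun_line:
  assumes "f \<in> polyfun J"
  shows "\<exists>p. \<forall>t. f (\<lambda>x. a x + t * (b x - a x)) = poly p t"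
proof -
  \<comment> \<open>The parameter space is a single point, whose function ring consists of the
    constants; families over it are just polynomials.\<close>
  have "\<exists>P\<in>poly_family (range (\<lambda>c (_::unit). c)). \<forall>u t. f (\<lambda>x. poly [:a x, b x - a x:] t) = poly (P u) t"
    by (rule polyfun_family[OF _ assms, of _ "\<lambda>x _. [:a x, b x - a x:]"])
      (auto simp: function_ring_def intro!: function_ring.family_fixed)
  then show ?thesis by (auto simp: mult.commute)
qed

text \<open>On the line from \<open>a\<close> to \<open>b\<close> both functions become nonzero
  polynomials in one variable, and so does their product.\<close>

lemma polyfun_nonzero_both:
  assumes "f \<in> polyfun J" "g \<in> polyfun J" "f a \<noteq> 0" "g b \<noteq> 0"
  shows "\<exists>c. f c \<noteq> 0 \<and> g c \<noteq> 0"
proof -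
  obtain p q where p: "\<And>t. f (\<lambda>x. a x + t * (b x - a x)) = poly p t"
    and q: "\<And>t. g (\<lambda>x. a x + t * (b x - a x)) = poly q t"
    using polyfun_line[OF assms(1)] polyfun_line[OF assms(2)] by metis
  have "p \<noteq> 0" using p[of 0] assms(3) by auto
  moreover have "q \<noteq> 0" using q[of 1] assms(4) by auto
  ultimately have "p * q \<noteq> 0" by simp
  then obtain t where "poly (p * q) t \<noteq> 0"
    using poly_all_0_iff_0 by blast
  with p[of t] q[of t] show ?thesis
    by (intro exI[of _ "\<lambda>x. a x + t * (b x - a x)"]) auto
qed

text \<open>Genericity is packaged as a filter, so that finitely many generic conditions combine by
  \<open>eventually_elim\<close>. Two nonempty basic open sets meet in a nonempty one, which makes
  them a filter base. Points are total functions; only the equations are confined to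
  \<open>J\<close>.\<close>

definition zariski_generic :: "'x set \<Rightarrow> ('x \<Rightarrow> complex) filter" where
  "zariski_generic J = (INF g\<in>{g \<in> polyfun J. \<exists>a. g a \<noteq> 0}. principal {a. g a \<noteq> 0})"

lemma eventually_generic:
  "(\<forall>\<^sub>F a in zariski_generic J. P a) \<longleftrightarrow>
     (\<exists>g\<in>polyfun J. (\<exists>a. g a \<noteq> 0) \<and> (\<forall>a. g a \<noteq> 0 \<longrightarrow> P a))"
proof -
  have "(\<forall>\<^sub>F a in zariski_generic J. P a) \<longleftrightarrow>
    (\<exists>g\<in>{g \<in> polyfun J. \<exists>a. g a \<noteq> 0}. eventually P (principal {a. g a \<noteq> 0}))"
    unfolding zariski_generic_def
  proof (rule eventually_INF_base)
    show "{g \<in> polyfun J. \<exists>a. g a \<noteq> 0} \<noteq> {}"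
      using polyfun_const[of 1 J] by auto
  next
    fix f g assume "f \<in> {g \<in> polyfun J. \<exists>a. g a \<noteq> 0}" "g \<in> {g \<in> polyfun J. \<exists>a. g a \<noteq> 0}"
    then show "\<exists>h\<in>{g \<in> polyfun J. \<exists>a. g a \<noteq> 0}.
      principal {a. h a \<noteq> 0} \<le> inf (principal {a. f a \<noteq> 0}) (principal {a. g a \<noteq> 0})"
      using polyfun_nonzero_both[of f J g]
      by (intro bexI[of _ "\<lambda>a. f a * g a"]) (auto intro: polyfun_mult)
  qed
  then show ?thesis by (auto simp: eventually_principal)
qed

lemma generic_nontrivial: "zariski_generic J \<noteq> bot"
  unfolding trivial_limit_def eventually_generic by blast

lemma generic_nonzero:
  "g \<in> polyfun J \<Longrightarrow> g a \<noteq> 0 \<Longrightarrow> \<forall>\<^sub>F b in zariski_generic J. g b \<noteq> 0"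
  unfolding eventually_generic by (intro bexI[of _ g] conjI exI[of _ a]) auto

lemma generic_happens: "\<forall>\<^sub>F a in zariski_generic J. P a \<Longrightarrow> \<exists>a. P a"
  using generic_nontrivial by (rule eventually_happens')

lemma generic_subst:
  assumes "\<forall>\<^sub>F a in zariski_generic J. P a" and f: "\<And>x. x \<in> J \<Longrightarrow> f x \<in> K" "inj_on f J"
    and local: "\<And>a b. (\<And>x. x \<in> J \<Longrightarrow> a x = b x) \<Longrightarrow> P a \<Longrightarrow> P b"
  shows "\<forall>\<^sub>F a in zariski_generic K. P (\<lambda>x. a (f x))"
proof -
  obtain g a where g: "g \<in> polyfun J" "g a \<noteq> 0" "\<And>a. g a \<noteq> 0 \<Longrightarrow> P a"
    using assms(1) unfolding eventually_generic by blast
  have "(\<lambda>a. g (\<lambda>x. a (f x))) \<in> polyfun K"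
    by (rule polyfun_subst[OF polyfun.function_ring_axioms g(1)]) (auto intro: polyfun_coord f)
  moreover have "g (\<lambda>x. (\<lambda>y. a (inv_into J f y)) (f x)) \<noteq> 0"
    using g(2) polyfun_local[OF g(1), of "\<lambda>x. a (inv_into J f (f x))" a] f(2) by simp
  ultimately show ?thesis
    unfolding eventually_generic using g(3)
    by (intro bexI[of _ "\<lambda>a. g (\<lambda>x. a (f x))"] conjI exI[of _ "\<lambda>y. a (inv_into J f y)"]) auto
qed

section \<open>Constructible functions and Chevalley's theorem\<close>

text \<open>With the total inverse of HOL (\<open>inverse 0 = 0\<close>), the functions that are piecewise rational on
  constructible sets are those generated by the field operations alone: \<open>1 - f * inverse f\<close> is the
  indicator of \<open>f = 0\<close>, so case distinctions come for free.\<close>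

inductive_set cfun :: "'x set \<Rightarrow> (('x \<Rightarrow> complex) \<Rightarrow> complex) set" for J where
  cfun_const: "(\<lambda>_. c) \<in> cfun J"
| cfun_coord: "x \<in> J \<Longrightarrow> (\<lambda>a. a x) \<in> cfun J"
| cfun_add: "f \<in> cfun J \<Longrightarrow> g \<in> cfun J \<Longrightarrow> (\<lambda>a. f a + g a) \<in> cfun J"
| cfun_mult: "f \<in> cfun J \<Longrightarrow> g \<in> cfun J \<Longrightarrow> (\<lambda>a. f a * g a) \<in> cfun J"
| cfun_inverse: "f \<in> cfun J \<Longrightarrow> (\<lambda>a. inverse (f a)) \<in> cfun J"

interpretation cfun: function_ring "cfun J"
  by unfold_locales (auto intro: cfun.intros)

lemma polyfun_subset_cfun: "polyfun J \<subseteq> cfun J"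
proof
  fix f assume "f \<in> polyfun J"
  then show "f \<in> cfun J" by induction (auto intro: cfun.intros)
qed

lemma cfun_local: "f \<in> cfun J \<Longrightarrow> (\<And>x. x \<in> J \<Longrightarrow> a x = b x) \<Longrightarrow> f a = f b"
  by (induction rule: cfun.induct) auto

lemma cfun_divide: "f \<in> cfun J \<Longrightarrow> g \<in> cfun J \<Longrightarrow> (\<lambda>a. f a / g a) \<in> cfun J"
  by (simp add: divide_inverse cfun_mult cfun_inverse)

definition constructible :: "'x set \<Rightarrow> (('x \<Rightarrow> complex) \<Rightarrow> bool) \<Rightarrow> bool" where
  "constructible J Q \<longleftrightarrow> (\<lambda>a. of_bool (Q a)) \<in> cfun J"

lemma constructible_zero:
  assumes "f \<in> cfun J" shows "constructible J (\<lambda>a. f a = 0)"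
proof -
  have "(\<lambda>a. 1 - f a * inverse (f a)) \<in> cfun J"
    by (intro cfun.diff_mem cfun_const cfun_mult cfun_inverse assms)
  also have "(\<lambda>a. 1 - f a * inverse (f a)) = (\<lambda>a. of_bool (f a = 0))"
    by (auto simp: fun_eq_iff)
  finally show ?thesis unfolding constructible_def .
qed

lemma constructible_eq: "f \<in> cfun J \<Longrightarrow> g \<in> cfun J \<Longrightarrow> constructible J (\<lambda>a. f a = g a)"
  using constructible_zero[OF cfun.diff_mem, of f J g] by simp

lemma constructible_fixed: "constructible J (\<lambda>_. b)"
  unfolding constructible_def by (rule cfun_const)

lemma constructible_not: "constructible J Q \<Longrightarrow> constructible J (\<lambda>a. \<not> Q a)"
  using constructible_zero[of "\<lambda>a. of_bool (Q a)" J] by (simp add: constructible_def)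

lemma constructible_conj:
  "constructible J Q \<Longrightarrow> constructible J S \<Longrightarrow> constructible J (\<lambda>a. Q a \<and> S a)"
  unfolding constructible_def of_bool_conj by (rule cfun_mult)

lemma constructible_disj:
  assumes "constructible J Q" "constructible J S"
  shows "constructible J (\<lambda>a. Q a \<or> S a)"
proof -
  have "constructible J (\<lambda>a. \<not> (\<not> Q a \<and> \<not> S a))"
    by (rule constructible_not, rule constructible_conj; rule constructible_not; fact)
  then show ?thesis by (simp only: de_Morgan_conj not_not)
qed

lemma constructible_ball:
  "finite A \<Longrightarrow> (\<And>i. i \<in> A \<Longrightarrow> constructible J (Q i)) \<Longrightarrow> constructible J (\<lambda>a. \<forall>i\<in>A. Q i a)"
  by (induction A rule: finite_induct) (auto intro: constructible_fixed constructible_conj)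

lemma constructible_bex:
  "finite A \<Longrightarrow> (\<And>i. i \<in> A \<Longrightarrow> constructible J (Q i)) \<Longrightarrow> constructible J (\<lambda>a. \<exists>i\<in>A. Q i a)"
  by (induction A rule: finite_induct) (auto intro: constructible_fixed constructible_disj)

lemma cfun_mono: "f \<in> cfun J \<Longrightarrow> J \<subseteq> K \<Longrightarrow> f \<in> cfun K"
  by (induction rule: cfun.induct) (auto intro: cfun.intros)

lemma constructible_mono: "constructible J Q \<Longrightarrow> J \<subseteq> K \<Longrightarrow> constructible K Q"
  unfolding constructible_def by (rule cfun_mono)

lemma constructible_local:
  assumes "constructible J Q" "\<And>x. x \<in> J \<Longrightarrow> a x = b x"
  shows "Q a = Q b"
proof -
  have "of_bool (Q a) = (of_bool (Q b) :: complex)"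
    using cfun_local[OF assms(1)[unfolded constructible_def], of a b] assms(2) by simp
  then show ?thesis by (simp add: of_bool_def split: if_splits)
qed

lemma cfun_if:
  assumes "constructible J Q" "f \<in> cfun J" "g \<in> cfun J"
  shows "(\<lambda>a. if Q a then f a else g a) \<in> cfun J"
proof -
  have "(\<lambda>a. of_bool (Q a) * f a + (1 - of_bool (Q a)) * g a) \<in> cfun J"
    by (intro cfun_add cfun_mult cfun.diff_mem cfun_const assms assms(1)[unfolded constructible_def])
  also have "(\<lambda>a. of_bool (Q a) * f a + (1 - of_bool (Q a)) * g a) = (\<lambda>a. if Q a then f a else g a)"
    by (auto simp: fun_eq_iff)
  finally show ?thesis .
qed

text \<open>On a stratum given by the zero pattern of finitely many polynomial functions, a constructible
  function is a quotient of polynomial functions.\<close>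

definition zero_pattern :: "(('x \<Rightarrow> complex) \<Rightarrow> complex) set \<Rightarrow> ('x \<Rightarrow> complex) \<Rightarrow> (('x \<Rightarrow> complex) \<Rightarrow> complex) set" where
  "zero_pattern P a = {p \<in> P. p a = 0}"

lemma zero_pattern_Un:
  "zero_pattern (P \<union> S) a \<inter> P = zero_pattern P a" "zero_pattern (P \<union> S) a \<inter> S = zero_pattern S a"
  by (auto simp: zero_pattern_def)

definition stratified where
  "stratified J f P n d \<longleftrightarrow> finite P \<and> P \<subseteq> polyfun J \<and> (\<forall>T. n T \<in> polyfun J \<and> d T \<in> polyfun J) \<and>
    (\<forall>a. d (zero_pattern P a) a \<noteq> 0 \<and> f a = n (zero_pattern P a) a / d (zero_pattern P a) a)"

lemma cfun_stratified: "f \<in> cfun J \<Longrightarrow> \<exists>P n d. stratified J f P n d"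
proof (induction rule: cfun.induct)
  case (cfun_const c)
  have "stratified J (\<lambda>_. c) {} (\<lambda>_ _. c) (\<lambda>_ _. 1)"
    by (simp add: stratified_def polyfun_const)
  then show ?case by blast
next
  case (cfun_coord x)
  then have "stratified J (\<lambda>a. a x) {} (\<lambda>_ a. a x) (\<lambda>_ _. 1)"
    by (simp add: stratified_def polyfun_const polyfun_coord)
  then show ?case by blast
next
  case (cfun_add f g)
  then obtain P n d S n' d' where P: "stratified J f P n d" and S: "stratified J g S n' d'" by blast
  have "stratified J (\<lambda>a. f a + g a) (P \<union> S)
      (\<lambda>T a. n (T \<inter> P) a * d' (T \<inter> S) a + n' (T \<inter> S) a * d (T \<inter> P) a)
      (\<lambda>T a. d (T \<inter> P) a * d' (T \<inter> S) a)"
    using P S unfolding stratified_def zero_pattern_Un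
    by (simp add: add_frac_eq polyfun_add polyfun_mult)
  then show ?case by blast
next
  case (cfun_mult f g)
  then obtain P n d S n' d' where P: "stratified J f P n d" and S: "stratified J g S n' d'" by blast
  have "stratified J (\<lambda>a. f a * g a) (P \<union> S)
      (\<lambda>T a. n (T \<inter> P) a * n' (T \<inter> S) a) (\<lambda>T a. d (T \<inter> P) a * d' (T \<inter> S) a)"
    using P S unfolding stratified_def zero_pattern_Un by (simp add: polyfun_mult)
  then show ?case by blast
next
  case (cfun_inverse f)
  then obtain P n d where P: "stratified J f P n d" by blast
  \<comment> \<open>With the numerators among the tested functions, the zero pattern also decides
    whether \<open>f\<close> vanishes. Where it does, the inverse is \<open>0 / 1\<close>; elsewhere
    the fraction is turned over.\<close>
  let ?S = "P \<union> n ` Pow P"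
  define num where "num T = (if n (T \<inter> P) \<in> T then (\<lambda>_. 0) else d (T \<inter> P))" for T
  define den where "den T = (if n (T \<inter> P) \<in> T then (\<lambda>_. 1) else n (T \<inter> P))" for T
  have "den (zero_pattern ?S a) a \<noteq> 0 \<and> inverse (f a) = num (zero_pattern ?S a) a / den (zero_pattern ?S a) a" for a
  proof -
    have "zero_pattern P a \<subseteq> P" by (auto simp: zero_pattern_def)
    then have "n (zero_pattern P a) \<in> zero_pattern ?S a \<longleftrightarrow> n (zero_pattern P a) a = 0"
      by (auto simp: zero_pattern_def)
    moreover have "f a = n (zero_pattern P a) a / d (zero_pattern P a) a"
      using P by (simp add: stratified_def)
    ultimately show ?thesis by (simp add: num_def den_def zero_pattern_Un)
  qed
  with P have "stratified J (\<lambda>a. inverse (f a)) ?S num den"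
    by (auto simp: stratified_def num_def den_def polyfun_const)
  then show ?case by blast
qed

lemma constructible_pattern:
  assumes "constructible J Q"
  obtains P where "finite P" "P \<subseteq> polyfun J"
    "\<And>a b. zero_pattern P a = zero_pattern P b \<Longrightarrow> Q a = Q b"
proof -
  obtain P n d where "stratified J (\<lambda>a. of_bool (Q a)) P n d"
    using cfun_stratified[OF assms[unfolded constructible_def]] by blast
  then have P: "finite P" "P \<subseteq> polyfun J" "\<And>T. n T \<in> polyfun J"
      "\<And>a. of_bool (Q a) = n (zero_pattern P a) a / d (zero_pattern P a) a" "\<And>a. d (zero_pattern P a) a \<noteq> 0"
    by (simp_all add: stratified_def)
  \<comment> \<open>A fraction with nonzero denominator vanishes iff its numerator does, so testing
    the numerators as well determines \<open>Q\<close>.\<close>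
  let ?S = "P \<union> n ` Pow P"
  have Q: "Q a \<longleftrightarrow> n (zero_pattern P a) \<notin> zero_pattern ?S a" for a
  proof -
    have "zero_pattern P a \<subseteq> P" by (auto simp: zero_pattern_def)
    moreover have "Q a \<longleftrightarrow> n (zero_pattern P a) a \<noteq> 0"
      using P(4,5)[of a] by (auto simp: of_bool_def split: if_splits)
    ultimately show ?thesis by (auto simp: zero_pattern_def)
  qed
  show ?thesis
  proof (rule that[of ?S])
    fix a b assume *: "zero_pattern ?S a = zero_pattern ?S b"
    then have "zero_pattern P a = zero_pattern P b" by (metis zero_pattern_Un(1))
    with * Q show "Q a = Q b" by metis
  qed (use P in auto)
qed

text \<open>Each of the finitely many functions that is not identically zero is generically nonzero;
  hence a single stratum contains the generic points.\<close>

lemma generic_pattern: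
  assumes "finite P" "P \<subseteq> polyfun J"
  shows "\<forall>\<^sub>F a in zariski_generic J. zero_pattern P a = {p \<in> P. \<forall>b. p b = 0}"
proof -
  have "\<forall>\<^sub>F a in zariski_generic J. p a = 0 \<longrightarrow> (\<forall>b. p b = 0)" if p: "p \<in> P" for p
  proof (cases "\<forall>b. p b = 0")
    case False
    then obtain b where "p b \<noteq> 0" by blast
    with p assms have "\<forall>\<^sub>F a in zariski_generic J. p a \<noteq> 0"
      by (intro generic_nonzero) auto
    then show ?thesis by eventually_elim auto
  qed simp
  then have "\<forall>\<^sub>F a in zariski_generic J. \<forall>p\<in>P. p a = 0 \<longrightarrow> (\<forall>b. p b = 0)"
    by (intro eventually_ball_finite ballI assms)
  then show ?thesis by eventually_elim (auto simp: zero_pattern_def)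
qed

lemma constructible_dichotomy:
  assumes "constructible J Q"
  shows "(\<forall>\<^sub>F a in zariski_generic J. Q a) \<or> (\<forall>\<^sub>F a in zariski_generic J. \<not> Q a)"
proof -
  obtain P where P: "finite P" "P \<subseteq> polyfun J"
    "\<And>a b. zero_pattern P a = zero_pattern P b \<Longrightarrow> Q a = Q b"
    using constructible_pattern[OF assms] by blast
  note gen = generic_pattern[OF P(1,2)]
  from generic_happens[OF gen] obtain a0 where a0: "zero_pattern P a0 = {p \<in> P. \<forall>b. p b = 0}" ..
  have "\<forall>\<^sub>F a in zariski_generic J. Q a = Q a0"
    using gen by eventually_elim (simp add: P(3) a0)
  then show ?thesis by (cases "Q a0") auto
qed

lemma cfun_generically_rational:
  assumes "f \<in> cfun J"
  obtains num den where "num \<in> polyfun J" "den \<in> polyfun J"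
    "\<forall>\<^sub>F a in zariski_generic J. den a \<noteq> 0 \<and> f a = num a / den a"
proof -
  obtain P n d where "stratified J f P n d"
    using cfun_stratified[OF assms] by blast
  then have P: "finite P" "P \<subseteq> polyfun J" "\<And>T. n T \<in> polyfun J" "\<And>T. d T \<in> polyfun J"
      "\<And>a. d (zero_pattern P a) a \<noteq> 0 \<and> f a = n (zero_pattern P a) a / d (zero_pattern P a) a"
    by (simp_all add: stratified_def)
  have "\<forall>\<^sub>F a in zariski_generic J. d {p \<in> P. \<forall>b. p b = 0} a \<noteq> 0 \<and>
      f a = n {p \<in> P. \<forall>b. p b = 0} a / d {p \<in> P. \<forall>b. p b = 0} a"
    using generic_pattern[OF P(1,2)] by eventually_elim (metis P(5))
  then show ?thesis by (rule that[OF P(3,4)])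
qed

section \<open>Division, gcds and squarefree parts of polynomials depending on parameters\<close>

lemma family_if:
  assumes "constructible J Q" "F \<in> poly_family (cfun J)" "G \<in> poly_family (cfun J)"
  shows "(\<lambda>a. if Q a then F a else G a) \<in> poly_family (cfun J)"
proof -
  obtain d e where "\<And>a. degree (F a) \<le> d" "\<And>a. degree (G a) \<le> e"
    using assms by (metis poly_family_degree)
  then have "degree (if Q a then F a else G a) \<le> max d e" for a
    by (simp add: le_max_iff_disj)
  then show ?thesis
  proof (rule poly_familyI)
    fix k
    have "(\<lambda>a. if Q a then coeff (F a) k else coeff (G a) k) \<in> cfun J"
      by (intro cfun_if assms poly_family_coeff)
    then show "(\<lambda>a. coeff (if Q a then F a else G a) k) \<in> cfun J"
      by (simp add: if_distrib[of "\<lambda>p. coeff p k"])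
  qed
qed

lemma constructible_family_zero:
  assumes "F \<in> poly_family (cfun J)"
  shows "constructible J (\<lambda>a. F a = 0)"
proof -
  obtain d where d: "\<And>a. degree (F a) \<le> d"
    using assms by (metis poly_family_degree)
  have "F a = 0 \<longleftrightarrow> (\<forall>i\<in>{..d}. coeff (F a) i = 0)" for a
    using d[of a] by (metis atMost_iff coeff_0 leading_coeff_0_iff)
  moreover have "constructible J (\<lambda>a. \<forall>i\<in>{..d}. coeff (F a) i = 0)"
    by (intro constructible_ball constructible_zero poly_family_coeff assms) auto
  ultimately show ?thesis by simp
qed

lemma constructible_degree:
  assumes "F \<in> poly_family (cfun J)"
  shows "constructible J (\<lambda>a. degree (F a) = k)"
proof -
  obtain d where d: "\<And>a. degree (F a) \<le> d"
    using assms by (metis poly_family_degree)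
  have "degree (F a) = k \<longleftrightarrow> (\<forall>i\<in>{k<..d}. coeff (F a) i = 0) \<and> (k = 0 \<or> \<not> coeff (F a) k = 0)" for a
  proof
    assume "degree (F a) = k"
    then show "(\<forall>i\<in>{k<..d}. coeff (F a) i = 0) \<and> (k = 0 \<or> \<not> coeff (F a) k = 0)"
      by (auto simp: coeff_eq_0)
  next
    assume *: "(\<forall>i\<in>{k<..d}. coeff (F a) i = 0) \<and> (k = 0 \<or> \<not> coeff (F a) k = 0)"
    then have "degree (F a) \<le> k"
    proof (intro degree_le allI impI)
      fix i assume "k < i"
      with * d[of a] show "coeff (F a) i = 0" by (cases "i \<le> d") (auto intro: coeff_eq_0)
    qed
    moreover have "k \<le> degree (F a)"
      using * by (auto intro: le_degree)
    ultimately show "degree (F a) = k" by simp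
  qed
  moreover have "constructible J (\<lambda>a. (\<forall>i\<in>{k<..d}. coeff (F a) i = 0) \<and> (k = 0 \<or> \<not> coeff (F a) k = 0))"
    by (intro constructible_conj constructible_disj constructible_ball constructible_zero constructible_not
        constructible_fixed poly_family_coeff assms) auto
  ultimately show ?thesis by simp
qed

text \<open>Degrees jump with the parameter. As \<open>N\<close> takes finitely many values, each on
  a constructible set, a choice depending on it is a finite sum of case distinctions.\<close>

lemma family_select:
  assumes "\<And>a. N a \<le> (d::nat)" "\<And>k. constructible J (\<lambda>a. N a = k)" "\<And>k. F k \<in> poly_family (cfun J)"
  shows "(\<lambda>a. F (N a) a) \<in> poly_family (cfun J)"
proof -
  have "(\<lambda>a. \<Sum>k\<le>d. if N a = k then F k a else 0) \<in> poly_family (cfun J)"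
    by (intro cfun.family_sum family_if assms cfun.family_fixed)
  also have "(\<lambda>a. \<Sum>k\<le>d. if N a = k then F k a else 0) = (\<lambda>a. F (N a) a)"
    using assms(1) by (auto simp: fun_eq_iff)
  finally show ?thesis .
qed

lemma family_lead_coeff:
  assumes "F \<in> poly_family (cfun J)"
  shows "(\<lambda>a. lead_coeff (F a)) \<in> cfun J"
proof -
  obtain d where d: "\<And>a. degree (F a) \<le> d"
    using assms by (metis poly_family_degree)
  have "(\<lambda>a. [:coeff (F a) (degree (F a)):]) \<in> poly_family (cfun J)"
    by (rule family_select[OF d constructible_degree[OF assms], of "\<lambda>k a. [:coeff (F a) k:]"])
      (intro cfun.family_const poly_family_coeff assms)
  from poly_family_coeff[OF this, of 0] show ?thesis by simp
qed

lemma degree_reduce_less: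
  fixes f g :: "complex poly"
  assumes "g \<noteq> 0" "degree g \<le> degree f" "i \<ge> degree f"
  shows "coeff (f - monom (lead_coeff f / lead_coeff g) (degree f - degree g) * g) i = 0"
proof (cases "i = degree f")
  case True
  with assms show ?thesis by (simp add: coeff_monom_mult)
next
  case False
  with assms have "i > degree f" "i - (degree f - degree g) > degree g" by auto
  then show ?thesis by (simp add: coeff_monom_mult coeff_eq_0)
qed

text \<open>Long division, carried out for all parameters simultaneously. The induction is on a
  bound \<open>B\<close> for the degrees of all dividends, because individual parameters finish at
  different stages; those already finished are frozen by \<open>stop\<close>.\<close>

lemma family_div_mod:
  assumes G: "G \<in> poly_family (cfun J)" and "F \<in> poly_family (cfun J)"
  shows "(\<lambda>a. F a div G a) \<in> poly_family (cfun J) \<and> (\<lambda>a. F a mod G a) \<in> poly_family (cfun J)"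
proof -
  have "(\<forall>a. \<forall>i\<ge>B. coeff (F a) i = 0) \<longrightarrow> ?thesis" for B
    using assms(2)
  proof (induction B arbitrary: F)
    case 0
    show ?case
    proof
      assume "\<forall>a. \<forall>i\<ge>0. coeff (F a) i = 0"
      then have "F = (\<lambda>_. 0)" by (auto simp: fun_eq_iff poly_eq_iff)
      then show "(\<lambda>a. F a div G a) \<in> poly_family (cfun J) \<and> (\<lambda>a. F a mod G a) \<in> poly_family (cfun J)"
        by (simp add: cfun.family_fixed)
    qed
  next
    case (Suc B)
    define stop where "stop a \<longleftrightarrow> G a = 0 \<or> degree (F a) < degree (G a)" for a
    define H where "H a = monom (lead_coeff (F a) / lead_coeff (G a)) (degree (F a) - degree (G a))" for a
    define F' where "F' a = (if stop a then 0 else F a - H a * G a)" for a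
    obtain d e where d: "\<And>a. degree (F a) \<le> d" "\<And>a. degree (G a) \<le> e"
      using Suc.prems G by (metis poly_family_degree)
    have stop: "constructible J stop"
    proof -
      have "stop = (\<lambda>a. G a = 0 \<or> (\<exists>i\<in>{..d}. \<exists>j\<in>{..e}. (degree (F a) = i \<and> degree (G a) = j) \<and> i < j))"
        using d by (auto simp: stop_def fun_eq_iff)
      moreover have "constructible J \<dots>"
        by (intro constructible_disj constructible_family_zero constructible_bex constructible_conj
            constructible_degree constructible_fixed G Suc.prems) auto
      ultimately show ?thesis by simp
    qed
    have cd: "constructible J (\<lambda>a. degree (F a) - degree (G a) = k)" for k
    proof -
      have "(\<lambda>a. degree (F a) - degree (G a) = k) =
        (\<lambda>a. \<exists>i\<in>{..d}. \<exists>j\<in>{..e}. (degree (F a) = i \<and> degree (G a) = j) \<and> i - j = k)"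
        using d by (auto simp: fun_eq_iff)
      moreover have "constructible J \<dots>"
        by (intro constructible_bex constructible_conj constructible_degree constructible_fixed G Suc.prems) auto
      ultimately show ?thesis by simp
    qed
    have bd: "degree (F a) - degree (G a) \<le> d" for a using d(1)[of a] by simp
    have H: "H \<in> poly_family (cfun J)"
      unfolding H_def
      by (rule family_select[where F = "\<lambda>k a. monom (lead_coeff (F a) / lead_coeff (G a)) k", OF bd cd])
        (intro cfun.family_monom cfun_divide family_lead_coeff G Suc.prems)
    have F': "F' \<in> poly_family (cfun J)"
      unfolding F'_def
      by (intro family_if stop cfun.family_fixed cfun.family_diff cfun.family_mult H G Suc.prems)
    show ?case
    proof
      assume B: "\<forall>a. \<forall>i\<ge>Suc B. coeff (F a) i = 0"
      have "coeff (F' a) i = 0" if "i \<ge> B" for a i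
      proof (cases "stop a")
        case False
        have "degree (F a) \<le> B"
          using B by (intro degree_le) (auto simp: Suc_le_eq)
        with False that show ?thesis
          using degree_reduce_less[of "G a" "F a" i] by (auto simp: F'_def H_def stop_def)
      qed (simp add: F'_def)
      with Suc.IH[OF F'] have IH: "(\<lambda>a. F' a div G a) \<in> poly_family (cfun J)" "(\<lambda>a. F' a mod G a) \<in> poly_family (cfun J)"
        by auto
      have eq: "F a = F' a + H a * G a" if "\<not> stop a" for a using that by (simp add: F'_def)
      have "(\<lambda>a. F a div G a) = (\<lambda>a. if stop a then 0 else H a + F' a div G a)"
      proof
        fix a
        show "F a div G a = (if stop a then 0 else H a + F' a div G a)"
        proof (cases "stop a")
          case True
          then show ?thesis by (auto simp: stop_def div_poly_less)
        next
          case False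
          then show ?thesis using eq[OF False] by (simp add: stop_def)
        qed
      qed
      moreover have "(\<lambda>a. F a mod G a) = (\<lambda>a. if stop a then F a else F' a mod G a)"
      proof
        fix a
        show "F a mod G a = (if stop a then F a else F' a mod G a)"
        proof (cases "stop a")
          case True
          then show ?thesis by (auto simp: stop_def mod_poly_less)
        next
          case False
          then show ?thesis using eq[OF False] by simp
        qed
      qed
      ultimately show "(\<lambda>a. F a div G a) \<in> poly_family (cfun J) \<and> (\<lambda>a. F a mod G a) \<in> poly_family (cfun J)"
        using IH by (auto intro!: family_if stop cfun.family_fixed cfun.family_add H Suc.prems)
    qed
  qed
  moreover obtain d where d: "\<And>a. degree (F a) \<le> d"
    using assms by (metis poly_family_degree)
  have "\<forall>a. \<forall>i\<ge>Suc d. coeff (F a) i = 0"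
  proof (intro allI impI)
    fix a i assume "Suc d \<le> i"
    with d[of a] show "coeff (F a) i = 0" by (intro coeff_eq_0) simp
  qed
  ultimately show ?thesis by blast
qed

lemmas family_div = family_div_mod[THEN conjunct1]
lemmas family_mod = family_div_mod[THEN conjunct2]

text \<open>The Euclidean algorithm, uniform in the parameter. Only \<open>D\<close> has to be
  constructible in \<open>a\<close>; the cofactors are asked for pointwise, which is enough to pass
  common zeros of \<open>F a\<close> and \<open>G a\<close> on to \<open>D a\<close>.\<close>

lemma family_bezout:
  assumes "F \<in> poly_family (cfun J)" "G \<in> poly_family (cfun J)"
  shows "\<exists>D\<in>poly_family (cfun J). \<forall>a. D a dvd F a \<and> D a dvd G a \<and> (\<exists>u v. D a = u * F a + v * G a)"
proof -
  have "(\<forall>a. \<forall>i\<ge>B. coeff (G a) i = 0) \<longrightarrow> ?thesis" for B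
    using assms
  proof (induction B arbitrary: F G)
    case 0
    show ?case
    proof
      assume "\<forall>a. \<forall>i\<ge>0. coeff (G a) i = 0"
      then have "G = (\<lambda>_. 0)" by (auto simp: fun_eq_iff poly_eq_iff)
      then show "\<exists>D\<in>poly_family (cfun J). \<forall>a. D a dvd F a \<and> D a dvd G a \<and> (\<exists>u v. D a = u * F a + v * G a)"
        using 0 by (intro bexI[of _ F]) (auto intro: exI[of _ 1])
    qed
  next
    case (Suc B)
    \<comment> \<open>\<open>F a mod 0\<close> would be \<open>F a\<close> again; the value
      \<open>0\<close> keeps the degree bound decreasing at parameters where the algorithm has
      stopped.\<close>
    define H where "H a = (if G a = 0 then 0 else F a mod G a)" for a
    have H: "H \<in> poly_family (cfun J)"
      unfolding H_def
      by (intro family_if constructible_family_zero cfun.family_fixed family_mod Suc.prems)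
    show ?case
    proof
      assume B: "\<forall>a. \<forall>i\<ge>Suc B. coeff (G a) i = 0"
      have "coeff (H a) i = 0" if "i \<ge> B" for a i
      proof (cases "G a = 0 \<or> H a = 0")
        case False
        then have "degree (H a) < degree (G a)"
          using degree_mod_less[of "G a" "F a"] by (auto simp: H_def)
        also have "degree (G a) \<le> B"
          using B by (intro degree_le) (auto simp: Suc_le_eq)
        finally show ?thesis using that by (simp add: coeff_eq_0)
      qed (auto simp: H_def)
      with Suc.IH[OF Suc.prems(2) H] obtain D where D: "D \<in> poly_family (cfun J)"
        "\<And>a. D a dvd G a \<and> D a dvd H a \<and> (\<exists>u v. D a = u * G a + v * H a)" by blast
      define E where "E a = (if G a = 0 then F a else D a)" for a
      have E: "E \<in> poly_family (cfun J)"
        unfolding E_def by (intro family_if constructible_family_zero D Suc.prems)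
      have "E a dvd F a \<and> E a dvd G a \<and> (\<exists>u v. E a = u * F a + v * G a)" for a
      proof (cases "G a = 0")
        case True
        then show ?thesis by (auto simp: E_def intro: exI[of _ 1])
      next
        case False
        obtain u v where "D a = u * G a + v * H a" using D(2) by blast
        also have "H a = F a - (F a div G a) * G a"
          using False by (simp add: H_def minus_div_mult_eq_mod)
        finally have "D a = v * F a + (u - v * (F a div G a)) * G a"
          by (simp add: algebra_simps)
        moreover have "D a dvd F a"
          using D(2)[of a] False dvd_mod_imp_dvd[of "D a" "F a" "G a"] by (simp add: H_def)
        ultimately show ?thesis using D(2)[of a] False by (auto simp: E_def)
      qed
      with E show "\<exists>D\<in>poly_family (cfun J). \<forall>a. D a dvd F a \<and> D a dvd G a \<and> (\<exists>u v. D a = u * F a + v * G a)"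
        by blast
    qed
  qed
  moreover obtain d where d: "\<And>a. degree (G a) \<le> d"
    using assms by (metis poly_family_degree)
  have "\<forall>a. \<forall>i\<ge>Suc d. coeff (G a) i = 0"
  proof (intro allI impI)
    fix a i assume "Suc d \<le> i"
    with d[of a] show "coeff (G a) i = 0" by (intro coeff_eq_0) simp
  qed
  ultimately show ?thesis by blast
qed

lemma family_common_zeros:
  assumes "finite T" "T \<subseteq> poly_family (cfun J)"
  shows "\<exists>D\<in>poly_family (cfun J). \<forall>a. (D a = 0 \<longleftrightarrow> (\<forall>p\<in>T. p a = 0)) \<and>
    (\<forall>t. poly (D a) t = 0 \<longleftrightarrow> (\<forall>p\<in>T. poly (p a) t = 0))"
  using assms
proof (induction T rule: finite_induct)
  case empty
  show ?case by (rule bexI[of _ "\<lambda>_. 0"]) (auto intro: cfun.family_fixed)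
next
  case (insert p T)
  then obtain D where D: "D \<in> poly_family (cfun J)" "\<And>a. D a = 0 \<longleftrightarrow> (\<forall>p\<in>T. p a = 0)"
    "\<And>a t. poly (D a) t = 0 \<longleftrightarrow> (\<forall>p\<in>T. poly (p a) t = 0)" by auto
  obtain E where E: "E \<in> poly_family (cfun J)"
    "\<And>a. E a dvd p a \<and> E a dvd D a \<and> (\<exists>u v. E a = u * p a + v * D a)"
    using family_bezout[of p J D] D(1) insert.prems by auto
  have "E a = 0 \<longleftrightarrow> p a = 0 \<and> D a = 0" "poly (E a) t = 0 \<longleftrightarrow> poly (p a) t = 0 \<and> poly (D a) t = 0" for a t
  proof -
    obtain u v where uv: "E a = u * p a + v * D a" using E(2) by blast
    show "E a = 0 \<longleftrightarrow> p a = 0 \<and> D a = 0" using E(2)[of a] uv by auto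
    show "poly (E a) t = 0 \<longleftrightarrow> poly (p a) t = 0 \<and> poly (D a) t = 0"
    proof
      obtain k l where "p a = E a * k" "D a = E a * l" using E(2)[of a] unfolding dvd_def by blast
      then show "poly (E a) t = 0 \<Longrightarrow> poly (p a) t = 0 \<and> poly (D a) t = 0" by simp
      show "poly (p a) t = 0 \<and> poly (D a) t = 0 \<Longrightarrow> poly (E a) t = 0" by (simp add: uv)
    qed
  qed
  with D E show ?case by (intro bexI[of _ E]) auto
qed

lemma card_roots_rsquarefree:
  fixes p :: "complex poly"
  assumes "rsquarefree p"
  shows "card {t. poly p t = 0} = degree p"
proof -
  have "p \<noteq> 0" using assms by (simp add: rsquarefree_def)
  then have "degree p = degree (\<Prod>z|poly p z = 0. [:- z, 1:])"
    using complex_poly_decompose_rsquarefree[OF assms]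
    by (metis degree_smult_eq leading_coeff_0_iff)
  also have "\<dots> = card {t. poly p t = 0}"
    by (subst degree_prod_sum_eq) auto
  finally show ?thesis ..
qed

text \<open>The quotient of \<open>D a\<close> by its gcd with its derivative has the same zeros,
  all simple, so that its degree counts them.\<close>

lemma family_squarefree:
  assumes D: "D \<in> poly_family (cfun J)"
  shows "\<exists>R\<in>poly_family (cfun J). \<forall>a. D a \<noteq> 0 \<longrightarrow>
    rsquarefree (R a) \<and> (\<forall>t. poly (R a) t = 0 \<longleftrightarrow> poly (D a) t = 0)"
proof -
  obtain B where B: "B \<in> poly_family (cfun J)"
    "\<And>a. B a dvd D a \<and> B a dvd pderiv (D a) \<and> (\<exists>u v. B a = u * D a + v * pderiv (D a))"
    using family_bezout[OF D cfun.family_pderiv[OF D]] by blast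
  \<comment> \<open>A nonzero polynomial with zero derivative is constant and has no zeros; it is
    represented by \<open>1\<close>.\<close>
  define R where "R a = (if pderiv (D a) = 0 then 1 else D a div B a)" for a
  have "R \<in> poly_family (cfun J)"
    unfolding R_def
    by (intro family_if constructible_family_zero cfun.family_fixed family_div cfun.family_pderiv B D)
  moreover have "rsquarefree (R a) \<and> (\<forall>t. poly (R a) t = 0 \<longleftrightarrow> poly (D a) t = 0)" if "D a \<noteq> 0" for a
  proof (cases "pderiv (D a) = 0")
    case True
    then obtain c where "D a = [:c:]" using pderiv_iszero by blast
    with that True show ?thesis by (auto simp: R_def rsquarefree_roots)
  next
    case False
    obtain u v where uv: "B a = u * D a + v * pderiv (D a)" using B(2) by blast
    from B(2)[of a] have "D a = (D a div B a) * B a" "pderiv (D a) = (pderiv (D a) div B a) * B a"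
      by (simp_all)
    from poly_squarefree_decomp[OF False this uv] False show ?thesis by (simp add: R_def)
  qed
  ultimately show ?thesis by blast
qed

text \<open>The zeros of \<open>R a\<close> being simple, division by the gcd with
  \<open>Q a\<close> removes exactly those shared with \<open>Q a\<close>.\<close>

lemma family_remove_zeros:
  assumes R: "R \<in> poly_family (cfun J)" and Q: "Q \<in> poly_family (cfun J)"
  shows "\<exists>E\<in>poly_family (cfun J). \<forall>a. rsquarefree (R a) \<longrightarrow>
    rsquarefree (E a) \<and> (\<forall>t. poly (E a) t = 0 \<longleftrightarrow> poly (R a) t = 0 \<and> poly (Q a) t \<noteq> 0)"
proof -
  obtain B where B: "B \<in> poly_family (cfun J)"
    "\<And>a. B a dvd R a \<and> B a dvd Q a \<and> (\<exists>u v. B a = u * R a + v * Q a)"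
    using family_bezout[OF R Q] by blast
  have "rsquarefree (R a div B a) \<and>
      (\<forall>t. poly (R a div B a) t = 0 \<longleftrightarrow> poly (R a) t = 0 \<and> poly (Q a) t \<noteq> 0)" if "rsquarefree (R a)" for a
  proof -
    define E where "E = R a div B a"
    have RE: "R a = E * B a" using B(2)[of a] by (simp add: E_def)
    have sf: "\<not> (poly (R a) t = 0 \<and> poly (pderiv (R a)) t = 0)" for t
      using that by (simp add: rsquarefree_roots)
    have pd: "pderiv (R a) = E * pderiv (B a) + B a * pderiv E" unfolding RE by (simp add: pderiv_mult)
    obtain u v where uv: "B a = u * R a + v * Q a" using B(2) by blast
    have "rsquarefree E"
      unfolding rsquarefree_roots using sf pd RE by (metis add_0 mult_zero_left mult_zero_right poly_add poly_mult)
    moreover have "poly E t = 0 \<longleftrightarrow> poly (R a) t = 0 \<and> poly (Q a) t \<noteq> 0" for t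
    proof
      assume 0: "poly E t = 0"
      then have Rt: "poly (R a) t = 0" by (simp add: RE)
      have "poly (B a) t \<noteq> 0" using sf[of t] Rt 0 by (auto simp: pd)
      then show "poly (R a) t = 0 \<and> poly (Q a) t \<noteq> 0" using uv Rt by auto
    next
      assume *: "poly (R a) t = 0 \<and> poly (Q a) t \<noteq> 0"
      obtain k where "Q a = B a * k" using B(2)[of a] unfolding dvd_def by blast
      with * have "poly (B a) t \<noteq> 0" by auto
      with * RE show "poly E t = 0" by simp
    qed
    ultimately show ?thesis by (simp add: E_def)
  qed
  moreover have "(\<lambda>a. R a div B a) \<in> poly_family (cfun J)"
    by (intro family_div R B)
  ultimately show ?thesis by (intro bexI[of _ "\<lambda>a. R a div B a"]) auto
qed

section \<open>Elimination of one variable\<close>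

lemma family_locus:
  assumes "finite T" "T \<subseteq> poly_family (cfun J)" "Q \<in> poly_family (cfun J)"
  shows "\<exists>E\<in>poly_family (cfun J). \<forall>a. (\<exists>p\<in>T. p a \<noteq> 0) \<longrightarrow>
    rsquarefree (E a) \<and> (\<forall>t. poly (E a) t = 0 \<longleftrightarrow> (\<forall>p\<in>T. poly (p a) t = 0) \<and> poly (Q a) t \<noteq> 0)"
proof -
  obtain D where D: "D \<in> poly_family (cfun J)" "\<And>a. D a = 0 \<longleftrightarrow> (\<forall>p\<in>T. p a = 0)"
    "\<And>a t. poly (D a) t = 0 \<longleftrightarrow> (\<forall>p\<in>T. poly (p a) t = 0)"
    using family_common_zeros[OF assms(1,2)] by blast
  obtain R where R: "R \<in> poly_family (cfun J)" "\<And>a. D a \<noteq> 0 \<Longrightarrow>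
    rsquarefree (R a) \<and> (\<forall>t. poly (R a) t = 0 \<longleftrightarrow> poly (D a) t = 0)"
    using family_squarefree[OF D(1)] by blast
  obtain E where E: "E \<in> poly_family (cfun J)" "\<And>a. rsquarefree (R a) \<Longrightarrow>
    rsquarefree (E a) \<and> (\<forall>t. poly (E a) t = 0 \<longleftrightarrow> poly (R a) t = 0 \<and> poly (Q a) t \<noteq> 0)"
    using family_remove_zeros[OF R(1) assms(3)] by blast
  show ?thesis
    using D R(2) E by (intro bexI[of _ E]) auto
qed

text \<open>For a fixed stratum, the condition on \<open>t\<close> consists of finitely many
  equations, and of inequations that are merged into one by multiplication. The strata are disjoint,
  so solutions can be counted stratum by stratum.\<close>

lemma constructible_fiber_loci:
  assumes "constructible (insert y J) Q"
  obtains I P T S where "finite (I :: (('x \<Rightarrow> complex) \<Rightarrow> complex) set set)"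
    "\<And>b. Q b \<longleftrightarrow> zero_pattern P b \<in> I"
    "\<And>i. finite (T i)" "\<And>i. T i \<subseteq> poly_family (cfun J)" "\<And>i. S i \<in> poly_family (cfun J)"
    "\<And>i a t. i \<in> I \<Longrightarrow> zero_pattern P (a(y := t)) = i \<longleftrightarrow>
       (\<forall>p\<in>T i. poly (p a) t = 0) \<and> poly (S i a) t \<noteq> 0"
proof -
  obtain P where P: "finite P" "P \<subseteq> polyfun (insert y J)"
    "\<And>a b. zero_pattern P a = zero_pattern P b \<Longrightarrow> Q a = Q b"
    using constructible_pattern[OF assms] by blast
  have "\<exists>F\<in>poly_family (polyfun J). \<forall>a t. p (a(y := t)) = poly (F a) t" if "p \<in> P" for p
    using polyfun_upd_family[of p y J] P(2) that by blast
  then obtain F where F: "\<And>p. p \<in> P \<Longrightarrow> F p \<in> poly_family (polyfun J)"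
    "\<And>p a t. p \<in> P \<Longrightarrow> p (a(y := t)) = poly (F p a) t" by metis
  have F': "F p \<in> poly_family (cfun J)" if "p \<in> P" for p
    using F(1)[OF that] poly_family_mono[OF polyfun_subset_cfun] by blast
  define I where "I = {i. i \<subseteq> P \<and> (\<exists>b. zero_pattern P b = i \<and> Q b)}"
  define T where "T i = F ` (i \<inter> P)" for i
  define S where "S i a = (\<Prod>p\<in>P - i. F p a)" for i a
  show ?thesis
  proof (rule that[of I P T S])
    show "finite I" by (rule finite_subset[of _ "Pow P"]) (auto simp: I_def P(1))
    show "Q b \<longleftrightarrow> zero_pattern P b \<in> I" for b
    proof -
      have "zero_pattern P b \<subseteq> P" by (auto simp: zero_pattern_def)
      then show ?thesis unfolding I_def using P(3) by blast
    qed
    show "finite (T i)" for i using P(1) by (simp add: T_def)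
    show "T i \<subseteq> poly_family (cfun J)" for i using F' by (auto simp: T_def)
    show "S i \<in> poly_family (cfun J)" for i
      unfolding S_def by (intro cfun.family_prod F') auto
    show "zero_pattern P (a(y := t)) = i \<longleftrightarrow> (\<forall>p\<in>T i. poly (p a) t = 0) \<and> poly (S i a) t \<noteq> 0"
      if "i \<in> I" for i a t
    proof -
      have iP: "i \<subseteq> P" using that by (simp add: I_def)
      have "zero_pattern P (a(y := t)) = i \<longleftrightarrow>
          (\<forall>p\<in>i. p (a(y := t)) = 0) \<and> (\<forall>p\<in>P - i. p (a(y := t)) \<noteq> 0)"
        using iP unfolding zero_pattern_def by blast
      also have "(\<forall>p\<in>i. p (a(y := t)) = 0) \<longleftrightarrow> (\<forall>p\<in>i. poly (F p a) t = 0)"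
        by (rule ball_cong[OF refl]) (use iP F(2) in auto)
      also have "\<dots> \<longleftrightarrow> (\<forall>p\<in>T i. poly (p a) t = 0)"
        using iP by (auto simp: T_def)
      also have "(\<forall>p\<in>P - i. p (a(y := t)) \<noteq> 0) \<longleftrightarrow> (\<forall>p\<in>P - i. poly (F p a) t \<noteq> 0)"
        by (rule ball_cong[OF refl]) (use F(2) in auto)
      also have "\<dots> \<longleftrightarrow> poly (S i a) t \<noteq> 0"
        using P(1) by (auto simp: S_def poly_prod)
      finally show ?thesis .
    qed
  qed
qed

text \<open>Chevalley's theorem for one variable. If the equations of a stratum vanish identically
  at \<open>a\<close>, a solution exists iff the polynomial of the inequation is nonzero; otherwise
  the solutions are the roots of a squarefree polynomial and exist iff its degree is positive. Both
  criteria concern coefficients only.\<close>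

lemma constructible_ex:
  assumes "constructible (insert y J) Q"
  shows "constructible J (\<lambda>a. \<exists>t. Q (a(y := t)))"
proof -
  obtain I P T S where I: "finite (I :: (('a \<Rightarrow> complex) \<Rightarrow> complex) set set)"
    "\<And>b. Q b \<longleftrightarrow> zero_pattern P b \<in> I"
    and T: "\<And>i. finite (T i)" "\<And>i. T i \<subseteq> poly_family (cfun J)"
    and S: "\<And>i. S i \<in> poly_family (cfun J)"
    and TS: "\<And>i a t. i \<in> I \<Longrightarrow> zero_pattern P (a(y := t)) = i \<longleftrightarrow>
       (\<forall>p\<in>T i. poly (p a) t = 0) \<and> poly (S i a) t \<noteq> 0"
    by (rule constructible_fiber_loci[OF assms]) (rule that; assumption)
  have "constructible J (\<lambda>a. \<exists>t. (\<forall>p\<in>T i. poly (p a) t = 0) \<and> poly (S i a) t \<noteq> 0)" for i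
  proof -
    obtain E where E: "E \<in> poly_family (cfun J)" "\<And>a. \<exists>p\<in>T i. p a \<noteq> 0 \<Longrightarrow>
      rsquarefree (E a) \<and> (\<forall>t. poly (E a) t = 0 \<longleftrightarrow> (\<forall>p\<in>T i. poly (p a) t = 0) \<and> poly (S i a) t \<noteq> 0)"
      using family_locus[OF T[of i] S[of i]] by blast
    have "(\<exists>t. (\<forall>p\<in>T i. poly (p a) t = 0) \<and> poly (S i a) t \<noteq> 0) \<longleftrightarrow>
      (\<forall>p\<in>T i. p a = 0) \<and> \<not> S i a = 0 \<or> \<not> (\<forall>p\<in>T i. p a = 0) \<and> \<not> degree (E a) = 0" for a
    proof (cases "\<forall>p\<in>T i. p a = 0")
      case True
      have "poly (p a) t = 0" if "p \<in> T i" for p t using bspec[OF True that] by simp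
      then have "(\<exists>t. (\<forall>p\<in>T i. poly (p a) t = 0) \<and> poly (S i a) t \<noteq> 0) \<longleftrightarrow> (\<exists>t. poly (S i a) t \<noteq> 0)"
        by blast
      also have "\<dots> \<longleftrightarrow> S i a \<noteq> 0" using poly_all_0_iff_0[of "S i a"] by blast
      finally show ?thesis using True by blast
    next
      case False
      then have *: "rsquarefree (E a)"
        "\<And>t. poly (E a) t = 0 \<longleftrightarrow> (\<forall>p\<in>T i. poly (p a) t = 0) \<and> poly (S i a) t \<noteq> 0"
        using E(2)[of a] by auto
      have "finite {t. poly (E a) t = 0}"
        using *(1) by (simp add: rsquarefree_def poly_roots_finite)
      then have "degree (E a) \<noteq> 0 \<longleftrightarrow> (\<exists>t. poly (E a) t = 0)"
        by (subst card_roots_rsquarefree[OF *(1), symmetric]) (auto simp: card_eq_0_iff)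
      with False show ?thesis using *(2) by auto
    qed
    moreover have "constructible J (\<lambda>a. (\<forall>p\<in>T i. p a = 0) \<and> \<not> S i a = 0 \<or>
        \<not> (\<forall>p\<in>T i. p a = 0) \<and> \<not> degree (E a) = 0)"
      by (intro constructible_disj constructible_conj constructible_not constructible_ball
          constructible_family_zero constructible_degree T S E subsetD[OF T(2)])
    ultimately show ?thesis by simp
  qed
  from constructible_bex[OF I(1) this]
  have "constructible J (\<lambda>a. \<exists>i\<in>I. \<exists>t. (\<forall>p\<in>T i. poly (p a) t = 0) \<and> poly (S i a) t \<noteq> 0)" .
  moreover have "(\<exists>t. Q (a(y := t))) \<longleftrightarrow> (\<exists>i\<in>I. \<exists>t. (\<forall>p\<in>T i. poly (p a) t = 0) \<and> poly (S i a) t \<noteq> 0)" for a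
  proof -
    have "(\<exists>t. Q (a(y := t))) \<longleftrightarrow> (\<exists>i\<in>I. \<exists>t. zero_pattern P (a(y := t)) = i)"
      unfolding I(2) by blast
    also have "\<dots> \<longleftrightarrow> (\<exists>i\<in>I. \<exists>t. (\<forall>p\<in>T i. poly (p a) t = 0) \<and> poly (S i a) t \<noteq> 0)"
      by (intro bex_cong[OF refl] arg_cong[of _ _ Ex] ext TS)
    finally show ?thesis .
  qed
  ultimately show ?thesis by presburger
qed

theorem constructible_projection:
  assumes "finite K" "constructible (J \<union> K) Q"
  shows "constructible J (\<lambda>a. \<exists>f. Q (override_on a f K))"
  using assms
proof (induction K arbitrary: J rule: finite_induct)
  case empty
  then show ?case by simp
next
  case (insert y K)
  have "constructible (insert y J \<union> K) Q" using insert.prems by simp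
  from constructible_ex[OF insert.IH[OF this]]
  have "constructible J (\<lambda>a. \<exists>t f. Q (override_on (a(y := t)) f K))" .
  moreover have "(\<exists>t f. Q (override_on (a(y := t)) f K)) \<longleftrightarrow> (\<exists>f. Q (override_on a f (insert y K)))" for a
  proof
    assume "\<exists>t f. Q (override_on (a(y := t)) f K)"
    then obtain t f where "Q (override_on (a(y := t)) f K)" by blast
    moreover have "override_on (a(y := t)) f K = override_on a (f(y := t)) (insert y K)"
      using insert.hyps by (auto simp: override_on_def fun_eq_iff)
    ultimately show "\<exists>f. Q (override_on a f (insert y K))" by metis
  next
    assume "\<exists>f. Q (override_on a f (insert y K))"
    then obtain f where "Q (override_on a f (insert y K))" by blast
    moreover have "override_on (a(y := f y)) f K = override_on a f (insert y K)"
      by (auto simp: override_on_def fun_eq_iff)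
    ultimately show "\<exists>t f. Q (override_on (a(y := t)) f K)" by metis
  qed
  ultimately show ?case by simp
qed

text \<open>The product of the squarefree polynomials of all strata has one simple root for each
  point of a finite section; its coefficients later become those of a relation of the least possible
  degree.\<close>

lemma constructible_sections_family:
  assumes "constructible (insert y J) Q"
  shows "\<exists>E\<in>poly_family (cfun J). \<forall>a. E a \<noteq> 0 \<and> (finite {t. Q (a(y := t))} \<longrightarrow>
    (\<forall>t. Q (a(y := t)) \<longrightarrow> poly (E a) t = 0) \<and> degree (E a) = card {t. Q (a(y := t))})"
proof -
  obtain I P T S where I: "finite (I :: (('a \<Rightarrow> complex) \<Rightarrow> complex) set set)"
    "\<And>b. Q b \<longleftrightarrow> zero_pattern P b \<in> I"
    and T: "\<And>i. finite (T i)" "\<And>i. T i \<subseteq> poly_family (cfun J)"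
    and S: "\<And>i. S i \<in> poly_family (cfun J)"
    and TS: "\<And>i a t. i \<in> I \<Longrightarrow> zero_pattern P (a(y := t)) = i \<longleftrightarrow>
       (\<forall>p\<in>T i. poly (p a) t = 0) \<and> poly (S i a) t \<noteq> 0"
    by (rule constructible_fiber_loci[OF assms]) (rule that; assumption)
  have "\<forall>i. \<exists>E. E \<in> poly_family (cfun J) \<and> (\<forall>a. (\<exists>p\<in>T i. p a \<noteq> 0) \<longrightarrow>
      rsquarefree (E a) \<and> (\<forall>t. poly (E a) t = 0 \<longleftrightarrow> (\<forall>p\<in>T i. poly (p a) t = 0) \<and> poly (S i a) t \<noteq> 0))"
    using family_locus[OF T S] unfolding Bex_def by (intro allI)
  from choice[OF this] obtain E where E0: "\<forall>i. E i \<in> poly_family (cfun J) \<and> (\<forall>a. (\<exists>p\<in>T i. p a \<noteq> 0) \<longrightarrow>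
      rsquarefree (E i a) \<and> (\<forall>t. poly (E i a) t = 0 \<longleftrightarrow> (\<forall>p\<in>T i. poly (p a) t = 0) \<and> poly (S i a) t \<noteq> 0))" ..
  have E1: "E i \<in> poly_family (cfun J)" for i
    using spec[OF E0, of i] by (rule conjunct1)
  have E2: "rsquarefree (E i a) \<and> (\<forall>t. poly (E i a) t = 0 \<longleftrightarrow> (\<forall>p\<in>T i. poly (p a) t = 0) \<and> poly (S i a) t \<noteq> 0)"
    if "\<exists>p\<in>T i. p a \<noteq> 0" for i a
    using spec[OF conjunct2[OF spec[OF E0, of i]], of a] that by (rule mp)
  \<comment> \<open>Where the equations are all vacuous, the stratum is empty or cofinite in the
    line; in a finite section it is empty, in agreement with the rootless value
    \<open>1\<close>.\<close>
  define G where "G i a = (if \<forall>p\<in>T i. p a = 0 then 1 else E i a)" for i a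
  have G: "G i \<in> poly_family (cfun J)" for i
    unfolding G_def
    by (intro family_if constructible_ball constructible_family_zero cfun.family_fixed T E1 subsetD[OF T(2)])
  have sf: "rsquarefree (G i a)" for i a
  proof (cases "\<forall>p\<in>T i. p a = 0")
    case False
    then have "rsquarefree (E i a)" by (intro E2[THEN conjunct1]) blast
    then show ?thesis unfolding G_def if_not_P[OF False] .
  qed (simp add: G_def rsquarefree_roots)
  have nz: "G i a \<noteq> 0" for i a using sf[of i a] by (simp add: rsquarefree_def)
  have main: "(\<forall>t. Q (a(y := t)) \<longrightarrow> poly (\<Prod>i\<in>I. G i a) t = 0) \<and>
      degree (\<Prod>i\<in>I. G i a) = card {t. Q (a(y := t))}" if fin: "finite {t. Q (a(y := t))}" for a
  proof -
    have roots: "{t. poly (G i a) t = 0} = {t. zero_pattern P (a(y := t)) = i}" if i: "i \<in> I" for i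
    proof (cases "\<forall>p\<in>T i. p a = 0")
      case True
      have "{t. poly (S i a) t \<noteq> 0} \<subseteq> {t. Q (a(y := t))}"
      proof safe
        fix t assume "poly (S i a) t \<noteq> 0"
        moreover have "poly (p a) t = 0" if "p \<in> T i" for p using bspec[OF True that] by simp
        ultimately have "zero_pattern P (a(y := t)) = i" using TS[OF i] by blast
        then show "Q (a(y := t))" using I(2) i by simp
      qed
      then have "finite {t. poly (S i a) t \<noteq> 0}" using fin by (rule finite_subset)
      moreover have "{t. poly (S i a) t \<noteq> 0} = UNIV - {t. poly (S i a) t = 0}" by auto
      ultimately have "S i a = 0"
        using poly_roots_finite[of "S i a"] infinite_UNIV_char_0[where 'a = complex]
        by (metis finite_Diff2)
      moreover have "G i a = 1" unfolding G_def if_P[OF True] ..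
      ultimately show ?thesis unfolding TS[OF i] by simp
    next
      case False
      then have "\<exists>p\<in>T i. p a \<noteq> 0" by blast
      note E = E2[OF this, THEN conjunct2, THEN spec]
      show ?thesis unfolding G_def if_not_P[OF False] TS[OF i] by (intro Collect_cong E)
    qed
    have "{t. Q (a(y := t))} = (\<Union>i\<in>I. {t. zero_pattern P (a(y := t)) = i})"
      unfolding I(2) by blast
    also have "\<dots> = (\<Union>i\<in>I. {t. poly (G i a) t = 0})"
      by (intro SUP_cong refl roots[symmetric])
    also have "card \<dots> = (\<Sum>i\<in>I. card {t. poly (G i a) t = 0})"
    proof (rule card_UN_disjoint[OF I(1)])
      show "\<forall>i\<in>I. finite {t. poly (G i a) t = 0}" by (intro ballI poly_roots_finite nz)
      show "\<forall>i\<in>I. \<forall>j\<in>I. i \<noteq> j \<longrightarrow> {t. poly (G i a) t = 0} \<inter> {t. poly (G j a) t = 0} = {}"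
        by (simp add: roots) blast
    qed
    also have "\<dots> = (\<Sum>i\<in>I. degree (G i a))"
      by (simp add: card_roots_rsquarefree sf)
    also have "\<dots> = degree (\<Prod>i\<in>I. G i a)"
      using nz by (simp add: degree_prod_sum_eq)
    finally have "degree (\<Prod>i\<in>I. G i a) = card {t. Q (a(y := t))}" ..
    moreover have "poly (\<Prod>i\<in>I. G i a) t = 0" if "Q (a(y := t))" for t
    proof -
      have "zero_pattern P (a(y := t)) \<in> I" using that I(2) by simp
      moreover have "poly (G (zero_pattern P (a(y := t))) a) t = 0"
        using roots[OF calculation] by auto
      ultimately show ?thesis using I(1) by (auto simp: poly_prod)
    qed
    ultimately show ?thesis by blast
  qed
  have "(\<lambda>a. \<Prod>i\<in>I. G i a) \<in> poly_family (cfun J)" by (intro cfun.family_prod G)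
  moreover have "(\<Prod>i\<in>I. G i a) \<noteq> 0" for a using nz I(1) by simp
  ultimately show ?thesis using main by (intro bexI[of _ "\<lambda>a. \<Prod>i\<in>I. G i a"]) auto
qed

lemma generic_finite_valued:
  assumes "\<And>a. N a \<le> (d::nat)" "\<And>k. constructible J (\<lambda>a. N a = k)"
  obtains k where "\<forall>\<^sub>F a in zariski_generic J. N a = k"
proof -
  have "\<exists>k. \<forall>\<^sub>F a in zariski_generic J. N a = k"
  proof (rule ccontr)
    assume "\<nexists>k. \<forall>\<^sub>F a in zariski_generic J. N a = k"
    then have "\<forall>\<^sub>F a in zariski_generic J. N a \<noteq> k" for k
      using constructible_dichotomy[OF assms(2)] by blast
    then have "\<forall>\<^sub>F a in zariski_generic J. \<forall>k\<in>{..d}. N a \<noteq> k"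
      by (intro eventually_ball_finite) auto
    from generic_happens[OF this] assms(1) show False by auto
  qed
  with that show ?thesis by blast
qed

text \<open>The minimal polynomial of the coordinate \<open>y\<close> over the rational functions in the coordinates \<open>J\<close>,
  with denominators cleared.\<close>

lemma generic_section_relation:
  assumes "constructible (insert y J) Q" "\<forall>\<^sub>F a in zariski_generic J. finite {t. Q (a(y := t))}"
  obtains e c where "\<And>k. c k \<in> polyfun J" "\<exists>a. c e a \<noteq> 0"
    "\<forall>\<^sub>F a in zariski_generic J. card {t. Q (a(y := t))} = e"
    "\<And>a t. Q (a(y := t)) \<Longrightarrow> (\<Sum>k\<le>e. c k a * t ^ k) = 0"
proof -
  obtain E where E: "E \<in> poly_family (cfun J)" "\<And>a. E a \<noteq> 0"
    "\<And>a. finite {t. Q (a(y := t))} \<Longrightarrow>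
      (\<forall>t. Q (a(y := t)) \<longrightarrow> poly (E a) t = 0) \<and> degree (E a) = card {t. Q (a(y := t))}"
    using constructible_sections_family[OF assms(1)] by blast
  obtain d where d: "\<And>a. degree (E a) \<le> d" using E(1) by (metis poly_family_degree)
  obtain e where e: "\<forall>\<^sub>F a in zariski_generic J. degree (E a) = e"
    using generic_finite_valued[OF d constructible_degree[OF E(1)]] by blast
  have "\<exists>q. fst q \<in> polyfun J \<and> snd q \<in> polyfun J \<and>
      (\<forall>\<^sub>F a in zariski_generic J. snd q a \<noteq> 0 \<and> coeff (E a) k = fst q a / snd q a)" for k
    by (rule cfun_generically_rational[OF poly_family_coeff[OF E(1), of k]])
      (rule exI[of _ "(num, den)" for num den], simp)
  then have "\<forall>k. \<exists>q. fst q \<in> polyfun J \<and> snd q \<in> polyfun J \<and>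
      (\<forall>\<^sub>F a in zariski_generic J. snd q a \<noteq> 0 \<and> coeff (E a) k = fst q a / snd q a)" ..
  from choice[OF this] obtain q where q: "\<forall>k. fst (q k) \<in> polyfun J \<and> snd (q k) \<in> polyfun J \<and>
      (\<forall>\<^sub>F a in zariski_generic J. snd (q k) a \<noteq> 0 \<and> coeff (E a) k = fst (q k) a / snd (q k) a)" ..
  define num den where "num k = fst (q k)" and "den k = snd (q k)" for k
  have nd: "num k \<in> polyfun J" "den k \<in> polyfun J"
    "\<forall>\<^sub>F a in zariski_generic J. den k a \<noteq> 0 \<and> coeff (E a) k = num k a / den k a" for k
    using spec[OF q, of k] by (simp_all add: num_def den_def)
  have "\<forall>\<^sub>F a in zariski_generic J. degree (E a) = e \<and> finite {t. Q (a(y := t))} \<and>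
      (\<forall>k\<in>{..e}. den k a \<noteq> 0 \<and> coeff (E a) k = num k a / den k a)"
    by (intro eventually_conj e assms(2) eventually_ball_finite ballI nd(3)) auto
  then obtain g a0 where g: "g \<in> polyfun J" "g a0 \<noteq> 0"
    "\<And>a. g a \<noteq> 0 \<Longrightarrow> degree (E a) = e \<and> finite {t. Q (a(y := t))} \<and>
      (\<forall>k\<in>{..e}. den k a \<noteq> 0 \<and> coeff (E a) k = num k a / den k a)"
    unfolding eventually_generic by blast
  \<comment> \<open>The product of the other denominators clears fractions. The factor
    \<open>g\<close> makes all coefficients vanish outside the good open set, so that the relation
    holds at every point and not just generically.\<close>
  define c where "c k a = g a * (num k a * (\<Prod>j\<in>{..e} - {k}. den j a))" for k a
  have c_eq: "c k a = g a * (\<Prod>j\<le>e. den j a) * coeff (E a) k" if "k \<le> e" for k a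
  proof (cases "g a = 0")
    case False
    then show ?thesis using g(3)[of a] that by (simp add: c_def prod.remove[of "{..e}" k])
  qed (simp add: c_def)
  have c: "c k \<in> polyfun J" for k
    unfolding c_def by (intro polyfun_mult polyfun.prod_mem g nd)
  have rel: "(\<Sum>k\<le>e. c k a * t ^ k) = 0" if "Q (a(y := t))" for a t
  proof -
    have "(\<Sum>k\<le>e. c k a * t ^ k) = g a * (\<Prod>j\<le>e. den j a) * (\<Sum>k\<le>e. coeff (E a) k * t ^ k)"
      by (simp add: c_eq sum_distrib_left mult_ac)
    moreover have "(\<Sum>k\<le>e. coeff (E a) k * t ^ k) = 0" if "g a \<noteq> 0"
      using g(3)[OF that] E(3)[of a] \<open>Q (a(y := t))\<close> poly_eq_sum_coeff[of "E a" e t] by auto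
    ultimately show ?thesis by auto
  qed
  have "coeff (E a0) e \<noteq> 0" using g(3)[OF g(2)] E(2)[of a0] by (metis leading_coeff_0_iff)
  then have lead: "c e a0 \<noteq> 0"
    using g by (simp add: c_eq)
  have "\<forall>\<^sub>F a in zariski_generic J. card {t. Q (a(y := t))} = e"
    using e assms(2) by eventually_elim (use E(3) in auto)
  with c rel lead show ?thesis by (intro that[of c e]) auto
qed

section \<open>Algebraic dependence\<close>

lemma homogeneous_system_solution:
  fixes M :: "'i \<Rightarrow> 'j \<Rightarrow> complex"
  assumes "finite B" "finite A" "card B < card A"
  shows "\<exists>c. (\<exists>i\<in>A. c i \<noteq> 0) \<and> (\<forall>j\<in>B. (\<Sum>i\<in>A. c i * M i j) = 0)"
  using assms
proof (induction B arbitrary: A M rule: finite_induct)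
  case empty
  then obtain i where "i \<in> A" by (metis card.empty all_not_in_conv less_irrefl)
  then show ?case by (intro exI[of _ "\<lambda>_. 1"]) auto
next
  case (insert j B)
  show ?case
  proof (cases "\<forall>i\<in>A. M i j = 0")
    case True
    from insert have "card B < card A" by auto
    with insert.IH[OF insert.prems(1)] obtain c where
      "\<exists>i\<in>A. c i \<noteq> 0" "\<forall>j\<in>B. (\<Sum>i\<in>A. c i * M i j) = 0" by blast
    with True show ?thesis by (intro exI[of _ c]) auto
  next
    case False
    then obtain i0 where i0: "i0 \<in> A" "M i0 j \<noteq> 0" by blast
    define N where "N i k = M i k - M i j / M i0 j * M i0 k" for i k
    have "card B < card (A - {i0})" using insert i0 by auto
    with insert.IH[of "A - {i0}" N] insert.prems obtain c where c:
      "\<exists>i\<in>A - {i0}. c i \<noteq> 0" "\<And>k. k \<in> B \<Longrightarrow> (\<Sum>i\<in>A - {i0}. c i * N i k) = 0" by auto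
    define d where "d = c(i0 := - (\<Sum>i\<in>A - {i0}. c i * (M i j / M i0 j)))"
    have d: "(\<Sum>i\<in>A. d i * M i k) = (\<Sum>i\<in>A - {i0}. c i * N i k)" for k
    proof -
      have "(\<Sum>i\<in>A. d i * M i k) = d i0 * M i0 k + (\<Sum>i\<in>A - {i0}. c i * M i k)"
        using i0 insert.prems by (subst sum.remove[of _ i0]) (auto simp: d_def intro!: sum.cong)
      also have "\<dots> = (\<Sum>i\<in>A - {i0}. c i * M i k - c i * (M i j / M i0 j) * M i0 k)"
        by (simp add: d_def sum_subtractf sum_distrib_right)
      also have "\<dots> = (\<Sum>i\<in>A - {i0}. c i * N i k)"
        by (simp add: N_def algebra_simps)
      finally show ?thesis .
    qed
    have "(\<Sum>i\<in>A. d i * M i k) = 0" if "k \<in> insert j B" for k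
      using that c(2) i0 by (auto simp: d N_def)
    moreover have "\<exists>i\<in>A. d i \<noteq> 0" using c(1) by (auto simp: d_def)
    ultimately show ?thesis by blast
  qed
qed

definition exponents :: "'x set \<Rightarrow> nat \<Rightarrow> ('x \<Rightarrow> nat) set" where
  "exponents V B = V \<rightarrow>\<^sub>E {..B}"

definition monomial_fun :: "'x set \<Rightarrow> ('x \<Rightarrow> nat) \<Rightarrow> ('x \<Rightarrow> complex) \<Rightarrow> complex" where
  "monomial_fun V \<alpha> a = (\<Prod>x\<in>V. a x ^ \<alpha> x)"

text \<open>The bound is on each exponent separately, not on the total degree, so that there are
  exactly \<open>(B + 1) ^ card V\<close> monomials.\<close>

definition bounded_polyfun :: "'x set \<Rightarrow> nat \<Rightarrow> (('x \<Rightarrow> complex) \<Rightarrow> complex) set" where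
  "bounded_polyfun V B = {f. \<exists>c. f = (\<lambda>a. \<Sum>\<alpha>\<in>exponents V B. c \<alpha> * monomial_fun V \<alpha> a)}"

lemma finite_exponents: "finite V \<Longrightarrow> finite (exponents V B)"
  by (simp add: exponents_def finite_PiE)

lemma card_exponents: "finite V \<Longrightarrow> card (exponents V B) = Suc B ^ card V"
  by (simp add: exponents_def card_PiE)

lemma bounded_polyfun_monomial:
  assumes "finite V" "\<And>x. x \<in> V \<Longrightarrow> \<alpha> x \<le> B"
  shows "monomial_fun V \<alpha> \<in> bounded_polyfun V B"
proof -
  have m: "restrict \<alpha> V \<in> exponents V B" using assms(2) by (auto simp: exponents_def)
  have "(\<Sum>\<beta>\<in>exponents V B. (if \<beta> = restrict \<alpha> V then 1 else 0) * monomial_fun V \<beta> a)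
      = (\<Sum>\<beta>\<in>exponents V B. if \<beta> = restrict \<alpha> V then monomial_fun V \<beta> a else 0)" for a
    by (rule sum.cong) auto
  then have "(\<Sum>\<beta>\<in>exponents V B. (if \<beta> = restrict \<alpha> V then 1 else 0) * monomial_fun V \<beta> a) = monomial_fun V \<alpha> a" for a
    using m finite_exponents[OF assms(1), of B] by (simp add: monomial_fun_def)
  then show ?thesis
    unfolding bounded_polyfun_def
    by (intro CollectI exI[of _ "\<lambda>\<beta>. if \<beta> = restrict \<alpha> V then 1 else 0"]) simp
qed

lemma bounded_polyfun_add:
  assumes "f \<in> bounded_polyfun V B" "g \<in> bounded_polyfun V B"
  shows "(\<lambda>a. f a + g a) \<in> bounded_polyfun V B"
proof -
  obtain c d where "f = (\<lambda>a. \<Sum>\<alpha>\<in>exponents V B. c \<alpha> * monomial_fun V \<alpha> a)"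
    "g = (\<lambda>a. \<Sum>\<alpha>\<in>exponents V B. d \<alpha> * monomial_fun V \<alpha> a)"
    using assms unfolding bounded_polyfun_def by blast
  then have "(\<lambda>a. f a + g a) = (\<lambda>a. \<Sum>\<alpha>\<in>exponents V B. (c \<alpha> + d \<alpha>) * monomial_fun V \<alpha> a)"
    by (simp add: sum.distrib distrib_right)
  then show ?thesis unfolding bounded_polyfun_def by (intro CollectI exI[of _ "\<lambda>\<alpha>. c \<alpha> + d \<alpha>"])
qed

lemma bounded_polyfun_scale:
  assumes "f \<in> bounded_polyfun V B"
  shows "(\<lambda>a. k * f a) \<in> bounded_polyfun V B"
proof -
  obtain c where "f = (\<lambda>a. \<Sum>\<alpha>\<in>exponents V B. c \<alpha> * monomial_fun V \<alpha> a)"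
    using assms unfolding bounded_polyfun_def by blast
  then have "(\<lambda>a. k * f a) = (\<lambda>a. \<Sum>\<alpha>\<in>exponents V B. (k * c \<alpha>) * monomial_fun V \<alpha> a)"
    by (simp add: sum_distrib_left mult.assoc)
  then show ?thesis unfolding bounded_polyfun_def by (intro CollectI exI[of _ "\<lambda>\<alpha>. k * c \<alpha>"])
qed

lemma bounded_polyfun_sum:
  "(\<And>i. i \<in> A \<Longrightarrow> f i \<in> bounded_polyfun V B) \<Longrightarrow> (\<lambda>a. \<Sum>i\<in>A. f i a) \<in> bounded_polyfun V B"
proof (induction A rule: infinite_finite_induct)
  case (insert i A)
  then show ?case by (simp add: bounded_polyfun_add)
qed (auto simp: bounded_polyfun_def intro: exI[of _ "\<lambda>_. 0"])

lemma bounded_polyfun_mult: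
  assumes "finite V" "f \<in> bounded_polyfun V B" "g \<in> bounded_polyfun V C"
  shows "(\<lambda>a. f a * g a) \<in> bounded_polyfun V (B + C)"
proof -
  obtain c d where "f = (\<lambda>a. \<Sum>\<alpha>\<in>exponents V B. c \<alpha> * monomial_fun V \<alpha> a)"
    "g = (\<lambda>a. \<Sum>\<alpha>\<in>exponents V C. d \<alpha> * monomial_fun V \<alpha> a)"
    using assms unfolding bounded_polyfun_def by blast
  then have "(\<lambda>a. f a * g a) = (\<lambda>a. \<Sum>\<alpha>\<in>exponents V B. \<Sum>\<beta>\<in>exponents V C.
      (c \<alpha> * d \<beta>) * monomial_fun V (\<lambda>x. \<alpha> x + \<beta> x) a)"
    by (simp add: sum_product monomial_fun_def power_add prod.distrib mult_ac)
  moreover have "(\<lambda>a. \<Sum>\<alpha>\<in>exponents V B. \<Sum>\<beta>\<in>exponents V C.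
      (c \<alpha> * d \<beta>) * monomial_fun V (\<lambda>x. \<alpha> x + \<beta> x) a) \<in> bounded_polyfun V (B + C)"
    by (intro bounded_polyfun_sum bounded_polyfun_scale bounded_polyfun_monomial assms)
      (auto simp: exponents_def PiE_iff intro: add_mono)
  ultimately show ?thesis by simp
qed

lemma bounded_polyfun_const: "finite V \<Longrightarrow> (\<lambda>_. c) \<in> bounded_polyfun V B"
  using bounded_polyfun_scale[OF bounded_polyfun_monomial[of V "\<lambda>_. 0" B], of c]
  by (simp add: monomial_fun_def)

lemma bounded_polyfun_mono:
  assumes "finite V" "f \<in> bounded_polyfun V B" "B \<le> C"
  shows "f \<in> bounded_polyfun V C"
  using bounded_polyfun_mult[OF assms(1,2) bounded_polyfun_const[OF assms(1), of 1 "C - B"]] assms(3)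
  by simp

lemma bounded_polyfun_power:
  "finite V \<Longrightarrow> f \<in> bounded_polyfun V B \<Longrightarrow> (\<lambda>a. f a ^ n) \<in> bounded_polyfun V (n * B)"
  by (induction n) (auto intro: bounded_polyfun_const bounded_polyfun_mult)

lemma bounded_polyfun_prod:
  "finite V \<Longrightarrow> (\<And>i. i \<in> A \<Longrightarrow> f i \<in> bounded_polyfun V (B i)) \<Longrightarrow>
    (\<lambda>a. \<Prod>i\<in>A. f i a) \<in> bounded_polyfun V (\<Sum>i\<in>A. B i)"
proof (induction A rule: infinite_finite_induct)
  case (insert i A)
  then show ?case by (simp add: bounded_polyfun_mult)
qed (auto intro: bounded_polyfun_const)

lemma polyfun_bounded:
  assumes "finite V" "f \<in> polyfun V"
  shows "\<exists>B. f \<in> bounded_polyfun V B"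
  using assms(2)
proof induction
  case (polyfun_const c)
  show ?case using bounded_polyfun_const[OF assms(1)] by blast
next
  case (polyfun_coord x)
  have "(\<lambda>a. a x) = monomial_fun V (\<lambda>y. if y = x then 1 else 0)"
    using polyfun_coord assms(1)
    by (simp add: fun_eq_iff monomial_fun_def if_distrib[of "(^) _"] prod.delta cong: if_cong)
  moreover have "\<dots> \<in> bounded_polyfun V 1"
    by (rule bounded_polyfun_monomial[OF assms(1)]) auto
  ultimately show ?case by auto
next
  case (polyfun_add f g)
  then obtain B C where "f \<in> bounded_polyfun V B" "g \<in> bounded_polyfun V C" by blast
  then have "f \<in> bounded_polyfun V (max B C)" "g \<in> bounded_polyfun V (max B C)"
    using bounded_polyfun_mono[OF assms(1)] by auto
  then show ?case using bounded_polyfun_add by blast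
next
  case (polyfun_mult f g)
  then show ?case using bounded_polyfun_mult[OF assms(1)] by blast
qed

lemma monomial_fun_polyfun: "(\<lambda>a. c * monomial_fun K \<alpha> a) \<in> polyfun K"
  unfolding monomial_fun_def
  by (intro polyfun_mult polyfun_const polyfun.prod_mem polyfun.power_mem polyfun_coord)

lemma monomials_independent:
  assumes "finite K" "\<And>a. (\<Sum>\<alpha>\<in>exponents K D. c \<alpha> * monomial_fun K \<alpha> a) = 0" "\<alpha> \<in> exponents K D"
  shows "c \<alpha> = 0"
  using assms
proof (induction K arbitrary: c \<alpha> rule: finite_induct)
  case empty
  then show ?case by (simp add: exponents_def monomial_fun_def)
next
  case (insert x K)
  have exps: "exponents (insert x K) D = (\<lambda>(y, g). g(x := y)) ` ({..D} \<times> exponents K D)"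
    by (simp add: exponents_def PiE_insert_eq)
  have inj: "inj_on (\<lambda>(y, g). g(x := y)) ({..D} \<times> exponents K D)"
    using inj_combinator[OF insert.hyps(2), of "\<lambda>_. {..D}"] by (simp add: exponents_def)
  have mon: "monomial_fun (insert x K) (g(x := y)) (a(x := t)) = t ^ y * monomial_fun K g a" for g y a t
  proof -
    have "monomial_fun K (g(x := y)) (a(x := t)) = monomial_fun K g a"
      unfolding monomial_fun_def by (rule prod.cong) (use insert.hyps in auto)
    moreover have "monomial_fun (insert x K) b d = d x ^ b x * monomial_fun K b d" for b d
      using insert.hyps by (simp add: monomial_fun_def)
    ultimately show ?thesis by simp
  qed
  have "(\<Sum>g\<in>exponents K D. c (g(x := y)) * monomial_fun K g a) = 0" if y: "y \<le> D" for y a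
  proof -
    have "(\<Sum>i\<le>D. (\<Sum>g\<in>exponents K D. c (g(x := i)) * monomial_fun K g a) * t ^ i) = 0" for t
    proof -
      have "0 = (\<Sum>\<alpha>\<in>exponents (insert x K) D. c \<alpha> * monomial_fun (insert x K) \<alpha> (a(x := t)))"
        using insert.prems(1) by simp
      also have "\<dots> = (\<Sum>(i, g)\<in>{..D} \<times> exponents K D. c (g(x := i)) * (t ^ i * monomial_fun K g a))"
        unfolding exps by (subst sum.reindex[OF inj]) (simp add: mon case_prod_unfold)
      also have "\<dots> = (\<Sum>i\<le>D. \<Sum>g\<in>exponents K D. c (g(x := i)) * (t ^ i * monomial_fun K g a))"
        by (rule sum.cartesian_product[symmetric])
      also have "\<dots> = (\<Sum>i\<le>D. (\<Sum>g\<in>exponents K D. c (g(x := i)) * monomial_fun K g a) * t ^ i)"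
        by (simp add: sum_distrib_left sum_distrib_right mult_ac)
      finally show ?thesis ..
    qed
    then show ?thesis
      using polyfun_eq_0[of "\<lambda>i. \<Sum>g\<in>exponents K D. c (g(x := i)) * monomial_fun K g a" D] y by blast
  qed
  then have "c (g(x := y)) = 0" if "y \<le> D" "g \<in> exponents K D" for y g
    using insert.IH[of "\<lambda>g. c (g(x := y))"] that by blast
  with insert.prems(2) show ?case unfolding exps by auto
qed

text \<open>A count of dimensions: there are \<open>(D + 1) ^ card K\<close> monomials in the
  \<open>f x\<close> with exponents at most \<open>D\<close>, and they lie in a space of dimension
  at most \<open>(N + 1) ^ card V\<close> with \<open>N\<close> linear in \<open>D\<close>. For
  suitable \<open>D\<close> they are linearly dependent, and independence of the formal monomials
  makes the resulting \<open>g\<close> nonzero.\<close>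

theorem algebraically_dependent:
  assumes V: "finite V" and K: "finite K" "card V < card K"
    and f: "\<And>x. x \<in> K \<Longrightarrow> f x \<in> polyfun V"
  shows "\<exists>g\<in>polyfun K. (\<exists>a. g a \<noteq> 0) \<and> (\<forall>t. g (\<lambda>x. f x t) = 0)"
proof -
  have "\<forall>x\<in>K. \<exists>B. f x \<in> bounded_polyfun V B" using polyfun_bounded[OF V f] by blast
  from bchoice[OF this] obtain B where B: "\<forall>x\<in>K. f x \<in> bounded_polyfun V (B x)" ..
  define b where "b = (\<Sum>x\<in>K. B x)"
  have b: "f x \<in> bounded_polyfun V b" if "x \<in> K" for x
    using bounded_polyfun_mono[OF V, of "f x" "B x" b] B that member_le_sum[of x K B] K(1)
    by (auto simp: b_def)
  \<comment> \<open>\<open>c\<close> is chosen such that \<open>N + 1 \<le> c * (D + 1)\<close>.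
    With \<open>D = c ^ card V\<close>, one further factor \<open>D + 1\<close> exceeds the constant
    \<open>c ^ card V\<close>.\<close>
  define c where "c = card K * b + 1"
  define D where "D = c ^ card V"
  define N where "N = card K * (D * b)"
  have mono: "(\<lambda>t. monomial_fun K \<alpha> (\<lambda>x. f x t)) \<in> bounded_polyfun V N" if "\<alpha> \<in> exponents K D" for \<alpha>
  proof -
    have "(\<lambda>t. \<Prod>x\<in>K. f x t ^ \<alpha> x) \<in> bounded_polyfun V (\<Sum>x\<in>K. D * b)"
    proof (rule bounded_polyfun_prod[OF V])
      fix x assume x: "x \<in> K"
      then have "\<alpha> x * b \<le> D * b" using that by (auto simp: exponents_def)
      then show "(\<lambda>t. f x t ^ \<alpha> x) \<in> bounded_polyfun V (D * b)"
        using bounded_polyfun_power[OF V b[OF x]] bounded_polyfun_mono[OF V] by blast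
    qed
    then show ?thesis by (simp add: monomial_fun_def N_def)
  qed
  then have "\<forall>\<alpha>\<in>exponents K D. \<exists>m. (\<lambda>t. monomial_fun K \<alpha> (\<lambda>x. f x t)) =
      (\<lambda>t. \<Sum>\<gamma>\<in>exponents V N. m \<gamma> * monomial_fun V \<gamma> t)"
    unfolding bounded_polyfun_def by blast
  from bchoice[OF this] obtain M where "\<forall>\<alpha>\<in>exponents K D.
    (\<lambda>t. monomial_fun K \<alpha> (\<lambda>x. f x t)) = (\<lambda>t. \<Sum>\<gamma>\<in>exponents V N. M \<alpha> \<gamma> * monomial_fun V \<gamma> t)" ..
  note M = bspec[OF this]
  have "Suc N \<le> c * Suc D" by (simp add: N_def c_def algebra_simps)
  then have "Suc N ^ card V \<le> (c * Suc D) ^ card V" by (rule power_mono) simp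
  also have "\<dots> = D * Suc D ^ card V" by (simp only: power_mult_distrib D_def)
  also have "\<dots> < Suc D * Suc D ^ card V" by simp
  also have "\<dots> = Suc D ^ Suc (card V)" by simp
  also have "\<dots> \<le> Suc D ^ card K" using K(2) by (intro power_increasing) auto
  finally have "card (exponents V N) < card (exponents K D)" using V K by (simp add: card_exponents)
  from homogeneous_system_solution[OF finite_exponents[OF V] finite_exponents[OF K(1)] this, of M]
  obtain u where u: "\<exists>\<alpha>\<in>exponents K D. u \<alpha> \<noteq> 0"
    "\<And>\<gamma>. \<gamma> \<in> exponents V N \<Longrightarrow> (\<Sum>\<alpha>\<in>exponents K D. u \<alpha> * M \<alpha> \<gamma>) = 0" by blast
  define g where "g a = (\<Sum>\<alpha>\<in>exponents K D. u \<alpha> * monomial_fun K \<alpha> a)" for a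
  have "g \<in> polyfun K" unfolding g_def by (intro polyfun.sum_mem monomial_fun_polyfun)
  moreover have "\<exists>a. g a \<noteq> 0"
  proof (rule ccontr)
    assume "\<nexists>a. g a \<noteq> 0"
    then have "(\<Sum>\<alpha>\<in>exponents K D. u \<alpha> * monomial_fun K \<alpha> a) = 0" for a unfolding g_def by blast
    from monomials_independent[OF K(1) this] u(1) show False by blast
  qed
  moreover have "g (\<lambda>x. f x t) = 0" for t
  proof -
    have "g (\<lambda>x. f x t) = (\<Sum>\<alpha>\<in>exponents K D. u \<alpha> * (\<Sum>\<gamma>\<in>exponents V N. M \<alpha> \<gamma> * monomial_fun V \<gamma> t))"
      unfolding g_def by (intro sum.cong refl arg_cong[of _ _ "(*) _"] fun_cong[OF M])
    also have "\<dots> = (\<Sum>\<gamma>\<in>exponents V N. (\<Sum>\<alpha>\<in>exponents K D. u \<alpha> * M \<alpha> \<gamma>) * monomial_fun V \<gamma> t)"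
      unfolding sum_distrib_left sum_distrib_right
      by (subst sum.swap) (simp add: mult.assoc)
    also have "\<dots> = 0" using u(2) by simp
    finally show ?thesis .
  qed
  ultimately show ?thesis by blast
qed

text \<open>In a relation between the coordinates and \<open>h\<close>, cancel powers of \<open>h\<close> and then set \<open>h = 0\<close>.\<close>

lemma algebraically_dependent_on_hypersurface:
  assumes V: "finite V" and K: "finite K" "card V \<le> card K"
    and f: "\<And>x. x \<in> K \<Longrightarrow> f x \<in> polyfun V" and h: "h \<in> polyfun V" "h t0 \<noteq> 0"
  shows "\<exists>g\<in>polyfun K. (\<exists>a. g a \<noteq> 0) \<and> (\<forall>t. h t = 0 \<longrightarrow> g (\<lambda>x. f x t) = 0)"
proof -
  \<comment> \<open>\<open>None\<close> is a further coordinate carrying \<open>h\<close>, which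
    brings the number of functions above \<open>card V\<close>.\<close>
  define F where "F y = (case y of None \<Rightarrow> h | Some x \<Rightarrow> f x)" for y
  have F: "F y \<in> polyfun V" if "y \<in> insert None (Some ` K)" for y
    using that f h by (auto simp: F_def)
  have "card V < card (insert None (Some ` K))"
    using K by (simp add: card_image)
  then have "\<exists>g\<in>polyfun (insert None (Some ` K)). (\<exists>a. g a \<noteq> 0) \<and> (\<forall>t. g (\<lambda>y. F y t) = 0)"
    using K by (intro algebraically_dependent[OF V _ _ F]) auto
  then obtain g a0 where
    g: "g \<in> polyfun (insert None (Some ` K))" "g a0 \<noteq> 0" "\<And>t. g (\<lambda>y. F y t) = 0" by blast
  obtain P where P: "P \<in> poly_family (polyfun (Some ` K))" "\<And>a t. g (a(None := t)) = poly (P a) t"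
    using polyfun_upd_family[OF g(1)] by blast
  have "P a0 \<noteq> 0" using P(2)[of a0 "a0 None"] g(2) by auto
  then have ex: "\<exists>k a. coeff (P a) k \<noteq> 0" by (metis leading_coeff_0_iff)
  define k where "k = (LEAST k. \<exists>a. coeff (P a) k \<noteq> 0)"
  have k: "\<exists>a. coeff (P a) k \<noteq> 0" using LeastI_ex[OF ex] unfolding k_def .
  have below: "coeff (P a) i = 0" if "i < k" for a i using not_less_Least that unfolding k_def by blast
  define R where "R a = poly_shift k (P a)" for a
  have PR: "P a = monom 1 k * R a" for a
    unfolding R_def by (rule poly_eqI) (auto simp: coeff_monom_mult coeff_poly_shift below)
  have R: "R \<in> poly_family (polyfun (Some ` K))"
  proof -
    obtain d where d: "\<And>a. degree (P a) \<le> d" using P(1) by (metis poly_family_degree)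
    have "degree (R a) \<le> d" for a
    proof (intro degree_le allI impI)
      fix i assume "d < i"
      with d[of a] have "coeff (P a) (i + k) = 0" by (intro coeff_eq_0) simp
      then show "coeff (R a) i = 0" by (simp add: R_def coeff_poly_shift)
    qed
    then show ?thesis
      by (rule poly_familyI) (auto simp: R_def coeff_poly_shift intro: poly_family_coeff P)
  qed
  define S where "S t = poly (R (\<lambda>y. F y t)) (h t)" for t
  have sub: "(\<lambda>t. q (\<lambda>y. F y t)) \<in> polyfun V" if "q \<in> polyfun (Some ` K)" for q
    by (rule polyfun_subst[OF polyfun.function_ring_axioms that]) (auto intro: F)
  obtain d where d: "\<And>a. degree (R a) \<le> d" using R by (metis poly_family_degree)
  have "S = (\<lambda>t. \<Sum>i\<le>d. coeff (R (\<lambda>y. F y t)) i * h t ^ i)"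
    unfolding S_def by (simp add: poly_eq_sum_coeff[OF d])
  also have "\<dots> \<in> polyfun V"
    by (intro polyfun.sum_mem polyfun_mult polyfun.power_mem h sub[OF poly_family_coeff[OF R]])
  finally have S: "S \<in> polyfun V" .
  have hS: "h t ^ k * S t = 0" for t
  proof -
    have "(\<lambda>y. F y t)(None := h t) = (\<lambda>y. F y t)" by (auto simp: F_def)
    then have "poly (P (\<lambda>y. F y t)) (h t) = 0" using P(2)[of "\<lambda>y. F y t" "h t"] g(3)[of t] by simp
    then show ?thesis by (simp add: PR S_def poly_monom)
  qed
  \<comment> \<open>Polynomial functions have no zero divisors, and \<open>h\<close> is not
    identically zero.\<close>
  have S0: "S t = 0" for t
  proof (rule ccontr)
    assume "S t \<noteq> 0"
    from polyfun_nonzero_both[where f = S and g = h, OF S h(1) this h(2)]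
    obtain c where "S c \<noteq> 0 \<and> h c \<noteq> 0" ..
    with hS[of c] show False by simp
  qed
  \<comment> \<open>The lowest coefficient that is not identically zero; as a function of the
    coordinates in \<open>K\<close> alone it may be evaluated with \<open>0\<close> at
    \<open>None\<close>.\<close>
  define q where "q b = coeff (P (\<lambda>y. case y of None \<Rightarrow> 0 | Some x \<Rightarrow> b x)) k" for b
  have ext: "(\<lambda>b. case y of None \<Rightarrow> 0 | Some x \<Rightarrow> b x) \<in> polyfun K" if y: "y \<in> Some ` K" for y
  proof -
    obtain x where "y = Some x" "x \<in> K" using y by blast
    then show ?thesis by (simp add: polyfun_coord)
  qed
  have "q \<in> polyfun K"
    unfolding q_def
    by (rule polyfun_subst[where f = "\<lambda>a. coeff (P a) k" and J = "Some ` K" and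
          \<sigma> = "\<lambda>y b. case y of None \<Rightarrow> 0 | Some x \<Rightarrow> b x", OF polyfun.function_ring_axioms _ ext])
      (rule poly_family_coeff[OF P(1)])
  moreover have q_eq: "q b = coeff (P a) k" if "\<And>x. x \<in> K \<Longrightarrow> b x = a (Some x)" for a b
    unfolding q_def
    by (rule polyfun_local[where f = "\<lambda>a. coeff (P a) k", OF poly_family_coeff[OF P(1)]])
      (use that in auto)
  moreover have "\<exists>b. q b \<noteq> 0"
  proof -
    obtain a where "coeff (P a) k \<noteq> 0" using k by blast
    with q_eq[of "\<lambda>x. a (Some x)" a] have "q (\<lambda>x. a (Some x)) \<noteq> 0" by simp
    then show ?thesis by (rule exI[where x = "\<lambda>x. a (Some x)"])
  qed
  moreover have "q (\<lambda>x. f x t) = 0" if "h t = 0" for t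
  proof -
    have "q (\<lambda>x. f x t) = coeff (P (\<lambda>y. F y t)) k"
      by (rule q_eq[where a = "\<lambda>y. F y t"]) (simp add: F_def)
    also have "\<dots> = coeff (R (\<lambda>y. F y t)) 0" by (simp add: R_def coeff_poly_shift)
    also have "\<dots> = S t" using that by (simp add: S_def poly_0_coeff_0)
    finally show ?thesis using S0 by simp
  qed
  ultimately show ?thesis by blast
qed

section \<open>Matrix Schubert varieties as unions of cells\<close>

text \<open>Rank at most \<open>r\<close>, as a factorization through an
  \<open>r\<close>-dimensional space. In this existential form the condition is a projection, open
  to Chevalley's theorem, and a matrix can be enlarged by enlarging its two factors.\<close>

definition factors_through :: "nat \<Rightarrow> nat \<Rightarrow> nat \<Rightarrow> (nat \<times> nat \<Rightarrow> complex) \<Rightarrow> bool" where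
  "factors_through r p q A \<longleftrightarrow>
     (\<exists>B C. \<forall>i\<in>{1..p}. \<forall>j\<in>{1..q}. A (i, j) = (\<Sum>l<r. B i l * C l j))"

lemma northwest_carrier: "northwest p q A \<in> carrier_mat p q"
  by (simp add: northwest_def)

lemma col_northwest: "j < q \<Longrightarrow> i < p \<Longrightarrow> col (northwest p q A) j $ i = A (i + 1, j + 1)"
  by (simp add: northwest_def)

lemma factors_through_rank:
  assumes "vec_space.rank p (northwest p q A) \<le> r"
  shows "factors_through r p q A"
proof -
  interpret vec_space "TYPE(complex)" p .
  let ?A = "northwest p q A"
  have fin: "finite (set (cols ?A))" by simp
  have carr: "set (cols ?A) \<subseteq> carrier_vec p"
    using cols_dim[of ?A] northwest_carrier[of p q A] by (simp add: northwest_def)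
  obtain S where S: "maximal S (\<lambda>T. T \<subseteq> set (cols ?A) \<and> lin_indpt T)" "finite S"
    using maximal_exists_superset[of "set (cols ?A)" "\<lambda>T. T \<subseteq> set (cols ?A) \<and> lin_indpt T" "{}"]
      finite_lin_indpt2[of "{}"] fin by auto
  then have card: "card S \<le> r"
    using rank_card_indpt[OF northwest_carrier S(1)] assms by simp
  from S(1) have Sc: "S \<subseteq> set (cols ?A)" "lin_indpt S" by (auto simp: maximal_def)
  with carr have SV: "S \<subseteq> carrier_vec p" by auto
  have in_span: "v \<in> span S" if v: "v \<in> set (cols ?A)" for v
  proof (cases "v \<in> S")
    case True
    with in_own_span[OF SV] show ?thesis by (rule subsetD)
  next
    case False
    have vc: "v \<in> carrier_vec p" using v carr by auto
    have "\<not> lin_indpt (S \<union> {v})"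
    proof
      assume "lin_indpt (S \<union> {v})"
      moreover have "S \<union> {v} \<subseteq> set (cols ?A)" using v Sc by simp
      ultimately have "S = S \<union> {v}"
        using S(1) unfolding maximal_def by (metis Un_upper1)
      with False show False by auto
    qed
    with lin_dep_iff_in_span[OF SV Sc(2) vc False] show ?thesis by simp
  qed
  have "\<exists>a. v = lincomb a S" if "v \<in> set (cols ?A)" for v
    using in_span[OF that] finite_span[OF S(2) SV] by auto
  then have "\<forall>j. \<exists>a. j < q \<longrightarrow> col ?A j = lincomb a S"
    by (auto simp: cols_def northwest_def)
  from choice[OF this] obtain a where a: "\<forall>j. j < q \<longrightarrow> col ?A j = lincomb (a j) S" ..
  obtain h where h: "bij_betw h {0..<card S} S" using ex_bij_betw_nat_finite[OF S(2)] by blast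
  define B where "B i l = (if l < card S then h l $ (i - 1) else 0)" for i l
  define C where "C l j = a (j - 1) (h l)" for l j
  have "A (i, j) = (\<Sum>l<r. B i l * C l j)" if "i \<in> {1..p}" "j \<in> {1..q}" for i j
  proof -
    have "A (i, j) = col ?A (j - 1) $ (i - 1)"
      using that by (subst col_northwest) auto
    also have "col ?A (j - 1) = lincomb (a (j - 1)) S" using that by (intro mp[OF spec[OF a]]) auto
    also have "\<dots> $ (i - 1) = (\<Sum>x\<in>S. a (j - 1) x * x $ (i - 1))"
      using that carr Sc by (intro lincomb_index) auto
    also have "\<dots> = (\<Sum>l\<in>{0..<card S}. a (j - 1) (h l) * h l $ (i - 1))"
      by (rule sum.reindex_bij_betw[OF h, symmetric])
    also have "\<dots> = (\<Sum>l\<in>{0..<card S}. B i l * C l j)"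
      by (rule sum.cong) (auto simp: B_def C_def)
    also have "\<dots> = (\<Sum>l<r. B i l * C l j)"
      by (rule sum.mono_neutral_left) (use card in \<open>auto simp: B_def\<close>)
    finally show ?thesis .
  qed
  then show ?thesis unfolding factors_through_def by blast
qed

lemma rank_factors_through:
  assumes "factors_through r p q A"
  shows "vec_space.rank p (northwest p q A) \<le> r"
proof -
  interpret vec_space "TYPE(complex)" p .
  let ?A = "northwest p q A"
  obtain B C where BC: "\<And>i j. i \<in> {1..p} \<Longrightarrow> j \<in> {1..q} \<Longrightarrow> A (i, j) = (\<Sum>l<r. B i l * C l j)"
    using assms unfolding factors_through_def by blast
  have carr: "set (cols ?A) \<subseteq> carrier_vec p"
    using cols_dim[of ?A] by (simp add: northwest_def)
  obtain S where S: "maximal S (\<lambda>T. T \<subseteq> set (cols ?A) \<and> lin_indpt T)" "finite S"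
    using maximal_exists_superset[of "set (cols ?A)" "\<lambda>T. T \<subseteq> set (cols ?A) \<and> lin_indpt T" "{}"]
      finite_lin_indpt2[of "{}"] by auto
  from S(1) have Sc: "S \<subseteq> set (cols ?A)" "lin_indpt S" by (auto simp: maximal_def)
  have "card S \<le> r"
  proof (rule ccontr)
    assume "\<not> card S \<le> r"
    have "\<forall>v\<in>S. \<exists>j. j < q \<and> v = col ?A j"
    proof
      fix v assume "v \<in> S"
      then obtain j where "j < length (cols ?A)" "cols ?A ! j = v"
        using Sc(1) by (metis in_set_conv_nth subsetD)
      moreover have "dim_col ?A = q" by (simp add: northwest_def)
      ultimately show "\<exists>j. j < q \<and> v = col ?A j" by (intro exI[of _ j]) simp
    qed
    from bchoice[OF this] obtain J where J: "\<forall>v\<in>S. J v < q \<and> v = col ?A (J v)" ..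
    have "\<exists>c. (\<exists>v\<in>S. c v \<noteq> 0) \<and> (\<forall>l\<in>{..<r}. (\<Sum>v\<in>S. c v * C l (J v + 1)) = 0)"
      by (rule homogeneous_system_solution) (use S(2) \<open>\<not> card S \<le> r\<close> in auto)
    then obtain c where c: "\<exists>v\<in>S. c v \<noteq> 0" "\<And>l. l < r \<Longrightarrow> (\<Sum>v\<in>S. c v * C l (J v + 1)) = 0" by auto
    have "lincomb c S = 0\<^sub>v p"
    proof (rule eq_vecI)
      show "dim_vec (lincomb c S) = dim_vec (0\<^sub>v p)"
        using lincomb_dim[OF S(2), of c] Sc(1) carr by auto
      fix i assume "i < dim_vec (0\<^sub>v p)"
      then have i: "i < p" by simp
      have "lincomb c S $ i = (\<Sum>v\<in>S. c v * v $ i)"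
        using i Sc(1) carr by (intro lincomb_index) auto
      also have "\<dots> = (\<Sum>v\<in>S. c v * (\<Sum>l<r. B (i + 1) l * C l (J v + 1)))"
      proof (rule sum.cong[OF refl])
        fix v assume "v \<in> S"
        with J have v: "J v < q" "v = col ?A (J v)" by auto
        have "v $ i = A (i + 1, J v + 1)" by (subst v(2)) (rule col_northwest[OF v(1) i])
        also have "\<dots> = (\<Sum>l<r. B (i + 1) l * C l (J v + 1))" using v(1) i by (intro BC) auto
        finally show "c v * v $ i = c v * (\<Sum>l<r. B (i + 1) l * C l (J v + 1))" by simp
      qed
      also have "\<dots> = (\<Sum>l<r. B (i + 1) l * (\<Sum>v\<in>S. c v * C l (J v + 1)))"
        unfolding sum_distrib_left by (subst sum.swap) (simp add: mult_ac)
      also have "\<dots> = 0" using c(2) by simp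
      finally show "lincomb c S $ i = 0\<^sub>v p $ i" using i by simp
    qed
    moreover from c(1) obtain v where "v \<in> S" "c v \<noteq> 0" by blast
    ultimately have "lin_dep S"
      by (intro lin_dep_crit[where A = S and a = c and v = v]) (use S(2) in auto)
    with Sc(2) show False by simp
  qed
  then show ?thesis using rank_card_indpt[OF northwest_carrier S(1)] by simp
qed

lemma matrix_schubert_variety_iff:
  "A \<in> matrix_schubert_variety n w \<longleftrightarrow> A \<in> affine_space (grid n) \<and>
     (\<forall>p\<in>{1..n}. \<forall>q\<in>{1..n}. factors_through (rank_fun n w p q) p q A)"
  unfolding matrix_schubert_variety_def
  using factors_through_rank rank_factors_through by blast

section \<open>Pivots of the columns\<close>

definition column_dependent :: "(nat \<times> nat \<Rightarrow> complex) \<Rightarrow> nat \<Rightarrow> nat \<Rightarrow> nat set \<Rightarrow> bool" where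
  "column_dependent A p q S \<longleftrightarrow> (\<exists>c. \<forall>i\<in>{1..p}. A (i, q) = (\<Sum>j\<in>S. c j * A (i, j)))"

text \<open>The row in which column \<open>q\<close> receives its pivot in column reduction from
  left to right; \<open>n + 1\<close> stands for a column without pivot.\<close>

definition pivot :: "nat \<Rightarrow> (nat \<times> nat \<Rightarrow> complex) \<Rightarrow> nat \<Rightarrow> nat" where
  "pivot n A q = (LEAST p. p = n + 1 \<or> \<not> column_dependent A p q {1..<q})"

lemma column_dependent_antimono: "column_dependent A p q S \<Longrightarrow> p' \<le> p \<Longrightarrow> column_dependent A p' q S"
  unfolding column_dependent_def by fastforce

lemma column_dependent_mono:
  assumes "column_dependent A p q S" "S \<subseteq> T" "finite T"
  shows "column_dependent A p q T"
proof -
  obtain c where c: "\<And>i. i \<in> {1..p} \<Longrightarrow> A (i, q) = (\<Sum>j\<in>S. c j * A (i, j))"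
    using assms(1) unfolding column_dependent_def by blast
  have "(\<Sum>j\<in>S. c j * A (i, j)) = (\<Sum>j\<in>T. (if j \<in> S then c j else 0) * A (i, j))" for i
    by (rule sum.mono_neutral_cong_left) (use assms in auto)
  with c show ?thesis
    unfolding column_dependent_def by (intro exI[of _ "\<lambda>j. if j \<in> S then c j else 0"]) simp
qed

lemma column_dependent_trans:
  assumes "column_dependent A p q S" "\<And>j. j \<in> S \<Longrightarrow> column_dependent A p j T"
  shows "column_dependent A p q T"
proof -
  obtain c where c: "\<And>i. i \<in> {1..p} \<Longrightarrow> A (i, q) = (\<Sum>j\<in>S. c j * A (i, j))"
    using assms(1) unfolding column_dependent_def by blast
  have "\<forall>j\<in>S. \<exists>d. \<forall>i\<in>{1..p}. A (i, j) = (\<Sum>l\<in>T. d l * A (i, l))"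
    using assms(2) unfolding column_dependent_def by blast
  from bchoice[OF this] obtain d where d: "\<forall>j\<in>S. \<forall>i\<in>{1..p}. A (i, j) = (\<Sum>l\<in>T. d j l * A (i, l))" ..
  have "A (i, q) = (\<Sum>l\<in>T. (\<Sum>j\<in>S. c j * d j l) * A (i, l))" if i: "i \<in> {1..p}" for i
  proof -
    have "A (i, q) = (\<Sum>j\<in>S. c j * A (i, j))" by (rule c[OF i])
    also have "\<dots> = (\<Sum>j\<in>S. c j * (\<Sum>l\<in>T. d j l * A (i, l)))"
      by (intro sum.cong refl arg_cong[of _ _ "(*) _"]) (use d i in blast)
    also have "\<dots> = (\<Sum>l\<in>T. (\<Sum>j\<in>S. c j * d j l) * A (i, l))"
      unfolding sum_distrib_left sum_distrib_right by (subst sum.swap) (simp add: mult_ac)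
    finally show ?thesis .
  qed
  then show ?thesis unfolding column_dependent_def by (intro exI[of _ "\<lambda>l. \<Sum>j\<in>S. c j * d j l"]) blast
qed

lemma pivot_le: "pivot n A q \<le> n + 1"
  unfolding pivot_def by (rule Least_le) simp

lemma pivot_pos: "1 \<le> pivot n A q"
proof -
  have "pivot n A q = n + 1 \<or> \<not> column_dependent A (pivot n A q) q {1..<q}"
    unfolding pivot_def by (rule LeastI[of _ "n + 1"]) simp
  moreover have "column_dependent A 0 q {1..<q}" by (simp add: column_dependent_def)
  ultimately show ?thesis by (cases "pivot n A q") auto
qed

lemma below_pivot: "p < pivot n A q \<Longrightarrow> column_dependent A p q {1..<q}"
  unfolding pivot_def using not_less_Least by blast

lemma above_pivot:
  assumes "pivot n A q \<le> p" "p \<le> n"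
  shows "\<not> column_dependent A p q {1..<q}"
proof -
  have "pivot n A q = n + 1 \<or> \<not> column_dependent A (pivot n A q) q {1..<q}"
    unfolding pivot_def by (rule LeastI[of _ "n + 1"]) simp
  with assms column_dependent_antimono show ?thesis by auto
qed

text \<open>Within the first \<open>p\<close> rows, a column without pivot there can be replaced by
  columns to its left; iterating leaves only columns with pivots in these rows. The exception
  \<open>q = 0\<close> is an index outside the matrix.\<close>

lemma column_dependent_on_pivots: "column_dependent A p q {j \<in> {1..q}. pivot n A j \<le> p} \<or> q = 0"
proof (induction q rule: less_induct)
  case (less q)
  show ?case
  proof (cases "pivot n A q \<le> p \<and> q \<noteq> 0")
    case True
    then show ?thesis
      unfolding column_dependent_def
      by (intro disjI1 exI[of _ "\<lambda>j. if j = q then 1 else 0"])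
        (simp add: if_distrib[of "\<lambda>x. x * _"] cong: if_cong)
  next
    case False
    show ?thesis
    proof (cases "q = 0")
      case q: False
      with False have "column_dependent A p q {1..<q}" by (intro below_pivot[of _ n]) auto
      then have "column_dependent A p q {j \<in> {1..q}. pivot n A j \<le> p}"
      proof (rule column_dependent_trans)
        fix j assume j: "j \<in> {1..<q}"
        with less.IH[of j] have "column_dependent A p j {l \<in> {1..j}. pivot n A l \<le> p}" by auto
        then show "column_dependent A p j {l \<in> {1..q}. pivot n A l \<le> p}"
          by (rule column_dependent_mono) (use j in auto)
      qed
      then show ?thesis ..
    qed simp
  qed
qed

lemma below_pivot_dependent:
  assumes "p < pivot n A q"
  shows "column_dependent A p q {j \<in> {1..<q}. pivot n A j \<le> p}"
proof (rule column_dependent_trans[OF below_pivot[OF assms]])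
  fix j assume j: "j \<in> {1..<q}"
  with column_dependent_on_pivots[of A p j n]
  have "column_dependent A p j {l \<in> {1..j}. pivot n A l \<le> p}" by auto
  then show "column_dependent A p j {l \<in> {1..<q}. pivot n A l \<le> p}"
    by (rule column_dependent_mono) (use j in auto)
qed

text \<open>Columns with pivot in the first \<open>p\<close> rows are independent there: in a linear
  relation, the last column with nonzero coefficient would depend on preceding ones, against the
  definition of its pivot.\<close>

lemma card_pivots_le:
  assumes "factors_through r p q A" "p \<le> n"
  shows "card {j \<in> {1..q}. pivot n A j \<le> p} \<le> r"
proof (rule ccontr)
  let ?T = "{j \<in> {1..q}. pivot n A j \<le> p}"
  assume "\<not> card ?T \<le> r"
  obtain B C where BC: "\<And>i j. i \<in> {1..p} \<Longrightarrow> j \<in> {1..q} \<Longrightarrow> A (i, j) = (\<Sum>l<r. B i l * C l j)"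
    using assms unfolding factors_through_def by blast
  have "\<exists>c. (\<exists>j\<in>?T. c j \<noteq> 0) \<and> (\<forall>l\<in>{..<r}. (\<Sum>j\<in>?T. c j * C l j) = 0)"
    by (rule homogeneous_system_solution) (use \<open>\<not> card ?T \<le> r\<close> in auto)
  then obtain c where c: "\<exists>j\<in>?T. c j \<noteq> 0" "\<And>l. l < r \<Longrightarrow> (\<Sum>j\<in>?T. c j * C l j) = 0" by auto
  have zero: "(\<Sum>j\<in>?T. c j * A (i, j)) = 0" if "i \<in> {1..p}" for i
  proof -
    have "(\<Sum>j\<in>?T. c j * A (i, j)) = (\<Sum>j\<in>?T. c j * (\<Sum>l<r. B i l * C l j))"
      by (intro sum.cong refl arg_cong[of _ _ "(*) _"] BC that) auto
    also have "\<dots> = (\<Sum>l<r. B i l * (\<Sum>j\<in>?T. c j * C l j))"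
      unfolding sum_distrib_left by (subst sum.swap) (simp add: mult_ac)
    finally show ?thesis using c(2) by simp
  qed
  define m where "m = Max {j \<in> ?T. c j \<noteq> 0}"
  have ne: "{j \<in> ?T. c j \<noteq> 0} \<noteq> {}" using c(1) by blast
  have m: "m \<in> ?T" "c m \<noteq> 0" using Max_in[OF _ ne] by (auto simp: m_def)
  have above: "c j = 0" if "j \<in> ?T" "m < j" for j
  proof (rule ccontr)
    assume "c j \<noteq> 0"
    with that(1) have "j \<le> m" unfolding m_def by (intro Max_ge) auto
    with that(2) show False by simp
  qed
  have "column_dependent A p m {j \<in> ?T. j < m}"
    unfolding column_dependent_def
  proof (intro exI[of _ "\<lambda>j. - c j / c m"] ballI)
    fix i assume i: "i \<in> {1..p}"
    have "0 = c m * A (i, m) + (\<Sum>j\<in>?T - {m}. c j * A (i, j))"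
      using zero[OF i] m(1) by (subst (asm) sum.remove[of _ m]) auto
    also have "(\<Sum>j\<in>?T - {m}. c j * A (i, j)) = (\<Sum>j\<in>{j \<in> ?T. j < m}. c j * A (i, j))"
    proof (rule sum.mono_neutral_right)
      show "\<forall>j\<in>?T - {m} - {j \<in> ?T. j < m}. c j * A (i, j) = 0"
      proof
        fix j assume j: "j \<in> ?T - {m} - {j \<in> ?T. j < m}"
        then have "c j = 0" by (intro above) auto
        then show "c j * A (i, j) = 0" by simp
      qed
    qed auto
    finally have "A (i, m) = - (\<Sum>j\<in>{j \<in> ?T. j < m}. c j * A (i, j)) / c m"
      using m(2) by (simp add: field_simps eq_neg_iff_add_eq_0)
    then show "A (i, m) = (\<Sum>j\<in>{j \<in> ?T. j < m}. - c j / c m * A (i, j))"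
      by (simp add: sum_divide_distrib sum_negf)
  qed
  then have "column_dependent A p m {1..<m}" by (rule column_dependent_mono) auto
  with above_pivot[of n A m p] m(1) assms(2) show False by auto
qed

text \<open>The cell with pivots \<open>\<pi>\<close>: the entries of the column \<open>q\<close> from row \<open>\<pi> q\<close> on are free, the
  entries above are given by free coefficients on the preceding columns with smaller pivot.\<close>

definition cell_params :: "nat \<Rightarrow> (nat \<Rightarrow> nat) \<Rightarrow> (nat \<times> nat + nat \<times> nat) set" where
  "cell_params n \<pi> = Inl ` {(j, q). j \<in> {1..n} \<and> q \<in> {1..n} \<and> j < q \<and> \<pi> j < \<pi> q} \<union>
     Inr ` {(p, q). q \<in> {1..n} \<and> p \<in> {\<pi> q..n}}"

function cell_entry :: "(nat \<Rightarrow> nat) \<Rightarrow> nat \<Rightarrow> nat \<Rightarrow> (nat \<times> nat + nat \<times> nat \<Rightarrow> complex) \<Rightarrow> complex" where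
  "cell_entry \<pi> p q t = (if \<pi> q \<le> p then t (Inr (p, q))
     else \<Sum>j\<in>{j \<in> {1..<q}. \<pi> j < \<pi> q}. t (Inl (j, q)) * cell_entry \<pi> p j t)"
  by auto
termination by (relation "measure (\<lambda>(\<pi>, p, q, t). q)") auto

declare cell_entry.simps [simp del]

lemma cell_entry_polyfun:
  assumes "p \<in> {1..n}" "q \<in> {1..n}"
  shows "cell_entry \<pi> p q \<in> polyfun (cell_params n \<pi>)"
  using assms(2)
proof (induction q rule: less_induct)
  case (less q)
  show ?case
  proof (cases "\<pi> q \<le> p")
    case True
    have "(\<lambda>t. t (Inr (p, q))) \<in> polyfun (cell_params n \<pi>)"
      by (rule polyfun_coord) (use assms less.prems True in \<open>auto simp: cell_params_def\<close>)
    moreover have "cell_entry \<pi> p q = (\<lambda>t. t (Inr (p, q)))"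
      using True by (simp add: fun_eq_iff cell_entry.simps[of _ _ q])
    ultimately show ?thesis by simp
  next
    case False
    have "(\<lambda>t. \<Sum>j\<in>{j \<in> {1..<q}. \<pi> j < \<pi> q}. t (Inl (j, q)) * cell_entry \<pi> p j t) \<in> polyfun (cell_params n \<pi>)"
    proof (intro polyfun.sum_mem polyfun_mult)
      fix j assume j: "j \<in> {j \<in> {1..<q}. \<pi> j < \<pi> q}"
      show "(\<lambda>t. t (Inl (j, q))) \<in> polyfun (cell_params n \<pi>)"
        by (rule polyfun_coord) (use j less.prems in \<open>auto simp: cell_params_def\<close>)
      show "cell_entry \<pi> p j \<in> polyfun (cell_params n \<pi>)"
        by (rule less.IH) (use j less.prems in auto)
    qed
    moreover have "cell_entry \<pi> p q = (\<lambda>t. \<Sum>j\<in>{j \<in> {1..<q}. \<pi> j < \<pi> q}. t (Inl (j, q)) * cell_entry \<pi> p j t)"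
      using False by (simp add: fun_eq_iff cell_entry.simps[of _ _ q])
    ultimately show ?thesis by simp
  qed
qed

lemma cell_cover:
  "\<exists>t. \<forall>p\<in>{1..n}. \<forall>q\<in>{1..n}. A (p, q) = cell_entry (pivot n A) p q t"
proof -
  have "\<forall>q. \<exists>c. \<forall>i\<in>{1..pivot n A q - 1}. A (i, q) = (\<Sum>j\<in>{j \<in> {1..<q}. pivot n A j < pivot n A q}. c j * A (i, j))"
  proof
    fix q
    \<comment> \<open>Down to the row just above its pivot a column depends on preceding columns,
      and those with smaller pivot suffice. The coefficients of this dependence are the parameters
      of the point.\<close>
    have "pivot n A q - 1 < pivot n A q" using pivot_pos[of n A q] by simp
    moreover have "{j \<in> {1..<q}. pivot n A j \<le> pivot n A q - 1} = {j \<in> {1..<q}. pivot n A j < pivot n A q}"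
      using pivot_pos[of n A q] by auto
    ultimately show "\<exists>c. \<forall>i\<in>{1..pivot n A q - 1}. A (i, q) = (\<Sum>j\<in>{j \<in> {1..<q}. pivot n A j < pivot n A q}. c j * A (i, j))"
      using below_pivot_dependent[of "pivot n A q - 1" n A q] unfolding column_dependent_def by simp
  qed
  from choice[OF this] obtain c where c: "\<forall>q. \<forall>i\<in>{1..pivot n A q - 1}.
    A (i, q) = (\<Sum>j\<in>{j \<in> {1..<q}. pivot n A j < pivot n A q}. c q j * A (i, j))" ..
  define t where "t x = (case x of Inl (j, q) \<Rightarrow> c q j | Inr (p, q) \<Rightarrow> A (p, q))" for x
  have "A (p, q) = cell_entry (pivot n A) p q t" if p: "p \<in> {1..n}" for p q
  proof (induction q rule: less_induct)
    case (less q)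
    show ?case
    proof (cases "pivot n A q \<le> p")
      case True
      then show ?thesis by (simp add: cell_entry.simps[of _ _ q] t_def)
    next
      case False
      then have "A (p, q) = (\<Sum>j\<in>{j \<in> {1..<q}. pivot n A j < pivot n A q}. c q j * A (p, j))"
        using c p by auto
      also have "\<dots> = (\<Sum>j\<in>{j \<in> {1..<q}. pivot n A j < pivot n A q}. t (Inl (j, q)) * cell_entry (pivot n A) p j t)"
      proof (rule sum.cong[OF refl])
        fix j assume "j \<in> {j \<in> {1..<q}. pivot n A j < pivot n A q}"
        then have "A (p, j) = cell_entry (pivot n A) p j t" by (intro less.IH) simp
        then show "c q j * A (p, j) = t (Inl (j, q)) * cell_entry (pivot n A) p j t"
          by (simp add: t_def)
      qed
      finally show ?thesis using False by (simp add: cell_entry.simps[of _ _ q])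
    qed
  qed
  then show ?thesis by blast
qed

section \<open>Bruhat order and dimensions of cells\<close>

definition column_rank :: "(nat \<Rightarrow> nat) \<Rightarrow> nat \<Rightarrow> nat \<Rightarrow> nat" where
  "column_rank \<pi> p q = card {j \<in> {1..q}. \<pi> j \<le> p}"

text \<open>The number of parameters of the cell: noninversions of \<open>\<pi>\<close> count the
  coefficients, the second sum counts the free entries.\<close>

definition cell_dim :: "nat \<Rightarrow> (nat \<Rightarrow> nat) \<Rightarrow> nat" where
  "cell_dim n \<pi> = (\<Sum>x\<in>{1..n}. \<Sum>y\<in>{1..n}. of_bool (x < y \<and> \<pi> x < \<pi> y)) + (\<Sum>q\<in>{1..n}. n + 1 - \<pi> q)"

lemma double_sum_insert:
  fixes g :: "'a \<Rightarrow> 'a \<Rightarrow> nat"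
  assumes "finite S" "i \<notin> S"
  shows "(\<Sum>x\<in>insert i S. \<Sum>y\<in>insert i S. g x y) =
    g i i + (\<Sum>y\<in>S. g i y + g y i) + (\<Sum>x\<in>S. \<Sum>y\<in>S. g x y)"
  using assms by (simp add: sum.distrib algebra_simps)

text \<open>Only pairs meeting \<open>{i, j}\<close> change their status. The pair itself becomes a
  noninversion, and any third position forms at least as many noninversions with \<open>i\<close>
  and \<open>j\<close> together as before.\<close>

lemma cell_dim_swap:
  assumes ij: "i \<in> {1..n}" "j \<in> {1..n}" "i < j" and "\<pi> j < \<pi> i"
  shows "cell_dim n \<pi> < cell_dim n ((\<pi>(i := \<pi> j))(j := \<pi> i))"
proof -
  let ?\<pi> = "(\<pi>(i := \<pi> j))(j := \<pi> i)"
  define S where "S = {1..n} - {i, j}"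
  have A: "{1..n} = insert i (insert j S)" using ij by (auto simp: S_def)
  have S: "finite S" "j \<notin> S" "i \<notin> insert j S" "finite (insert j S)" using ij by (auto simp: S_def)
  define g where "g \<pi> x y = (of_bool (x < y \<and> \<pi> x < \<pi> y) :: nat)" for \<pi> :: "nat \<Rightarrow> nat" and x y
  have exp: "(\<Sum>x\<in>{1..n}. \<Sum>y\<in>{1..n}. g \<pi> x y) = g \<pi> i j + g \<pi> j i +
      (\<Sum>y\<in>S. (g \<pi> i y + g \<pi> y i) + (g \<pi> j y + g \<pi> y j)) + (\<Sum>x\<in>S. \<Sum>y\<in>S. g \<pi> x y)" for \<pi>
    unfolding A double_sum_insert[OF S(4,3)] double_sum_insert[OF S(1,2)]
    using S by (simp add: sum.distrib g_def)
  have "(\<Sum>y\<in>S. (g \<pi> i y + g \<pi> y i) + (g \<pi> j y + g \<pi> y j)) \<le>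
      (\<Sum>y\<in>S. (g ?\<pi> i y + g ?\<pi> y i) + (g ?\<pi> j y + g ?\<pi> y j))"
  proof (rule sum_mono)
    fix y assume "y \<in> S"
    then have y: "y \<noteq> i" "y \<noteq> j" by (auto simp: S_def)
    consider "y < i" | "i < y" "y < j" | "j < y" using y by linarith
    then show "(g \<pi> i y + g \<pi> y i) + (g \<pi> j y + g \<pi> y j) \<le>
      (g ?\<pi> i y + g ?\<pi> y i) + (g ?\<pi> j y + g ?\<pi> y j)"
      using y ij(3) assms(4) by cases (auto simp: g_def)
  qed
  moreover have "(\<Sum>x\<in>S. \<Sum>y\<in>S. g \<pi> x y) = (\<Sum>x\<in>S. \<Sum>y\<in>S. g ?\<pi> x y)"
    by (intro sum.cong refl) (auto simp: g_def S_def)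
  moreover have "g \<pi> i j + g \<pi> j i = 0" "g ?\<pi> i j = 1" using assms by (auto simp: g_def)
  ultimately have "(\<Sum>x\<in>{1..n}. \<Sum>y\<in>{1..n}. g \<pi> x y) < (\<Sum>x\<in>{1..n}. \<Sum>y\<in>{1..n}. g ?\<pi> x y)"
    unfolding exp by linarith
  moreover have "(\<Sum>q\<in>{1..n}. n + 1 - \<pi> q) = (\<Sum>q\<in>{1..n}. n + 1 - ?\<pi> q)"
  proof -
    have "(\<Sum>q\<in>S. n + 1 - \<pi> q) = (\<Sum>q\<in>S. n + 1 - ?\<pi> q)"
      by (rule sum.cong) (auto simp: S_def)
    then show ?thesis unfolding A using S ij by simp
  qed
  ultimately show ?thesis by (simp add: cell_dim_def g_def)
qed

text \<open>Lowering the value frees \<open>\<pi> i - a\<close> more entries. Noninversions are lost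
  only with earlier positions whose values lie strictly between \<open>a\<close> and
  \<open>\<pi> i\<close>; these values are distinct, so at most \<open>\<pi> i - a - 1\<close> are
  lost.\<close>

lemma cell_dim_lower:
  assumes i: "i \<in> {1..n}" and a: "a < \<pi> i" "\<pi> i \<le> n + 1"
    and inj: "inj_on \<pi> {1..<i}" "a \<notin> \<pi> ` {1..<i}"
    and later: "\<And>y. y \<in> {i<..n} \<Longrightarrow> \<not> (a \<le> \<pi> y \<and> \<pi> y < \<pi> i)"
  shows "cell_dim n \<pi> < cell_dim n (\<pi>(i := a))"
proof -
  let ?\<pi> = "\<pi>(i := a)"
  define S where "S = {1..n} - {i}"
  have A: "{1..n} = insert i S" using i by (auto simp: S_def)
  have S: "finite S" "i \<notin> S" by (auto simp: S_def)
  define g where "g \<pi> x y = (of_bool (x < y \<and> \<pi> x < \<pi> y) :: nat)" for \<pi> :: "nat \<Rightarrow> nat" and x y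
  define L where "L = {y \<in> {1..<i}. a < \<pi> y \<and> \<pi> y < \<pi> i}"
  have exp: "(\<Sum>x\<in>{1..n}. \<Sum>y\<in>{1..n}. g \<pi> x y) =
      (\<Sum>y\<in>S. g \<pi> i y + g \<pi> y i) + (\<Sum>x\<in>S. \<Sum>y\<in>S. g \<pi> x y)" for \<pi>
    unfolding A double_sum_insert[OF S] by (simp add: g_def)
  have "(\<Sum>y\<in>S. g \<pi> i y + g \<pi> y i) \<le> (\<Sum>y\<in>S. (g ?\<pi> i y + g ?\<pi> y i) + of_bool (y \<in> L))"
  proof (rule sum_mono)
    fix y assume "y \<in> S"
    then have y: "y \<in> {1..n}" "y \<noteq> i" by (auto simp: S_def)
    show "g \<pi> i y + g \<pi> y i \<le> (g ?\<pi> i y + g ?\<pi> y i) + of_bool (y \<in> L)"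
    proof (cases "y < i")
      case True
      with y have "\<pi> y \<noteq> a" using inj(2) by force
      with True y a show ?thesis by (auto simp: g_def L_def of_bool_def)
    next
      case False
      with y a show ?thesis by (auto simp: g_def of_bool_def)
    qed
  qed
  also have "\<dots> = (\<Sum>y\<in>S. g ?\<pi> i y + g ?\<pi> y i) + (\<Sum>y\<in>S. of_bool (y \<in> L))"
    by (rule sum.distrib)
  also have "(\<Sum>y\<in>S. of_bool (y \<in> L)) = card L"
  proof -
    have "S \<inter> L = L" using i by (auto simp: S_def L_def)
    then show ?thesis using S by (simp add: of_bool_def sum.If_cases Int_def)
  qed
  finally have "(\<Sum>y\<in>S. g \<pi> i y + g \<pi> y i) \<le> (\<Sum>y\<in>S. g ?\<pi> i y + g ?\<pi> y i) + card L" .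
  moreover have "card L \<le> card {a<..<\<pi> i}"
    by (rule card_inj_on_le[of \<pi>]) (auto simp: L_def intro: inj_on_subset[OF inj(1)])
  then have "card L \<le> \<pi> i - a - 1" by simp
  moreover have "(\<Sum>x\<in>S. \<Sum>y\<in>S. g \<pi> x y) = (\<Sum>x\<in>S. \<Sum>y\<in>S. g ?\<pi> x y)"
    by (intro sum.cong refl) (auto simp: g_def S_def)
  moreover have "(\<Sum>q\<in>{1..n}. n + 1 - ?\<pi> q) = (\<Sum>q\<in>{1..n}. n + 1 - \<pi> q) + (\<pi> i - a)"
  proof -
    have "(\<Sum>q\<in>S. n + 1 - \<pi> q) = (\<Sum>q\<in>S. n + 1 - ?\<pi> q)"
      by (rule sum.cong) (auto simp: S_def)
    then show ?thesis unfolding A using S a by simp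
  qed
  ultimately have "(\<Sum>x\<in>{1..n}. \<Sum>y\<in>{1..n}. g \<pi> x y) + (\<Sum>q\<in>{1..n}. n + 1 - \<pi> q) <
      (\<Sum>x\<in>{1..n}. \<Sum>y\<in>{1..n}. g ?\<pi> x y) + (\<Sum>q\<in>{1..n}. n + 1 - ?\<pi> q)"
    unfolding exp using a by linarith
  then show ?thesis by (simp add: cell_dim_def g_def)
qed

text \<open>One step up in Bruhat order, staying below \<open>u\<close>: at the first place \<open>i\<close> where \<open>\<pi>\<close> and \<open>u\<close> differ,
  the value of \<open>\<pi>\<close> is lowered, either by exchanging it with the next later value in
  \<open>[u i, \<pi> i)\<close>, or down to \<open>u i\<close> if there is none.\<close>

lemma bruhat_step:
  assumes u: "inj_on u {1..n}" "u ` {1..n} \<subseteq> {1..n}" and \<pi>: "\<pi> ` {1..n} \<subseteq> {1..n + 1}"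
    and le: "\<And>p q. p \<in> {1..n} \<Longrightarrow> q \<in> {1..n} \<Longrightarrow> column_rank \<pi> p q \<le> column_rank u p q"
    and neq: "\<exists>j\<in>{1..n}. \<pi> j \<noteq> u j"
  shows "\<exists>\<rho>. \<rho> ` {1..n} \<subseteq> {1..n + 1} \<and> cell_dim n \<pi> < cell_dim n \<rho> \<and>
    (\<forall>p\<in>{1..n}. \<forall>q\<in>{1..n}. column_rank \<rho> p q \<le> column_rank u p q)"
proof -
  define i where "i = (LEAST j. j \<in> {1..n} \<and> \<pi> j \<noteq> u j)"
  have i: "i \<in> {1..n}" "\<pi> i \<noteq> u i"
  proof -
    have "\<exists>j. j \<in> {1..n} \<and> \<pi> j \<noteq> u j" using neq by blast
    from LeastI_ex[OF this] show "i \<in> {1..n}" "\<pi> i \<noteq> u i" unfolding i_def by blast+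
  qed
  have agree: "\<pi> j = u j" if "j \<in> {1..<i}" for j
  proof (rule ccontr)
    assume "\<pi> j \<noteq> u j"
    with that i(1) have "j \<in> {1..n} \<and> \<pi> j \<noteq> u j" by auto
    from Least_le[of "\<lambda>j. j \<in> {1..n} \<and> \<pi> j \<noteq> u j", OF this] that show False by (simp add: i_def)
  qed
  define a0 where "a0 = u i"
  have a0: "a0 \<in> {1..n}" using u(2) i(1) unfolding a0_def by blast
  \<comment> \<open>A value of \<open>\<pi>\<close> at \<open>i\<close> smaller than
    \<open>u i\<close> would put one more dot of \<open>\<pi>\<close> than of \<open>u\<close> into
    the first \<open>\<pi> i\<close> rows and \<open>i\<close> columns, against the rank
    condition.\<close>
  have less: "a0 < \<pi> i"
  proof (rule ccontr)
    assume "\<not> a0 < \<pi> i"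
    with i(2) have lt: "\<pi> i < u i" by (simp add: a0_def)
    have "{j \<in> {1..i}. \<pi> j \<le> \<pi> i} = insert i {j \<in> {1..i}. u j \<le> \<pi> i}"
    proof (rule Set.set_eqI)
      fix j
      show "j \<in> {j \<in> {1..i}. \<pi> j \<le> \<pi> i} \<longleftrightarrow> j \<in> insert i {j \<in> {1..i}. u j \<le> \<pi> i}"
        using agree[of j] lt i(1) by (cases "j = i") auto
    qed
    moreover have "i \<notin> {j \<in> {1..i}. u j \<le> \<pi> i}" using lt by simp
    ultimately have "column_rank \<pi> (\<pi> i) i = Suc (column_rank u (\<pi> i) i)"
      unfolding column_rank_def by (simp only: card_insert_disjoint[of "{j \<in> {1..i}. u j \<le> \<pi> i}"] finite_Collect_conjI
          finite_atLeastAtMost Collect_mem_eq simp_thms)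
    moreover have "\<pi> i \<in> {1..n}" using \<pi> i(1) lt a0 by (auto simp: a0_def image_subset_iff)
    ultimately show False using le[of "\<pi> i" i] i(1) by simp
  qed
  \<comment> \<open>At these \<open>(p, q)\<close> the step may raise the rank by one, so strict
    inequality must hold beforehand. It is obtained by comparison with row \<open>a0 - 1\<close>: in
    the first \<open>q\<close> columns, \<open>\<pi>\<close> takes values in \<open>[a0, p]\<close>
    only left of \<open>i\<close>, where it agrees with \<open>u\<close>, while \<open>u\<close>
    takes in addition the value \<open>u i\<close>.\<close>
  have room: "Suc (column_rank \<pi> p q) \<le> column_rank u p q"
    if j: "\<And>l. i < l \<Longrightarrow> l < j \<Longrightarrow> l \<le> n \<Longrightarrow> \<not> (a0 \<le> \<pi> l \<and> \<pi> l < \<pi> i)"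
      and pq: "p \<in> {1..n}" "q \<in> {1..n}" "i \<le> q" "q < j" "a0 \<le> p" "p < \<pi> i" for j p q
  proof -
    define K where "K = {l \<in> {1..<i}. a0 \<le> u l \<and> u l \<le> p}"
    have eq: "{l \<in> {1..q}. \<pi> l \<le> p} = {l \<in> {1..q}. \<pi> l \<le> a0 - 1} \<union> K"
    proof (rule Set.set_eqI)
      fix l
      consider "l < i" | "l = i" | "l > i" by linarith
      then show "l \<in> {l \<in> {1..q}. \<pi> l \<le> p} \<longleftrightarrow> l \<in> {l \<in> {1..q}. \<pi> l \<le> a0 - 1} \<union> K"
      proof cases
        case 1
        then show ?thesis using agree[of l] pq a0 by (cases "l = 0") (auto simp: K_def)
      next
        case 2
        then show ?thesis using pq less by (auto simp: K_def)
      next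
        case 3
        then show ?thesis using j[of l] pq less a0 by (auto simp: K_def)
      qed
    qed
    have disj: "{l \<in> {1..q}. \<pi> l \<le> a0 - 1} \<inter> K = {}" "{l \<in> {1..q}. u l \<le> a0 - 1} \<inter> insert i K = {}"
      using agree a0 by (auto simp: K_def a0_def)
    have fin: "finite K" "i \<notin> K" by (auto simp: K_def)
    have "column_rank \<pi> p q = column_rank \<pi> (a0 - 1) q + card K"
      unfolding column_rank_def eq using disj(1) fin by (intro card_Un_disjoint) auto
    also have "column_rank \<pi> (a0 - 1) q \<le> column_rank u (a0 - 1) q"
    proof (cases "a0 = 1")
      case True
      have "{l \<in> {1..q}. \<pi> l \<le> a0 - 1} = {}" using \<pi> pq True by (force simp: image_subset_iff)
      then have "column_rank \<pi> (a0 - 1) q = 0" unfolding column_rank_def by (simp only: card.empty)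
      then show ?thesis by (simp only: zero_le)
    next
      case False
      then show ?thesis using a0 pq by (intro le) auto
    qed
    finally have "Suc (column_rank \<pi> p q) \<le> column_rank u (a0 - 1) q + card (insert i K)"
      using fin by simp
    also have "\<dots> = card ({l \<in> {1..q}. u l \<le> a0 - 1} \<union> insert i K)"
      unfolding column_rank_def using disj(2) fin by (intro card_Un_disjoint[symmetric]) auto
    also have "\<dots> \<le> column_rank u p q"
      unfolding column_rank_def
      by (rule card_mono) (use pq i(1) a0 in \<open>auto simp: K_def a0_def\<close>)
    finally show ?thesis .
  qed
  show ?thesis
  proof (cases "\<exists>l\<in>{i<..n}. a0 \<le> \<pi> l \<and> \<pi> l < \<pi> i")
    case True
    define j where "j = (LEAST l. l \<in> {i<..n} \<and> a0 \<le> \<pi> l \<and> \<pi> l < \<pi> i)"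
    have j: "j \<in> {i<..n}" "a0 \<le> \<pi> j" "\<pi> j < \<pi> i"
    proof -
      have "\<exists>l. l \<in> {i<..n} \<and> a0 \<le> \<pi> l \<and> \<pi> l < \<pi> i" using True by blast
      from LeastI_ex[OF this] show "j \<in> {i<..n}" "a0 \<le> \<pi> j" "\<pi> j < \<pi> i" unfolding j_def by blast+
    qed
    have min: "\<not> (a0 \<le> \<pi> l \<and> \<pi> l < \<pi> i)" if "i < l" "l < j" "l \<le> n" for l
      using not_less_Least[of l "\<lambda>l. l \<in> {i<..n} \<and> a0 \<le> \<pi> l \<and> \<pi> l < \<pi> i"] that unfolding j_def by auto
    let ?\<rho> = "(\<pi>(i := \<pi> j))(j := \<pi> i)"
    have "column_rank ?\<rho> p q \<le> column_rank u p q" if pq: "p \<in> {1..n}" "q \<in> {1..n}" for p q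
    proof -
      consider "q < i" | "j \<le> q" | "i \<le> q" "q < j" "p < \<pi> j \<or> \<pi> i \<le> p" | "i \<le> q" "q < j" "\<pi> j \<le> p" "p < \<pi> i"
        by linarith
      then show ?thesis
      proof cases
        case 1
        then have "{l \<in> {1..q}. ?\<rho> l \<le> p} = {l \<in> {1..q}. \<pi> l \<le> p}" using j by auto
        then show ?thesis using le[OF pq] by (simp add: column_rank_def)
      next
        case 2
        let ?\<tau> = "Transposition.transpose i j"
        have "{l \<in> {1..q}. ?\<rho> l \<le> p} = ?\<tau> ` {l \<in> {1..q}. \<pi> l \<le> p}"
        proof (rule Set.set_eqI)
          fix l
          have "l \<in> ?\<tau> ` {l \<in> {1..q}. \<pi> l \<le> p} \<longleftrightarrow> ?\<tau> l \<in> {l \<in> {1..q}. \<pi> l \<le> p}"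
            by (metis (no_types, lifting) image_iff transpose_involutory)
          also have "\<dots> \<longleftrightarrow> l \<in> {l \<in> {1..q}. ?\<rho> l \<le> p}"
            using 2 j i(1) by (auto simp: Transposition.transpose_def)
          finally show "l \<in> {l \<in> {1..q}. ?\<rho> l \<le> p} \<longleftrightarrow> l \<in> ?\<tau> ` {l \<in> {1..q}. \<pi> l \<le> p}" ..
        qed
        then have "column_rank ?\<rho> p q = column_rank \<pi> p q"
          unfolding column_rank_def by (simp add: card_image)
        then show ?thesis using le[OF pq] by simp
      next
        case 3
        then have "{l \<in> {1..q}. ?\<rho> l \<le> p} = {l \<in> {1..q}. \<pi> l \<le> p}" using j by auto
        then show ?thesis using le[OF pq] by (simp add: column_rank_def)
      next
        case 4
        have "{l \<in> {1..q}. ?\<rho> l \<le> p} \<subseteq> insert i {l \<in> {1..q}. \<pi> l \<le> p}" using 4 by auto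
        then have "column_rank ?\<rho> p q \<le> card (insert i {l \<in> {1..q}. \<pi> l \<le> p})"
          unfolding column_rank_def by (intro card_mono) auto
        also have "\<dots> \<le> Suc (column_rank \<pi> p q)"
          unfolding column_rank_def by (rule card_insert_le_m1[THEN order_trans]) (auto intro: card_insert_le)
        also have "\<dots> \<le> column_rank u p q"
          by (rule room[OF min]) (use 4 pq j in auto)
        finally show ?thesis .
      qed
    qed
    moreover have "cell_dim n \<pi> < cell_dim n ?\<rho>"
      by (rule cell_dim_swap) (use i j in auto)
    moreover have "?\<rho> ` {1..n} \<subseteq> {1..n + 1}"
      using \<pi> i(1) j(1) by (auto simp: image_subset_iff)
    ultimately show ?thesis by blast
  next
    case False
    let ?\<rho> = "\<pi>(i := a0)"
    have "column_rank ?\<rho> p q \<le> column_rank u p q" if pq: "p \<in> {1..n}" "q \<in> {1..n}" for p q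
    proof (cases "i \<le> q \<and> a0 \<le> p \<and> p < \<pi> i")
      case True
      have "{l \<in> {1..q}. ?\<rho> l \<le> p} \<subseteq> insert i {l \<in> {1..q}. \<pi> l \<le> p}" using True by auto
      then have "column_rank ?\<rho> p q \<le> card (insert i {l \<in> {1..q}. \<pi> l \<le> p})"
        unfolding column_rank_def by (intro card_mono) auto
      also have "\<dots> \<le> Suc (column_rank \<pi> p q)"
        unfolding column_rank_def by (rule card_insert_le_m1[THEN order_trans]) (auto intro: card_insert_le)
      also have "\<dots> \<le> column_rank u p q"
        by (rule room[of "n + 1"]) (use False True pq in auto)
      finally show ?thesis .
    next
      case outside: False
      then have "{l \<in> {1..q}. ?\<rho> l \<le> p} = {l \<in> {1..q}. \<pi> l \<le> p}" using less by auto
      then show ?thesis using le[OF pq] by (simp add: column_rank_def)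
    qed
    moreover have "cell_dim n \<pi> < cell_dim n ?\<rho>"
    proof (rule cell_dim_lower[of i n a0 \<pi>])
      show "i \<in> {1..n}" "a0 < \<pi> i" by (rule i(1), rule less)
      show "\<pi> i \<le> n + 1" using \<pi> i(1) by (auto simp: image_subset_iff)
      have sub: "{1..<i} \<subseteq> {1..n}" using i(1) by auto
      show "inj_on \<pi> {1..<i}"
        using inj_on_subset[OF u(1) sub] inj_on_cong[of "{1..<i}" \<pi> u] agree by blast
      show "a0 \<notin> \<pi> ` {1..<i}"
      proof
        assume "a0 \<in> \<pi> ` {1..<i}"
        then obtain l where l: "l \<in> {1..<i}" "a0 = \<pi> l" by blast
        then have "u i = u l" using agree by (simp add: a0_def)
        then have "i = l" by (rule inj_onD[OF u(1)]) (use i(1) l(1) in auto)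
        with l(1) show False by simp
      qed
    qed (use False in auto)
    moreover have "?\<rho> ` {1..n} \<subseteq> {1..n + 1}"
      using \<pi> a0 by (auto simp: image_subset_iff)
    ultimately show ?thesis by blast
  qed
qed

lemma cell_dim_le: "cell_dim n \<pi> \<le> n * n + n * (n + 1)"
proof -
  have "(\<Sum>x\<in>{1..n}. \<Sum>y\<in>{1..n}. of_bool (x < y \<and> \<pi> x < \<pi> y)) \<le> (\<Sum>x\<in>{1..n}. \<Sum>y\<in>{1..n}. 1 :: nat)"
    by (intro sum_mono) simp
  moreover have "(\<Sum>q\<in>{1..n}. n + 1 - \<pi> q) \<le> (\<Sum>q\<in>{1..n}. n + 1)"
    by (intro sum_mono) simp
  ultimately show ?thesis by (simp add: cell_dim_def)
qed

text \<open>Each step raises \<open>cell_dim\<close> strictly, and \<open>cell_dim\<close> is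
  bounded; the ascent can only end at \<open>u\<close>.\<close>

lemma bruhat_cell_dim:
  assumes u: "inj_on u {1..n}" "u ` {1..n} \<subseteq> {1..n}" and "\<pi> ` {1..n} \<subseteq> {1..n + 1}"
    and "\<And>p q. p \<in> {1..n} \<Longrightarrow> q \<in> {1..n} \<Longrightarrow> column_rank \<pi> p q \<le> column_rank u p q"
    and "\<exists>j\<in>{1..n}. \<pi> j \<noteq> u j"
  shows "cell_dim n \<pi> < cell_dim n u"
  using assms(3-)
proof (induction "n * n + n * (n + 1) - cell_dim n \<pi>" arbitrary: \<pi> rule: less_induct)
  case less
  from bruhat_step[OF u less.prems] obtain \<rho> where \<rho>: "\<rho> ` {1..n} \<subseteq> {1..n + 1}"
    "cell_dim n \<pi> < cell_dim n \<rho>"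
    "\<And>p q. p \<in> {1..n} \<Longrightarrow> q \<in> {1..n} \<Longrightarrow> column_rank \<rho> p q \<le> column_rank u p q" by blast
  show ?case
  proof (cases "\<exists>j\<in>{1..n}. \<rho> j \<noteq> u j")
    case True
    have "n * n + n * (n + 1) - cell_dim n \<rho> < n * n + n * (n + 1) - cell_dim n \<pi>"
      using \<rho>(2) cell_dim_le[of n \<rho>] by linarith
    from less.hyps[OF this \<rho>(1,3) True] \<rho>(2) show ?thesis by simp
  next
    case False
    then have "cell_dim n \<rho> = cell_dim n u" by (simp add: cell_dim_def)
    with \<rho>(2) show ?thesis by simp
  qed
qed

lemma card_cell_params:
  assumes "\<pi> ` {1..n} \<subseteq> {1..n + 1}"
  shows "finite (cell_params n \<pi>)" "card (cell_params n \<pi>) = cell_dim n \<pi>"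
proof -
  let ?P = "{(j, q). j \<in> {1..n} \<and> q \<in> {1..n} \<and> j < q \<and> \<pi> j < \<pi> q}"
  let ?F = "{(p, q). q \<in> {1..n} \<and> p \<in> {\<pi> q..n}}"
  have P: "?P = (SIGMA j:{1..n}. {q \<in> {1..n}. j < q \<and> \<pi> j < \<pi> q})" by auto
  have F: "?F = prod.swap ` (SIGMA q:{1..n}. {\<pi> q..n})" by (auto simp: image_iff)
  have finP: "finite ?P" unfolding P by (intro finite_SigmaI) auto
  have finF: "finite ?F" unfolding F by (intro finite_imageI finite_SigmaI) auto
  have "card ?P = (\<Sum>j\<in>{1..n}. card {q \<in> {1..n}. j < q \<and> \<pi> j < \<pi> q})"
    unfolding P by (rule card_SigmaI) auto
  also have "\<dots> = (\<Sum>x\<in>{1..n}. \<Sum>y\<in>{1..n}. of_bool (x < y \<and> \<pi> x < \<pi> y))"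
    by (intro sum.cong refl) (simp add: of_bool_def sum.If_cases Int_def)
  finally have cP: "card ?P = (\<Sum>x\<in>{1..n}. \<Sum>y\<in>{1..n}. of_bool (x < y \<and> \<pi> x < \<pi> y))" .
  have "card ?F = (\<Sum>q\<in>{1..n}. card {\<pi> q..n})"
    unfolding F by (subst card_image) (auto simp: card_SigmaI intro: inj_swap inj_on_subset)
  then have cF: "card ?F = (\<Sum>q\<in>{1..n}. n + 1 - \<pi> q)" by simp
  show "finite (cell_params n \<pi>)" unfolding cell_params_def using finP finF by simp
  have "card (cell_params n \<pi>) = card (Inl ` ?P :: (nat \<times> nat + nat \<times> nat) set) + card (Inr ` ?F :: (nat \<times> nat + nat \<times> nat) set)"
    unfolding cell_params_def using finP finF by (intro card_Un_disjoint) auto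
  also have "\<dots> = cell_dim n \<pi>"
    using cP cF by (simp add: card_image cell_dim_def)
  finally show "card (cell_params n \<pi>) = cell_dim n \<pi>" .
qed

text \<open>The grid splits into three parts. Boxes at or below the dot of their column are the free
  entries; boxes above it form the diagram if they lie left of the dot of their row, and otherwise
  correspond to noninversions of the inverse.\<close>

lemma card_rothe_diagram:
  assumes w: "w permutes {1..n}"
  shows "cell_dim n (inv_into UNIV w) + card (rothe_diagram n w) = n * n"
proof -
  let ?u = "inv_into UNIV w"
  have u: "?u permutes {1..n}" using w by (rule permutes_inv)
  have uim: "?u ` {1..n} \<subseteq> {1..n + 1}" using permutes_image[OF u] by auto
  let ?P = "{(j, q). j \<in> {1..n} \<and> q \<in> {1..n} \<and> j < q \<and> ?u j < ?u q}"
  let ?F = "{(p, q). q \<in> {1..n} \<and> p \<in> {?u q..n}}"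
  let ?D = "rothe_diagram n w"
  let ?N = "(\<lambda>(j, q). (?u j, q)) ` ?P"
  have in_u: "?u q \<in> {1..n} \<longleftrightarrow> q \<in> {1..n}" for q using permutes_in_image[OF u] .
  have in_w: "w q \<in> {1..n} \<longleftrightarrow> q \<in> {1..n}" for q using permutes_in_image[OF w] .
  have wu: "w (?u q) = q" "?u (w q) = q" for q using permutes_inverses[OF w] by auto
  have N: "?N = {(p, q) \<in> grid n. p < ?u q \<and> w p < q}"
  proof (rule equalityI; rule subsetI)
    fix x assume "x \<in> ?N"
    then obtain j q where "x = (?u j, q)" "j \<in> {1..n}" "q \<in> {1..n}" "j < q" "?u j < ?u q" by auto
    then show "x \<in> {(p, q) \<in> grid n. p < ?u q \<and> w p < q}"
      using in_u[of j] by (simp add: grid_def wu)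
  next
    fix x assume "x \<in> {(p, q) \<in> grid n. p < ?u q \<and> w p < q}"
    then obtain p q where x: "x = (p, q)" "(p, q) \<in> grid n" "p < ?u q" "w p < q" by auto
    then have "(w p, q) \<in> ?P" using in_w[of p] by (auto simp: grid_def wu)
    then show "x \<in> ?N" by (rule rev_image_eqI) (simp add: x wu)
  qed
  have D: "?D = {(p, q) \<in> grid n. p < ?u q \<and> q < w p}" by (auto simp: rothe_diagram_def)
  have split: "grid n = ?F \<union> ?D \<union> ?N"
  proof (rule equalityI; rule subsetI)
    fix x assume "x \<in> grid n"
    then obtain p q where x: "x = (p, q)" "(p, q) \<in> grid n" by (cases x) auto
    have ne: "w p \<noteq> q \<or> ?u q = p" using wu by blast
    consider "?u q \<le> p" | "p < ?u q" "q < w p" | "p < ?u q" "w p < q" using ne by linarith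
    then show "x \<in> ?F \<union> ?D \<union> ?N"
    proof cases
      case 1
      then have "x \<in> ?F" using x by (auto simp: grid_def)
      then show ?thesis by blast
    next
      case 2
      then have "x \<in> ?D" using x unfolding D by blast
      then show ?thesis by blast
    next
      case 3
      then have "x \<in> ?N" using x unfolding N by blast
      then show ?thesis by blast
    qed
  next
    fix x assume x: "x \<in> ?F \<union> ?D \<union> ?N"
    have "(p, q) \<in> grid n" if "q \<in> {1..n}" "p \<in> {?u q..n}" for p q
      using in_u[of q] that by (auto simp: grid_def)
    then show "x \<in> grid n" using x unfolding N D by blast
  qed
  have fin: "finite (grid n)" by (simp add: grid_def)
  have sub: "?F \<subseteq> grid n" "?D \<subseteq> grid n" "?N \<subseteq> grid n" using split by blast+
  note fins = sub[THEN finite_subset, OF fin]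
  have FDN: "(?F \<union> ?D) \<inter> ?N = {}" unfolding N D by force
  have FD: "?F \<inter> ?D = {}" unfolding D by force
  have "n * n = card (grid n)" by (simp add: grid_def card_cartesian_product)
  also have "\<dots> = card ((?F \<union> ?D) \<union> ?N)" by (rule arg_cong[OF split])
  also have "\<dots> = card (?F \<union> ?D) + card ?N"
    by (rule card_Un_disjoint[OF _ fins(3) FDN]) (rule finite_UnI[OF fins(1,2)])
  also have "card (?F \<union> ?D) = card ?F + card ?D"
    by (rule card_Un_disjoint[OF fins(1,2) FD])
  also have "card ?N = card ?P"
    by (rule card_image) (auto simp: inj_on_def dest: injD[OF permutes_inj[OF u]])
  also have "card ?F + card ?D + card ?P = cell_dim n ?u + card ?D"
  proof -
    have "finite ?P" by (rule finite_subset[of _ "{1..n} \<times> {1..n}"]) auto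
    then have "card (cell_params n ?u) = card (Inl ` ?P :: (nat \<times> nat + nat \<times> nat) set) + card (Inr ` ?F :: (nat \<times> nat + nat \<times> nat) set)"
      unfolding cell_params_def using fins by (intro card_Un_disjoint) auto
    then show ?thesis using card_cell_params(2)[OF uim] by (simp add: card_image)
  qed
  finally show ?thesis ..
qed

section \<open>Coxeter length\<close>

definition inversions :: "nat \<Rightarrow> (nat \<Rightarrow> nat) \<Rightarrow> (nat \<times> nat) set" where
  "inversions n w = {(a, b). a \<in> {1..n} \<and> b \<in> {1..n} \<and> a < b \<and> w b < w a}"

lemma finite_inversions: "finite (inversions n w)"
  by (rule finite_subset[of _ "{1..n} \<times> {1..n}"]) (auto simp: inversions_def)

lemma card_inversions:
  assumes w: "w permutes {1..n}"
  shows "card (inversions n w) = card (rothe_diagram n w)"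
proof -
  let ?u = "inv_into UNIV w"
  have in_u: "?u q \<in> {1..n} \<longleftrightarrow> q \<in> {1..n}" for q by (rule permutes_in_image[OF permutes_inv[OF w]])
  have in_w: "w q \<in> {1..n} \<longleftrightarrow> q \<in> {1..n}" for q by (rule permutes_in_image[OF w])
  have wu: "w (?u q) = q" "?u (w q) = q" for q using permutes_inverses[OF w] by auto
  have "rothe_diagram n w = (\<lambda>(a, b). (a, w b)) ` inversions n w"
  proof (rule equalityI; rule subsetI)
    fix x assume "x \<in> rothe_diagram n w"
    then obtain i j where x: "x = (i, j)" "i \<in> {1..n}" "j \<in> {1..n}" "j < w i" "i < ?u j"
      by (auto simp: rothe_diagram_def grid_def)
    then have "(i, ?u j) \<in> inversions n w" using in_u[of j] by (simp add: inversions_def wu)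
    then show "x \<in> (\<lambda>(a, b). (a, w b)) ` inversions n w"
      by (rule rev_image_eqI) (simp add: x wu)
  next
    fix x assume "x \<in> (\<lambda>(a, b). (a, w b)) ` inversions n w"
    then obtain a b where x: "x = (a, w b)" "a \<in> {1..n}" "b \<in> {1..n}" "a < b" "w b < w a"
      by (auto simp: inversions_def)
    with in_w[of b] show "x \<in> rothe_diagram n w" by (simp add: rothe_diagram_def grid_def wu)
  qed
  moreover have "inj_on (\<lambda>(a, b). (a, w b)) (inversions n w)"
    by (auto simp: inj_on_def dest: injD[OF permutes_inj[OF w]])
  ultimately show ?thesis by (simp add: card_image)
qed

definition adjacent :: "nat \<Rightarrow> nat \<Rightarrow> nat" where
  "adjacent i = Transposition.transpose i (Suc i)"

lemma adjacent_adjacent: "adjacent i (adjacent i x) = x"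
  by (simp add: adjacent_def)

lemma adjacent_permutes: "i \<in> {1..<n} \<Longrightarrow> adjacent i permutes {1..n}"
  unfolding adjacent_def by (rule permutes_swap_id) auto

lemma adjacent_less: "{x, y} \<noteq> {i, Suc i} \<Longrightarrow> adjacent i x < adjacent i y \<longleftrightarrow> x < y"
  by (auto simp: adjacent_def Transposition.transpose_def)

text \<open>Composition on the left exchanges the values \<open>i\<close> and \<open>i + 1\<close>,
  which alters the relative order of this one pair of values only.\<close>

lemma inversions_adjacent:
  assumes w: "w permutes {1..n}" and i: "i \<in> {1..<n}"
    and less: "inv_into UNIV w i < inv_into UNIV w (Suc i)"
  shows "card (inversions n (adjacent i \<circ> w)) = Suc (card (inversions n w))"
proof -
  let ?u = "inv_into UNIV w"
  have in_u: "?u q \<in> {1..n} \<longleftrightarrow> q \<in> {1..n}" for q by (rule permutes_in_image[OF permutes_inv[OF w]])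
  have wu: "w (?u q) = q" "?u (w q) = q" for q using permutes_inverses[OF w] by auto
  have "inversions n (adjacent i \<circ> w) = insert (?u i, ?u (Suc i)) (inversions n w)"
  proof (rule Set.set_eqI)
    fix x :: "nat \<times> nat"
    obtain a b where x: "x = (a, b)" by (cases x)
    show "x \<in> inversions n (adjacent i \<circ> w) \<longleftrightarrow> x \<in> insert (?u i, ?u (Suc i)) (inversions n w)"
    proof (cases "{w b, w a} = {i, Suc i}")
      case True
      then consider "w a = i" "w b = Suc i" | "w a = Suc i" "w b = i" by (auto simp: doubleton_eq_iff)
      then show ?thesis
      proof cases
        case 1
        then have "a = ?u i" "b = ?u (Suc i)" using wu(2) by metis+
        with 1 i less in_u[of i] in_u[of "Suc i"] show ?thesis
          by (simp add: x inversions_def adjacent_def)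
      next
        case 2
        then have "a = ?u (Suc i)" "b = ?u i" using wu(2) by metis+
        with less have "\<not> a < b" "(a, b) \<noteq> (?u i, ?u (Suc i))" by auto
        then show ?thesis by (simp add: x inversions_def)
      qed
    next
      case False
      then have "\<not> (a = ?u i \<and> b = ?u (Suc i))" by (auto simp: wu)
      with adjacent_less[OF False] show ?thesis by (auto simp: x inversions_def)
    qed
  qed
  moreover have "(?u i, ?u (Suc i)) \<notin> inversions n w" by (simp add: inversions_def wu)
  ultimately show ?thesis using finite_inversions by simp
qed

lemma inversions_adjacent_le:
  assumes w: "w permutes {1..n}" and i: "i \<in> {1..<n}"
  shows "card (inversions n (adjacent i \<circ> w)) \<le> Suc (card (inversions n w))"
proof (cases "inv_into UNIV w i < inv_into UNIV w (Suc i)")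
  case True
  with inversions_adjacent[OF assms] show ?thesis by simp
next
  case False
  let ?w = "adjacent i \<circ> w"
  have perm: "?w permutes {1..n}" by (rule permutes_compose[OF w adjacent_permutes[OF i]])
  have inv: "inv_into UNIV ?w q = inv_into UNIV w (adjacent i q)" for q
    by (rule inv_f_eq[OF permutes_inj[OF perm]])
      (simp add: permutes_inverses[OF w] adjacent_adjacent)
  have "inv_into UNIV w i \<noteq> inv_into UNIV w (Suc i)"
    using permutes_inj[OF permutes_inv[OF w]] by (metis injD n_not_Suc_n)
  with False have "inv_into UNIV ?w i < inv_into UNIV ?w (Suc i)"
    unfolding inv by (simp add: adjacent_def)
  from inversions_adjacent[OF perm i this] have "card (inversions n (adjacent i \<circ> ?w)) = Suc (card (inversions n ?w))" .
  moreover have "adjacent i \<circ> ?w = w" by (simp add: fun_eq_iff adjacent_adjacent)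
  ultimately show ?thesis by simp
qed

lemma no_descent_id:
  assumes u: "u permutes {1..n}" and "\<And>i. i \<in> {1..<n} \<Longrightarrow> u i < u (Suc i)"
  shows "u = id"
proof -
  have ge: "j \<le> u j" if "j \<in> {1..n}" for j
    using that
  proof (induction j)
    case (Suc j)
    show ?case
    proof (cases "j = 0")
      case True
      with Suc.prems show ?thesis using permutes_in_image[OF u, of "Suc j"] by auto
    next
      case False
      with Suc.prems have "j \<le> u j" "u j < u (Suc j)" using Suc.IH assms(2)[of j] by auto
      then show ?thesis by simp
    qed
  qed simp
  \<comment> \<open>A permutation dominating the identity pointwise equals it, as both have the same
    sum of values.\<close>
  have "(\<Sum>j\<in>{1..n}. u j) = (\<Sum>j\<in>{1..n}. j)"
    using sum.permute[OF u, of id] by simp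
  then have "u j = j" if "j \<in> {1..n}" for j
    using sum_mono_inv[of "\<lambda>j. j" "{1..n}" u j] ge that by force
  then show ?thesis using u by (auto simp: fun_eq_iff permutes_def)
qed

text \<open>Sorting: as long as \<open>w\<close> has inversions, its inverse has a descent at some
  \<open>i\<close>, and exchanging the values \<open>i\<close> and \<open>i + 1\<close> removes one
  inversion.\<close>

lemma exists_reduced_word:
  assumes "w permutes {1..n}"
  shows "\<exists>is. length is = card (inversions n w) \<and> set is \<subseteq> {1..<n} \<and> w = foldr (\<lambda>i f. adjacent i \<circ> f) is id"
  using assms
proof (induction "card (inversions n w)" arbitrary: w)
  case 0
  have "inv_into UNIV w i < inv_into UNIV w (Suc i)" if i: "i \<in> {1..<n}" for i
  proof (rule ccontr)
    let ?u = "inv_into UNIV w"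
    assume "\<not> ?u i < ?u (Suc i)"
    moreover have "?u i \<noteq> ?u (Suc i)"
      using permutes_inj[OF permutes_inv[OF 0(2)]] by (metis injD n_not_Suc_n)
    ultimately have "(?u (Suc i), ?u i) \<in> inversions n w"
      using i permutes_in_image[OF permutes_inv[OF 0(2)], of i] permutes_in_image[OF permutes_inv[OF 0(2)], of "Suc i"]
      by (simp add: inversions_def permutes_inverses[OF 0(2)])
    then show False using 0(1) finite_inversions by (metis card_eq_0_iff empty_iff)
  qed
  then have "inv_into UNIV w = id" by (rule no_descent_id[OF permutes_inv[OF 0(2)]])
  then have "w = id" using permutes_inv_inv[OF 0(2)] by (metis inv_id)
  with 0(1) show ?case by (intro exI[of _ "[]"]) simp
next
  case (Suc m)
  let ?u = "inv_into UNIV w"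
  have "\<exists>i\<in>{1..<n}. \<not> ?u i < ?u (Suc i)"
  proof (rule ccontr)
    assume "\<not> (\<exists>i\<in>{1..<n}. \<not> ?u i < ?u (Suc i))"
    then have "?u = id" by (intro no_descent_id[OF permutes_inv[OF Suc.prems]]) auto
    then have "w = id" using permutes_inv_inv[OF Suc.prems] by (metis inv_id)
    then have "inversions n w = {}" by (auto simp: inversions_def)
    with Suc.hyps(2) show False by simp
  qed
  then obtain i where i: "i \<in> {1..<n}" "\<not> ?u i < ?u (Suc i)" by blast
  have "?u i \<noteq> ?u (Suc i)"
    using permutes_inj[OF permutes_inv[OF Suc.prems]] by (metis injD n_not_Suc_n)
  with i(2) have gt: "?u (Suc i) < ?u i" by simp
  let ?w = "adjacent i \<circ> w"
  have perm: "?w permutes {1..n}" by (rule permutes_compose[OF Suc.prems adjacent_permutes[OF i(1)]])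
  have inv: "inv_into UNIV ?w q = ?u (adjacent i q)" for q
    by (rule inv_f_eq[OF permutes_inj[OF perm]])
      (simp add: permutes_inverses[OF Suc.prems] adjacent_adjacent)
  have "inv_into UNIV ?w i < inv_into UNIV ?w (Suc i)"
    unfolding inv using gt by (simp add: adjacent_def)
  from inversions_adjacent[OF perm i(1) this]
  have "card (inversions n (adjacent i \<circ> ?w)) = Suc (card (inversions n ?w))" .
  moreover have w: "adjacent i \<circ> ?w = w" by (simp add: fun_eq_iff adjacent_adjacent)
  ultimately have "m = card (inversions n ?w)" using Suc.hyps(2) by simp
  from Suc.hyps(1)[OF this perm] obtain ws where ws: "length ws = card (inversions n ?w)"
    "set ws \<subseteq> {1..<n}" "?w = foldr (\<lambda>i f. adjacent i \<circ> f) ws id" by blast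
  show ?case
  proof (intro exI[of _ "i # ws"] conjI)
    show "length (i # ws) = card (inversions n w)"
      using ws(1) \<open>m = card (inversions n ?w)\<close> Suc.hyps(2) by simp
    show "set (i # ws) \<subseteq> {1..<n}" using ws(2) i(1) by simp
    show "w = foldr (\<lambda>i f. adjacent i \<circ> f) (i # ws) id" using ws(3) w by simp
  qed
qed

lemma word_inversions:
  "set is \<subseteq> {1..<n} \<Longrightarrow> foldr (\<lambda>i f. adjacent i \<circ> f) is id permutes {1..n} \<and>
    card (inversions n (foldr (\<lambda>i f. adjacent i \<circ> f) is id)) \<le> length is"
proof (induction "is")
  case Nil
  have "inversions n id = {}" by (auto simp: inversions_def)
  then show ?case
    using permutes_id[of "{1..n}"]
    by (simp only: foldr.simps id_def list.size card.empty order_refl simp_thms)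
next
  case (Cons i "is")
  let ?w = "foldr (\<lambda>i f. adjacent i \<circ> f) is id"
  from Cons.prems have i: "i \<in> {1..<n}" and "set is \<subseteq> {1..<n}" by auto
  from Cons.IH[OF this(2)] have w: "?w permutes {1..n}" "card (inversions n ?w) \<le> length is" by blast+
  have "adjacent i \<circ> ?w permutes {1..n}" by (rule permutes_compose[OF w(1) adjacent_permutes[OF i]])
  moreover have "card (inversions n (adjacent i \<circ> ?w)) \<le> Suc (length is)"
    using inversions_adjacent_le[OF w(1) i] w(2) by linarith
  ultimately show ?case unfolding foldr.simps comp_apply list.size by simp
qed

theorem coxeter_length_eq:
  assumes "w permutes {1..n}"
  shows "coxeter_length n w = card (rothe_diagram n w)"
proof -
  have "coxeter_length n w = card (inversions n w)"
    unfolding coxeter_length_def adjacent_def[symmetric]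
  proof (rule Least_equality)
    show "\<exists>is. length is = card (inversions n w) \<and> set is \<subseteq> {1..<n} \<and> w = foldr (\<lambda>i f. adjacent i \<circ> f) is id"
      by (rule exists_reduced_word[OF assms])
    show "card (inversions n w) \<le> m"
      if "\<exists>is. length is = m \<and> set is \<subseteq> {1..<n} \<and> w = foldr (\<lambda>i f. adjacent i \<circ> f) is id" for m
    proof -
      from that obtain ws where ws: "length ws = m" "set ws \<subseteq> {1..<n}"
        "w = foldr (\<lambda>i f. adjacent i \<circ> f) ws id" by blast
      from word_inversions[OF ws(2)] show ?thesis unfolding ws(3)[symmetric] ws(1) by blast
    qed
  qed
  then show ?thesis by (simp add: card_inversions[OF assms])
qed

section \<open>Dimension of matrix Schubert varieties\<close>

lemma rank_fun_column_rank:
  assumes w: "w permutes {1..n}" and "p \<le> n" "q \<le> n"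
  shows "rank_fun n w p q = column_rank (inv_into UNIV w) p q"
proof -
  let ?u = "inv_into UNIV w"
  have in_u: "?u q \<in> {1..n} \<longleftrightarrow> q \<in> {1..n}" for q by (rule permutes_in_image[OF permutes_inv[OF w]])
  have wu: "w (?u q) = q" "?u (w q) = q" for q using permutes_inverses[OF w] by auto
  have "{(i, j) \<in> grid n. i \<le> p \<and> j \<le> q \<and> w i = j} = (\<lambda>j. (?u j, j)) ` {j \<in> {1..q}. ?u j \<le> p}"
  proof (rule equalityI; rule subsetI)
    fix x assume "x \<in> {(i, j) \<in> grid n. i \<le> p \<and> j \<le> q \<and> w i = j}"
    then obtain i where x: "x = (i, w i)" "(i, w i) \<in> grid n" "i \<le> p" "w i \<le> q" by blast
    then have "w i \<in> {j \<in> {1..q}. ?u j \<le> p}" by (simp add: wu grid_def)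
    then show "x \<in> (\<lambda>j. (?u j, j)) ` {j \<in> {1..q}. ?u j \<le> p}"
      by (rule rev_image_eqI) (simp add: x wu)
  next
    fix x assume "x \<in> (\<lambda>j. (?u j, j)) ` {j \<in> {1..q}. ?u j \<le> p}"
    then obtain j where x: "x = (?u j, j)" "j \<in> {1..q}" "?u j \<le> p" by blast
    then have "(?u j, j) \<in> grid n" using in_u[of j] assms(3) by (auto simp: grid_def)
    then show "x \<in> {(i, j) \<in> grid n. i \<le> p \<and> j \<le> q \<and> w i = j}" using x by (simp add: wu)
  qed
  moreover have "inj_on (\<lambda>j. (?u j, j)) {j \<in> {1..q}. ?u j \<le> p}" by (auto simp: inj_on_def)
  ultimately show ?thesis by (simp add: rank_fun_def column_rank_def card_image)
qed

lemma pivot_column_rank: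
  assumes w: "w permutes {1..n}" and A: "A \<in> matrix_schubert_variety n w"
    and pq: "p \<in> {1..n}" "q \<in> {1..n}"
  shows "column_rank (pivot n A) p q \<le> column_rank (inv_into UNIV w) p q"
proof -
  have "factors_through (rank_fun n w p q) p q A"
    using A pq unfolding matrix_schubert_variety_iff by blast
  then have "card {j \<in> {1..q}. pivot n A j \<le> p} \<le> rank_fun n w p q"
    by (rule card_pivots_le) (use pq in auto)
  then show ?thesis
    using rank_fun_column_rank[OF w, of p q] pq by (simp add: column_rank_def)
qed

lemma cell_entry_cong:
  assumes "\<And>j. j \<in> {1..n} \<Longrightarrow> \<pi> j = \<rho> j" "q \<in> {1..n}"
  shows "cell_entry \<pi> p q t = cell_entry \<rho> p q t"
  using assms(2)
proof (induction q rule: less_induct)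
  case (less q)
  have "{j \<in> {1..<q}. \<pi> j < \<pi> q} = {j \<in> {1..<q}. \<rho> j < \<rho> q}"
    using less.prems assms(1) by auto
  moreover have "cell_entry \<pi> p j t = cell_entry \<rho> p j t" if "j \<in> {j \<in> {1..<q}. \<rho> j < \<rho> q}" for j
    using that less.prems by (intro less.IH) auto
  ultimately have "(\<Sum>j\<in>{j \<in> {1..<q}. \<pi> j < \<pi> q}. t (Inl (j, q)) * cell_entry \<pi> p j t) =
      (\<Sum>j\<in>{j \<in> {1..<q}. \<rho> j < \<rho> q}. t (Inl (j, q)) * cell_entry \<rho> p j t)"
    by (intro sum.cong) auto
  then show ?case
    unfolding cell_entry.simps[of _ _ q] using assms(1)[OF less.prems] by simp
qed

lemma cell_entry_polyfun_grid:
  "x \<in> grid n \<Longrightarrow> (\<lambda>t. cell_entry \<pi> (fst x) (snd x) t) \<in> polyfun (cell_params n \<pi>)"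
  using cell_entry_polyfun[of "fst x" n "snd x" \<pi>] by (auto simp: grid_def)

lemma nonzero_prod:
  assumes "finite I" "\<And>i. i \<in> I \<Longrightarrow> g i \<in> polyfun K \<and> (\<exists>a. g i a \<noteq> 0)"
  shows "\<exists>a. (\<Prod>i\<in>I. g i a) \<noteq> 0"
proof -
  have "\<forall>\<^sub>F a in zariski_generic K. \<forall>i\<in>I. g i a \<noteq> 0"
  proof (intro eventually_ball_finite ballI assms(1))
    fix i assume "i \<in> I"
    with assms(2) obtain a where "g i \<in> polyfun K" "g i a \<noteq> 0" by blast
    then show "\<forall>\<^sub>F a in zariski_generic K. g i a \<noteq> 0" by (rule generic_nonzero)
  qed
  from generic_happens[OF this] obtain a where "\<forall>i\<in>I. g i a \<noteq> 0" ..
  then have "(\<Prod>i\<in>I. g i a) \<noteq> 0" using assms(1) by simp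
  then show ?thesis by (rule exI[where x = a])
qed

text \<open>A point of the variety lies in the cell of its pivots, and only finitely many pivot
  functions obey the rank conditions; the product of the relations on their cells holds throughout.
  The condition \<open>S\<close> allows hypersurface sections to be treated in the same way.\<close>

lemma schubert_relation_from_cells:
  assumes w: "w permutes {1..n}" and K: "K \<subseteq> grid n"
    and cells: "\<And>\<pi>. \<pi> ` {1..n} \<subseteq> {1..n + 1} \<Longrightarrow>
      (\<And>p q. p \<in> {1..n} \<Longrightarrow> q \<in> {1..n} \<Longrightarrow> column_rank \<pi> p q \<le> column_rank (inv_into UNIV w) p q) \<Longrightarrow>
      \<exists>g\<in>polyfun K. (\<exists>a. g a \<noteq> 0) \<and> (\<forall>t. S (\<lambda>x. cell_entry \<pi> (fst x) (snd x) t) \<longrightarrow>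
         g (\<lambda>x. cell_entry \<pi> (fst x) (snd x) t) = 0)"
    and S: "\<And>A B. (\<And>x. x \<in> grid n \<Longrightarrow> A x = B x) \<Longrightarrow> S A \<Longrightarrow> S B"
  shows "\<exists>g\<in>polyfun K. (\<exists>a. g a \<noteq> 0) \<and> (\<forall>A\<in>matrix_schubert_variety n w. S A \<longrightarrow> g A = 0)"
proof -
  define \<C> where "\<C> = {\<pi> \<in> {1..n} \<rightarrow>\<^sub>E {1..n + 1}. \<forall>p\<in>{1..n}. \<forall>q\<in>{1..n}.
    column_rank \<pi> p q \<le> column_rank (inv_into UNIV w) p q}"
  have fin: "finite \<C>" unfolding \<C>_def by (simp add: finite_PiE)
  have "\<forall>\<pi>\<in>\<C>. \<exists>g. g \<in> polyfun K \<and> (\<exists>a. g a \<noteq> 0) \<and> (\<forall>t. S (\<lambda>x. cell_entry \<pi> (fst x) (snd x) t) \<longrightarrow>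
         g (\<lambda>x. cell_entry \<pi> (fst x) (snd x) t) = 0)"
  proof
    fix \<pi> assume "\<pi> \<in> \<C>"
    then have "\<pi> ` {1..n} \<subseteq> {1..n + 1}"
      "\<And>p q. p \<in> {1..n} \<Longrightarrow> q \<in> {1..n} \<Longrightarrow> column_rank \<pi> p q \<le> column_rank (inv_into UNIV w) p q"
      by (auto simp: \<C>_def)
    from cells[OF this] show "\<exists>g. g \<in> polyfun K \<and> (\<exists>a. g a \<noteq> 0) \<and> (\<forall>t. S (\<lambda>x. cell_entry \<pi> (fst x) (snd x) t) \<longrightarrow>
         g (\<lambda>x. cell_entry \<pi> (fst x) (snd x) t) = 0)" by blast
  qed
  from bchoice[OF this] obtain g where g: "\<forall>\<pi>\<in>\<C>. g \<pi> \<in> polyfun K \<and> (\<exists>a. g \<pi> a \<noteq> 0) \<and>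
    (\<forall>t. S (\<lambda>x. cell_entry \<pi> (fst x) (snd x) t) \<longrightarrow> g \<pi> (\<lambda>x. cell_entry \<pi> (fst x) (snd x) t) = 0)" ..
  define G where "G a = (\<Prod>\<pi>\<in>\<C>. g \<pi> a)" for a
  have "G \<in> polyfun K" unfolding G_def by (intro polyfun.prod_mem) (use g in blast)
  moreover have "\<exists>a. G a \<noteq> 0"
    unfolding G_def by (rule nonzero_prod[OF fin]) (use g in blast)
  moreover have "G A = 0" if A: "A \<in> matrix_schubert_variety n w" "S A" for A
  proof -
    define \<pi> where "\<pi> = restrict (pivot n A) {1..n}"
    have "\<pi> \<in> {1..n} \<rightarrow>\<^sub>E {1..n + 1}"
      using pivot_le[of n A] pivot_pos[of n A] by (auto simp: \<pi>_def)
    moreover have "column_rank \<pi> p q \<le> column_rank (inv_into UNIV w) p q" if "p \<in> {1..n}" "q \<in> {1..n}" for p q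
    proof -
      have "{j \<in> {1..q}. \<pi> j \<le> p} = {j \<in> {1..q}. pivot n A j \<le> p}" using that by (auto simp: \<pi>_def)
      then show ?thesis using pivot_column_rank[OF w A(1) that] by (simp add: column_rank_def)
    qed
    ultimately have \<pi>: "\<pi> \<in> \<C>" by (simp add: \<C>_def)
    obtain t where t: "\<forall>p\<in>{1..n}. \<forall>q\<in>{1..n}. A (p, q) = cell_entry (pivot n A) p q t"
      using cell_cover by blast
    define B where "B x = cell_entry \<pi> (fst x) (snd x) t" for x
    have AB: "A x = B x" if x: "x \<in> grid n" for x
    proof -
      have pq: "fst x \<in> {1..n}" "snd x \<in> {1..n}" using x by (auto simp: grid_def)
      have "cell_entry \<pi> (fst x) (snd x) t = cell_entry (pivot n A) (fst x) (snd x) t"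
        by (rule cell_entry_cong[OF _ pq(2)]) (simp add: \<pi>_def)
      then show ?thesis using bspec[OF bspec[OF t pq(1)] pq(2)] by (simp add: B_def)
    qed
    have "S B" by (rule S[OF AB A(2)])
    then have "g \<pi> B = 0" using g \<pi> unfolding B_def by blast
    moreover have "g \<pi> A = g \<pi> B"
      using g \<pi> AB K by (intro polyfun_local[of "g \<pi>" K]) auto
    ultimately show ?thesis unfolding G_def using fin \<pi> by (auto intro: prod_zero)
  qed
  ultimately show ?thesis by blast
qed

lemma inv_image_props:
  assumes w: "w permutes {1..n}"
  shows "inj_on (inv_into UNIV w) {1..n}" "inv_into UNIV w ` {1..n} \<subseteq> {1..n}"
  using permutes_inj_on[OF permutes_inv[OF w]] permutes_image[OF permutes_inv[OF w]] by auto

lemma finite_grid: "finite (grid n)"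
  by (simp add: grid_def)

text \<open>The dimension bound for the variety: every cell has at most
  \<open>n * n - card (rothe_diagram n w)\<close> parameters, fewer than there are coordinates in
  \<open>K\<close>.\<close>

theorem schubert_coordinates_dependent:
  assumes w: "w permutes {1..n}" and K: "K \<subseteq> grid n" "n * n < card K + card (rothe_diagram n w)"
  shows "\<exists>g\<in>polyfun K. (\<exists>a. g a \<noteq> 0) \<and> (\<forall>A\<in>matrix_schubert_variety n w. g A = 0)"
proof -
  have "\<exists>g\<in>polyfun K. (\<exists>a. g a \<noteq> 0) \<and> (\<forall>A\<in>matrix_schubert_variety n w. True \<longrightarrow> g A = 0)"
  proof (rule schubert_relation_from_cells[OF w K(1)])
    fix \<pi> :: "nat \<Rightarrow> nat"
    assume \<pi>: "\<pi> ` {1..n} \<subseteq> {1..n + 1}"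
      "\<And>p q. p \<in> {1..n} \<Longrightarrow> q \<in> {1..n} \<Longrightarrow> column_rank \<pi> p q \<le> column_rank (inv_into UNIV w) p q"
    have "cell_dim n \<pi> \<le> cell_dim n (inv_into UNIV w)"
    proof (cases "\<exists>j\<in>{1..n}. \<pi> j \<noteq> inv_into UNIV w j")
      case True
      with bruhat_cell_dim[OF inv_image_props[OF w] \<pi>] show ?thesis by simp
    next
      case False
      then show ?thesis by (simp add: cell_dim_def)
    qed
    then have "card (cell_params n \<pi>) < card K"
      using card_cell_params(2)[OF \<pi>(1)] card_rothe_diagram[OF w] K(2) by simp
    then have "\<exists>g\<in>polyfun K. (\<exists>a. g a \<noteq> 0) \<and> (\<forall>t. g (\<lambda>x. cell_entry \<pi> (fst x) (snd x) t) = 0)"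
      by (rule algebraically_dependent[OF card_cell_params(1)[OF \<pi>(1)] finite_subset[OF K(1) finite_grid]])
        (use K(1) in \<open>auto intro: cell_entry_polyfun_grid\<close>)
    then show "\<exists>g\<in>polyfun K. (\<exists>a. g a \<noteq> 0) \<and> (\<forall>t. True \<longrightarrow> g (\<lambda>x. cell_entry \<pi> (fst x) (snd x) t) = 0)"
      by simp
  qed auto
  then show ?thesis by simp
qed

text \<open>All cells but one have too few parameters for \<open>card K\<close> independent
  coordinates. The remaining cell contains the permutation matrix, so \<open>h\<close> is not
  identically zero on it, and cutting with \<open>h = 0\<close> lowers its dimension.\<close>

theorem schubert_hypersurface_dependent:
  assumes w: "w permutes {1..n}" and K: "K \<subseteq> grid n" "n * n \<le> card K + card (rothe_diagram n w)"
    and h: "h \<in> polyfun (grid n)" "h (\<lambda>(i, j). of_bool (w i = j)) \<noteq> 0"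
  shows "\<exists>g\<in>polyfun K. (\<exists>a. g a \<noteq> 0) \<and> (\<forall>A\<in>matrix_schubert_variety n w. h A = 0 \<longrightarrow> g A = 0)"
proof (rule schubert_relation_from_cells[OF w K(1)])
  let ?u = "inv_into UNIV w"
  fix \<pi> :: "nat \<Rightarrow> nat"
  assume \<pi>: "\<pi> ` {1..n} \<subseteq> {1..n + 1}"
    "\<And>p q. p \<in> {1..n} \<Longrightarrow> q \<in> {1..n} \<Longrightarrow> column_rank \<pi> p q \<le> column_rank ?u p q"
  have finK: "finite K" by (rule finite_subset[OF K(1) finite_grid])
  let ?h = "\<lambda>t. h (\<lambda>x. cell_entry \<pi> (fst x) (snd x) t)"
  have hp: "?h \<in> polyfun (cell_params n \<pi>)"
    by (rule polyfun_subst[OF polyfun.function_ring_axioms h(1)]) (rule cell_entry_polyfun_grid)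
  have Kp: "(\<lambda>t. cell_entry \<pi> (fst x) (snd x) t) \<in> polyfun (cell_params n \<pi>)" if "x \<in> K" for x
    using that K(1) by (intro cell_entry_polyfun_grid) auto
  show "\<exists>g\<in>polyfun K. (\<exists>a. g a \<noteq> 0) \<and> (\<forall>t. ?h t = 0 \<longrightarrow> g (\<lambda>x. cell_entry \<pi> (fst x) (snd x) t) = 0)"
  proof (cases "\<exists>j\<in>{1..n}. \<pi> j \<noteq> ?u j")
    case True
    have "card (cell_params n \<pi>) < card K"
      using bruhat_cell_dim[OF inv_image_props[OF w] \<pi> True]
        card_cell_params(2)[OF \<pi>(1)] card_rothe_diagram[OF w] K(2) by simp
    then have "\<exists>g\<in>polyfun K. (\<exists>a. g a \<noteq> 0) \<and> (\<forall>t. g (\<lambda>x. cell_entry \<pi> (fst x) (snd x) t) = 0)"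
      by (rule algebraically_dependent[OF card_cell_params(1)[OF \<pi>(1)] finK]) (rule Kp)
    then obtain g where g: "g \<in> polyfun K" "\<exists>a. g a \<noteq> 0" "\<forall>t. g (\<lambda>x. cell_entry \<pi> (fst x) (snd x) t) = 0"
      by (elim bexE conjE)
    then show ?thesis by (intro bexI[of _ g]) simp_all
  next
    case False
    then have "cell_dim n \<pi> = cell_dim n ?u" by (simp add: cell_dim_def)
    then have "card (cell_params n \<pi>) \<le> card K"
      using card_cell_params(2)[OF \<pi>(1)] card_rothe_diagram[OF w] K(2) by simp
    \<comment> \<open>Zero coefficients, and free entries equal to one exactly at the dots, give the
      permutation matrix.\<close>
    moreover define t0 :: "nat \<times> nat + nat \<times> nat \<Rightarrow> complex"
      where "t0 y = (case y of Inl _ \<Rightarrow> 0 | Inr (p, q) \<Rightarrow> of_bool (w p = q))" for y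
    have "?h t0 = h (\<lambda>(i, j). of_bool (w i = j))"
    proof (rule polyfun_local[OF h(1)])
      fix x assume "x \<in> grid n"
      then obtain p q where x: "x = (p, q)" "p \<in> {1..n}" "q \<in> {1..n}" by (auto simp: grid_def)
      have wu: "w p = q \<longleftrightarrow> p = ?u q" using permutes_inv_eq[OF w, of q p] by auto
      have "\<pi> q = ?u q" using False x by blast
      then have "cell_entry \<pi> p q t0 = of_bool (w p = q)"
        using wu by (simp add: cell_entry.simps[of _ _ q] t0_def)
      then show "cell_entry \<pi> (fst x) (snd x) t0 = (case x of (i, j) \<Rightarrow> of_bool (w i = j))"
        by (simp add: x)
    qed
    then have "?h t0 \<noteq> 0" using h(2) by simp
    ultimately show ?thesis
      by (intro algebraically_dependent_on_hypersurface[OF card_cell_params(1)[OF \<pi>(1)] finK _ Kp hp])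
  qed
next
  fix A B :: "nat \<times> nat \<Rightarrow> complex"
  assume "\<And>x. x \<in> grid n \<Longrightarrow> A x = B x" "h A = 0"
  then show "h B = 0" using polyfun_local[OF h(1), of A B] by simp
qed

section \<open>General fibers of coordinate projections\<close>

lemma poly_value_polyfun:
  assumes "vars_of p \<subseteq> J"
  shows "(\<lambda>a. poly_value a p) \<in> polyfun J"
  unfolding poly_value_def eval_with_def
  by (intro polyfun.sum_mem polyfun_mult polyfun_const polyfun.prod_mem polyfun.power_mem polyfun_coord)
    (use assms in \<open>auto simp: vars_of_def\<close>)

text \<open>Zariski topology is defined by formal polynomials; this makes nonvanishing sets of
  polynomial functions open in that sense.\<close>

lemma polyfun_poly_value:
  assumes J: "finite J" and "g \<in> polyfun J"
  shows "\<exists>p. vars_of p \<subseteq> J \<and> (\<forall>a. poly_value a p = g a)"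
proof -
  obtain B where "g \<in> bounded_polyfun J B" using polyfun_bounded[OF assms] by blast
  then obtain c where c: "g = (\<lambda>a. \<Sum>\<alpha>\<in>exponents J B. c \<alpha> * monomial_fun J \<alpha> a)"
    unfolding bounded_polyfun_def by blast
  let ?E = "exponents J B"
  have E: "finite ?E" by (rule finite_exponents[OF J])
  define m :: "('a \<Rightarrow> nat) \<Rightarrow> 'a \<Rightarrow>\<^sub>0 nat" where "m \<alpha> = (\<Sum>x\<in>J. Poly_Mapping.single x (\<alpha> x))" for \<alpha>
  have m: "Poly_Mapping.lookup (m \<alpha>) x = (if x \<in> J then \<alpha> x else 0)" for \<alpha> x
    unfolding m_def using J by (simp add: lookup_sum lookup_single when_def)
  have keys: "Poly_Mapping.keys (m \<alpha>) \<subseteq> J" for \<alpha>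
    by (auto simp: in_keys_iff m split: if_splits)
  have inj: "inj_on m ?E"
  proof (rule inj_onI)
    fix \<alpha> \<beta> assume "\<alpha> \<in> ?E" "\<beta> \<in> ?E" and eq: "m \<alpha> = m \<beta>"
    then have ab: "\<alpha> \<in> J \<rightarrow>\<^sub>E {..B}" "\<beta> \<in> J \<rightarrow>\<^sub>E {..B}" by (auto simp: exponents_def)
    show "\<alpha> = \<beta>"
    proof (rule PiE_ext[OF ab])
      fix x assume "x \<in> J"
      then show "\<alpha> x = \<beta> x" using m[of \<alpha> x] m[of \<beta> x] eq by simp
    qed
  qed
  define p where "p = (\<Sum>\<alpha>\<in>?E. Poly_Mapping.single (m \<alpha>) (c \<alpha>))"
  have lookup_p: "Poly_Mapping.lookup p (m \<alpha>) = c \<alpha>" if "\<alpha> \<in> ?E" for \<alpha>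
  proof -
    have "Poly_Mapping.lookup p (m \<alpha>) = (\<Sum>\<beta>\<in>?E. if \<beta> = \<alpha> then c \<beta> else 0)"
      unfolding p_def lookup_sum lookup_single when_def
      by (rule sum.cong) (use inj that in \<open>auto dest: inj_onD\<close>)
    then show ?thesis using that E by simp
  qed
  have keys_p: "Poly_Mapping.keys p \<subseteq> m ` ?E"
    unfolding p_def by (rule order_trans[OF keys_sum]) auto
  have "poly_value a p = g a" for a
  proof -
    have "poly_value a p = (\<Sum>k\<in>m ` ?E. Poly_Mapping.lookup p k * (\<Prod>x\<in>Poly_Mapping.keys k. a x ^ Poly_Mapping.lookup k x))"
      unfolding poly_value_def eval_with_def
      by (rule sum.mono_neutral_left) (use keys_p E in \<open>auto simp: in_keys_iff\<close>)
    also have "\<dots> = (\<Sum>\<alpha>\<in>?E. Poly_Mapping.lookup p (m \<alpha>) *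
        (\<Prod>x\<in>Poly_Mapping.keys (m \<alpha>). a x ^ Poly_Mapping.lookup (m \<alpha>) x))"
      by (rule sum.reindex[OF inj, unfolded comp_def])
    also have "\<dots> = (\<Sum>\<alpha>\<in>?E. c \<alpha> * monomial_fun J \<alpha> a)"
    proof (rule sum.cong[OF refl])
      fix \<alpha> assume \<alpha>: "\<alpha> \<in> ?E"
      have "(\<Prod>x\<in>Poly_Mapping.keys (m \<alpha>). a x ^ Poly_Mapping.lookup (m \<alpha>) x) =
          (\<Prod>x\<in>J. a x ^ Poly_Mapping.lookup (m \<alpha>) x)"
        by (rule prod.mono_neutral_left) (use J keys in \<open>auto simp: in_keys_iff\<close>)
      also have "\<dots> = monomial_fun J \<alpha> a" unfolding monomial_fun_def by (rule prod.cong) (auto simp: m)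
      finally show "Poly_Mapping.lookup p (m \<alpha>) *
        (\<Prod>x\<in>Poly_Mapping.keys (m \<alpha>). a x ^ Poly_Mapping.lookup (m \<alpha>) x) = c \<alpha> * monomial_fun J \<alpha> a"
        using lookup_p[OF \<alpha>] by simp
    qed
    finally show ?thesis by (simp add: c)
  qed
  moreover have "vars_of p \<subseteq> J"
    unfolding vars_of_def using keys_p keys by blast
  ultimately show ?thesis by blast
qed

lemma restrict_affine_space: "restrict a J \<in> affine_space J"
  by (simp add: affine_space_def)

lemma zariski_closed_generic:
  assumes "zariski_closed J Z" "Z \<noteq> affine_space J"
  shows "\<forall>\<^sub>F a in zariski_generic J. restrict a J \<notin> Z"
proof -
  obtain P :: "('a, complex) mpolynomial set" where P: "\<And>p. p \<in> P \<Longrightarrow> vars_of p \<subseteq> J"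
    "Z = {a \<in> affine_space J. \<forall>p\<in>P. poly_value a p = 0}"
    using assms(1) unfolding zariski_closed_def by blast
  with assms(2) obtain a p where ap: "p \<in> P" "poly_value a p \<noteq> 0" by blast
  note pf = poly_value_polyfun[OF P(1)[OF ap(1)]]
  have "\<forall>\<^sub>F a in zariski_generic J. poly_value a p \<noteq> 0" by (rule generic_nonzero[OF pf ap(2)])
  then show ?thesis
  proof eventually_elim
    case (elim b)
    have "poly_value (restrict b J) p = poly_value b p"
      by (rule polyfun_local[OF pf]) simp
    with elim show ?case using P(2) ap(1) by auto
  qed
qed

lemma zariski_open_generic:
  assumes "zariski_open J U" "U \<noteq> {}"
  shows "\<forall>\<^sub>F a in zariski_generic J. restrict a J \<in> U"
proof -
  have "zariski_closed J (affine_space J - U)" "affine_space J - U \<noteq> affine_space J"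
    using assms unfolding zariski_open_def by auto
  from zariski_closed_generic[OF this] show ?thesis
    by eventually_elim (simp add: restrict_affine_space)
qed

lemma zariski_open_nonzero:
  assumes J: "finite J" and g: "g \<in> polyfun J"
  shows "zariski_open J {a \<in> affine_space J. g a \<noteq> 0}"
proof -
  obtain p where p: "vars_of p \<subseteq> J" "\<And>a. poly_value a p = g a"
    using polyfun_poly_value[OF assms] by blast
  have "zariski_closed J {a \<in> affine_space J. g a = 0}"
    unfolding zariski_closed_def by (rule exI[of _ "{p}"]) (use p in auto)
  moreover have "affine_space J - {a \<in> affine_space J. g a \<noteq> 0} = {a \<in> affine_space J. g a = 0}" by auto
  ultimately show ?thesis unfolding zariski_open_def by auto
qed

text \<open>Unlike \<open>projection_fiber\<close>, this accepts total functions as base points and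
  reads only their coordinates in \<open>J\<close>, as suits \<open>zariski_generic\<close>.\<close>

definition fiber :: "('x \<Rightarrow> complex) set \<Rightarrow> 'x set \<Rightarrow> ('x \<Rightarrow> complex) \<Rightarrow> ('x \<Rightarrow> complex) set" where
  "fiber X J a = {x \<in> X. \<forall>j\<in>J. x j = a j}"

lemma projection_fiber_eq: "projection_fiber X J (restrict a J) = fiber X J a"
  unfolding projection_fiber_def fiber_def by (auto simp: restrict_def fun_eq_iff)

lemma fiber_local: "(\<And>j. j \<in> J \<Longrightarrow> a j = b j) \<Longrightarrow> fiber X J a = fiber X J b"
  by (auto simp: fiber_def)

lemma general_fiber_card_iff:
  assumes "finite J"
  shows "general_fiber_card X J d \<longleftrightarrow>
    (\<forall>\<^sub>F a in zariski_generic J. finite (fiber X J a) \<and> card (fiber X J a) = d)"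
proof
  assume "general_fiber_card X J d"
  then obtain U where U: "zariski_open J U" "U \<noteq> {}"
    "\<And>a. a \<in> U \<Longrightarrow> finite (projection_fiber X J a) \<and> card (projection_fiber X J a) = d"
    unfolding general_fiber_card_def by blast
  show "\<forall>\<^sub>F a in zariski_generic J. finite (fiber X J a) \<and> card (fiber X J a) = d"
    using zariski_open_generic[OF U(1,2)] by eventually_elim (use U(3) projection_fiber_eq in metis)
next
  assume "\<forall>\<^sub>F a in zariski_generic J. finite (fiber X J a) \<and> card (fiber X J a) = d"
  then obtain g a0 where g: "g \<in> polyfun J" "g a0 \<noteq> 0"
    "\<And>a. g a \<noteq> 0 \<Longrightarrow> finite (fiber X J a) \<and> card (fiber X J a) = d"
    unfolding eventually_generic by blast
  have "finite (projection_fiber X J a) \<and> card (projection_fiber X J a) = d"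
    if "a \<in> {a \<in> affine_space J. g a \<noteq> 0}" for a
  proof -
    have "restrict a J = a" using that by (auto simp: affine_space_def)
    then show ?thesis using g(3)[of a] that projection_fiber_eq[of X J a] by simp
  qed
  moreover have "g (restrict a0 J) \<noteq> 0"
    using g(2) polyfun_local[OF g(1), of "restrict a0 J" a0] by simp
  then have "{a \<in> affine_space J. g a \<noteq> 0} \<noteq> {}" using restrict_affine_space by blast
  ultimately show "general_fiber_card X J d"
    unfolding general_fiber_card_def using zariski_open_nonzero[OF assms g(1)] by blast
qed

lemma general_fiber_card_unique:
  assumes "finite J" "general_fiber_card X J d" "general_fiber_card X J e"
  shows "d = e"
proof -
  have "\<forall>\<^sub>F a in zariski_generic J. d = e"
    using assms(2,3)[unfolded general_fiber_card_iff[OF assms(1)]] by eventually_elim auto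
  from generic_happens[OF this] show ?thesis by blast
qed

lemma projection_degree_generic:
  assumes "finite J" "projection_degree X J \<noteq> 0"
  shows "\<forall>\<^sub>F a in zariski_generic J. finite (fiber X J a) \<and> card (fiber X J a) = projection_degree X J"
proof -
  from assms(2) obtain d where d: "general_fiber_card X J d"
    unfolding projection_degree_def by (auto split: if_splits)
  then have "(THE d. general_fiber_card X J d) = d"
    using general_fiber_card_unique[OF assms(1)] by blast
  then have "projection_degree X J = d"
    using assms(2) unfolding projection_degree_def by (auto split: if_splits)
  with d show ?thesis by (simp add: general_fiber_card_iff[OF assms(1)])
qed

text \<open>Fibers that are generically nonempty force dominance: a proper closed set containing the
  image would miss a generic base point.\<close>

lemma generic_projection_degree:
  assumes "finite J" "e > 0"
    and gen: "\<forall>\<^sub>F a in zariski_generic J. finite (fiber X J a) \<and> card (fiber X J a) = e"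
  shows "projection_degree X J = e"
proof -
  have d: "general_fiber_card X J e" using gen by (simp add: general_fiber_card_iff[OF assms(1)])
  then have "(THE d. general_fiber_card X J d) = e"
    using general_fiber_card_unique[OF assms(1)] by blast
  moreover have "dominant_projection X J"
    unfolding dominant_projection_def
  proof (intro allI impI)
    fix Z assume Z: "zariski_closed J Z \<and> (\<lambda>x. restrict x J) ` X \<subseteq> Z"
    show "Z = affine_space J"
    proof (rule ccontr)
      assume "Z \<noteq> affine_space J"
      with Z have "\<forall>\<^sub>F a in zariski_generic J. restrict a J \<notin> Z" by (intro zariski_closed_generic) auto
      with gen have "\<forall>\<^sub>F a in zariski_generic J. restrict a J \<notin> Z \<and> card (fiber X J a) = e"
        by eventually_elim auto
      from generic_happens[OF this] obtain a where a: "restrict a J \<notin> Z" "card (fiber X J a) = e" by blast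
      with assms(2) have "fiber X J a \<noteq> {}" by auto
      then obtain x where x: "x \<in> X" "\<forall>j\<in>J. x j = a j" by (auto simp: fiber_def)
      then have "restrict x J = restrict a J" by (auto simp: restrict_def)
      with x(1) Z a(1) show False by force
    qed
  qed
  ultimately show ?thesis using d unfolding projection_degree_def by auto
qed

section \<open>Linear forms on fibers\<close>

definition linear_form :: "'x set \<Rightarrow> ('x \<Rightarrow> complex) \<Rightarrow> ('x \<Rightarrow> complex) \<Rightarrow> complex" where
  "linear_form I c x = (\<Sum>i\<in>I. c i * x i)"

lemma linear_form_polyfun: "linear_form I c \<in> polyfun I"
  unfolding linear_form_def[abs_def]
  by (intro polyfun.sum_mem polyfun_mult polyfun_const polyfun_coord)

text \<open>The fresh coordinate \<open>y\<close> carries the value of the linear form; the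
  coordinates in \<open>I - J\<close> are then projected away by Chevalley's theorem.\<close>

lemma constructible_linear_sections:
  assumes I: "finite I" "J \<subseteq> I" "y \<notin> I" and X: "X = {a \<in> affine_space I. Q a}" "constructible I Q"
  shows "constructible (insert y J) (\<lambda>a. a y \<in> linear_form I c ` fiber X J a)"
proof -
  define S where "S b \<longleftrightarrow> Q b \<and> linear_form I c b = b y" for b
  have "constructible (insert y I) S"
    unfolding S_def
  proof (intro constructible_conj constructible_eq)
    show "constructible (insert y I) Q" by (rule constructible_mono[OF X(2)]) auto
    show "linear_form I c \<in> cfun (insert y I)"
      by (rule subsetD[OF polyfun_subset_cfun polyfun_mono[OF linear_form_polyfun]]) auto
  qed (auto intro: cfun_coord)
  moreover have "insert y J \<union> (I - J) = insert y I" using I(2) by auto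
  ultimately have "constructible (insert y J) (\<lambda>a. \<exists>f. S (override_on a f (I - J)))"
    using I(1) by (intro constructible_projection) auto
  moreover have "(\<exists>f. S (override_on a f (I - J))) \<longleftrightarrow> a y \<in> linear_form I c ` fiber X J a" for a
  proof
    assume "\<exists>f. S (override_on a f (I - J))"
    then obtain f where f: "S (override_on a f (I - J))" ..
    define b where "b = override_on a f (I - J)"
    have "Q (restrict b I)" using f constructible_local[OF X(2), of "restrict b I" b] by (simp add: S_def b_def)
    then have "restrict b I \<in> X" by (simp add: X(1) restrict_affine_space)
    moreover have "\<forall>j\<in>J. restrict b I j = a j" using I(2) by (auto simp: b_def)
    moreover have "linear_form I c (restrict b I) = a y"
      using f I(3) polyfun_local[OF linear_form_polyfun, of I "restrict b I" b c] by (simp add: S_def b_def)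
    ultimately show "a y \<in> linear_form I c ` fiber X J a" by (force simp: fiber_def)
  next
    assume "a y \<in> linear_form I c ` fiber X J a"
    then obtain x where x: "x \<in> X" "\<forall>j\<in>J. x j = a j" "linear_form I c x = a y" by (auto simp: fiber_def)
    define b where "b = override_on a x (I - J)"
    have bx: "b i = x i" if "i \<in> I" for i using x(2) that by (auto simp: b_def override_on_def)
    have "Q b" using x(1) constructible_local[OF X(2), of b x] bx by (simp add: X(1))
    moreover have "linear_form I c b = b y"
      using x(3) I(3) polyfun_local[OF linear_form_polyfun, of I b x c] bx by (simp add: b_def)
    ultimately show "\<exists>f. S (override_on a f (I - J))" unfolding S_def b_def by blast
  qed
  ultimately show ?thesis by simp
qed

lemma fiber_upd: "y \<notin> J \<Longrightarrow> fiber X J (a(y := t)) = fiber X J a"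
  by (rule fiber_local) auto

text \<open>Each point of \<open>X\<close> lies in the fiber over itself, so the relation for the
  values on fibers holds on all of \<open>X\<close>. Its degree is the number of values on a generic
  fiber.\<close>

lemma linear_form_relation:
  assumes I: "finite I" "J \<subseteq> I" "y \<notin> I" and X: "X = {a \<in> affine_space I. Q a}" "constructible I Q"
    and fin: "\<forall>\<^sub>F a in zariski_generic J. finite (fiber X J a)"
  obtains e u where "\<And>k. u k \<in> polyfun J" "\<exists>a. u e a \<noteq> 0"
    "\<forall>\<^sub>F a in zariski_generic J. card (linear_form I c ` fiber X J a) = e"
    "\<And>x. x \<in> X \<Longrightarrow> (\<Sum>k\<le>e. u k x * linear_form I c x ^ k) = 0"
proof -
  let ?Q = "\<lambda>a. a y \<in> linear_form I c ` fiber X J a"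
  have yJ: "y \<notin> J" using I by auto
  have sec: "{t. ?Q (a(y := t))} = linear_form I c ` fiber X J a" for a
    by (simp add: fiber_upd[OF yJ])
  have "\<forall>\<^sub>F a in zariski_generic J. finite {t. ?Q (a(y := t))}"
    using fin unfolding sec by eventually_elim simp
  then obtain e u where u: "\<And>k. u k \<in> polyfun J" "\<exists>a. u e a \<noteq> 0"
    "\<forall>\<^sub>F a in zariski_generic J. card {t. ?Q (a(y := t))} = e"
    "\<And>a t. ?Q (a(y := t)) \<Longrightarrow> (\<Sum>k\<le>e. u k a * t ^ k) = 0"
    by (rule generic_section_relation[OF constructible_linear_sections[OF I X]]) (rule that; assumption)
  show ?thesis
  proof (rule that[of u e])
    show "\<forall>\<^sub>F a in zariski_generic J. card (linear_form I c ` fiber X J a) = e"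
      using u(3) unfolding sec .
    fix x assume "x \<in> X"
    then have "x \<in> fiber X J x" by (simp add: fiber_def)
    then have "?Q (x(y := linear_form I c x))" by (simp add: fiber_upd[OF yJ])
    then show "(\<Sum>k\<le>e. u k x * linear_form I c x ^ k) = 0" by (rule u(4))
  qed (use u in auto)
qed

text \<open>The coefficient vectors \<open>t ^ idx i\<close> lie on a moment curve, so two distinct
  points have equal values for at most \<open>N\<close> parameters \<open>t\<close>. What matters is
  that one finite set \<open>C\<close> serves all fibers at once.\<close>

lemma separating_linear_forms:
  assumes I: "finite (I :: 'x set)"
  obtains C :: "('x \<Rightarrow> complex) set" where "finite C"
    "\<And>F. F \<subseteq> affine_space I \<Longrightarrow> finite F \<Longrightarrow> card F \<le> M \<Longrightarrow> \<exists>c\<in>C. inj_on (linear_form I c) F"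
proof -
  obtain idx :: "'x \<Rightarrow> nat" and N where idx: "inj_on idx I" "idx ` I = {i. i < N}"
    using finite_imp_inj_to_nat_seg[OF I] by blast
  define cf where "cf t i = (of_nat t :: complex) ^ idx i" for t i
  \<comment> \<open>A pair of points excludes at most \<open>N\<close> parameters and there are at
    most \<open>M * M\<close> pairs, so one of the \<open>D + 1\<close> parameters in
    \<open>{..D}\<close> survives.\<close>
  define D where "D = M * M * N"
  show ?thesis
  proof (rule that[of "cf ` {..D}"])
    fix F assume F: "F \<subseteq> affine_space I" "finite F" "card F \<le> M"
    define P where "P x z = (\<Sum>i\<in>I. monom (x i - z i) (idx i))" for x z :: "'x \<Rightarrow> complex"
    have eval: "poly (P x z) (of_nat t) = linear_form I (cf t) x - linear_form I (cf t) z" for x z t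
      by (simp add: P_def linear_form_def cf_def poly_sum poly_monom sum_subtractf[symmetric] algebra_simps)
    have bad: "finite {t. poly (P x z) (of_nat t) = 0} \<and> card {t::nat. poly (P x z) (of_nat t) = 0} \<le> N"
      if xz: "x \<in> F" "z \<in> F" "x \<noteq> z" for x z
    proof -
      obtain i where i: "i \<in> I" "x i \<noteq> z i"
        using xz F(1) PiE_ext[of x I "\<lambda>_. UNIV" z] unfolding affine_space_def by blast
      have "coeff (P x z) (idx i) = (\<Sum>j\<in>I. if j = i then x j - z j else 0)"
        unfolding P_def coeff_sum coeff_monom
        by (rule sum.cong) (use idx(1) i in \<open>auto dest: inj_onD\<close>)
      also have "\<dots> = x i - z i" using i I by simp
      finally have nz: "P x z \<noteq> 0" using i(2) by auto
      have deg: "degree (P x z) \<le> N"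
        unfolding P_def
      proof (rule degree_sum_le[OF I])
        fix j assume "j \<in> I"
        then have "idx j < N" using idx(2) by auto
        then show "degree (monom (x j - z j) (idx j)) \<le> N"
          by (meson degree_monom_le le_trans less_imp_le)
      qed
      have inj: "inj_on (of_nat :: nat \<Rightarrow> complex) {t. poly (P x z) (of_nat t) = 0}" by (auto simp: inj_on_def)
      have sub: "of_nat ` {t. poly (P x z) (of_nat t) = 0} \<subseteq> {s. poly (P x z) s = 0}" by auto
      have finr: "finite {s. poly (P x z) s = 0}" by (rule poly_roots_finite[OF nz])
      have "card {t::nat. poly (P x z) (of_nat t) = 0} \<le> card {s. poly (P x z) s = 0}"
        by (rule card_inj_on_le[OF inj sub finr])
      also have "\<dots> \<le> N" using card_poly_roots_bound[OF nz] deg by simp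
      finally show ?thesis using inj_on_finite[OF inj sub finr] by simp
    qed
    define Bad where "Bad = (\<Union>(x, z)\<in>{(x, z). x \<in> F \<and> z \<in> F \<and> x \<noteq> z}. {t::nat. poly (P x z) (of_nat t) = 0})"
    have pairs: "finite {(x, z). x \<in> F \<and> z \<in> F \<and> x \<noteq> z}" "card {(x, z). x \<in> F \<and> z \<in> F \<and> x \<noteq> z} \<le> M * M"
    proof -
      have sub: "{(x, z). x \<in> F \<and> z \<in> F \<and> x \<noteq> z} \<subseteq> F \<times> F" by auto
      show "finite {(x, z). x \<in> F \<and> z \<in> F \<and> x \<noteq> z}" by (rule finite_subset[OF sub]) (simp add: F(2))
      have "card {(x, z). x \<in> F \<and> z \<in> F \<and> x \<noteq> z} \<le> card (F \<times> F)" by (rule card_mono) (use F(2) sub in auto)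
      also have "\<dots> \<le> M * M" using F(3) by (simp add: card_cartesian_product mult_le_mono)
      finally show "card {(x, z). x \<in> F \<and> z \<in> F \<and> x \<noteq> z} \<le> M * M" .
    qed
    have "card Bad \<le> (\<Sum>(x, z)\<in>{(x, z). x \<in> F \<and> z \<in> F \<and> x \<noteq> z}. card {t::nat. poly (P x z) (of_nat t) = 0})"
      unfolding Bad_def using card_UN_le[OF pairs(1)] by (simp add: case_prod_unfold)
    also have "\<dots> \<le> (\<Sum>(x, z)\<in>{(x, z). x \<in> F \<and> z \<in> F \<and> x \<noteq> z}. N)"
      by (rule sum_mono) (use bad in auto)
    also have "\<dots> \<le> D" using pairs(2) by (simp add: D_def case_prod_unfold)
    finally have "card Bad < card {..D}" by simp
    moreover have "finite Bad" unfolding Bad_def using pairs(1) bad by auto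
    ultimately have "\<not> {..D} \<subseteq> Bad" using card_mono by (metis not_less)
    then obtain t where t: "t \<le> D" "t \<notin> Bad" by auto
    have "inj_on (linear_form I (cf t)) F"
    proof (rule inj_onI, rule ccontr)
      fix x z assume "x \<in> F" "z \<in> F" "linear_form I (cf t) x = linear_form I (cf t) z" "x \<noteq> z"
      then have "t \<in> Bad" unfolding Bad_def using eval[of x z t] by auto
      with t(2) show False by simp
    qed
    with t(1) show "\<exists>c\<in>cf ` {..D}. inj_on (linear_form I c) F" by auto
  qed simp
qed

text \<open>Each form in \<open>C\<close> has a generic number of values, and \<open>c0\<close> is
  one with the most. A generic fiber is separated by some form in \<open>C\<close>, so it has no
  more points than \<open>c0\<close> has values on it. Hence its cardinality is that constant, and
  \<open>c0\<close> separates it.\<close>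

lemma generic_fiber_card:
  assumes I: "finite I" "J \<subseteq> I" "y \<notin> I" and X: "X = {a \<in> affine_space I. Q a}" "constructible I Q"
    and bound: "\<forall>\<^sub>F a in zariski_generic J. finite (fiber X J a) \<and> card (fiber X J a) \<le> M"
  shows "\<exists>e c. \<forall>\<^sub>F a in zariski_generic J. finite (fiber X J a) \<and> card (fiber X J a) = e \<and>
    inj_on (linear_form I c) (fiber X J a)"
proof -
  obtain C :: "('a \<Rightarrow> complex) set" where C: "finite C"
    "\<And>F. F \<subseteq> affine_space I \<Longrightarrow> finite F \<Longrightarrow> card F \<le> M \<Longrightarrow> \<exists>c\<in>C. inj_on (linear_form I c) F"
    using separating_linear_forms[OF I(1)] by blast
  have fib: "fiber X J a \<subseteq> affine_space I" for a using X(1) by (auto simp: fiber_def)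
  have fin: "\<forall>\<^sub>F a in zariski_generic J. finite (fiber X J a)" using bound by eventually_elim simp
  have "\<forall>c. \<exists>e. \<forall>\<^sub>F a in zariski_generic J. card (linear_form I c ` fiber X J a) = e"
  proof
    fix c
    show "\<exists>e. \<forall>\<^sub>F a in zariski_generic J. card (linear_form I c ` fiber X J a) = e"
      by (rule linear_form_relation[OF I X fin, of c]) (rule exI)
  qed
  from choice[OF this] obtain e where
    e: "\<forall>c. \<forall>\<^sub>F a in zariski_generic J. card (linear_form I c ` fiber X J a) = e c" ..
  have "{} \<subseteq> affine_space I" "finite {}" "card {} \<le> M" by auto
  with C(2) have "C \<noteq> {}" by blast
  then obtain c0 where c0: "c0 \<in> C" "\<And>c. c \<in> C \<Longrightarrow> e c \<le> e c0"
    using Max_in[of "e ` C"] Max_ge[of "e ` C"] C(1) by (metis (no_types, lifting) finite_imageI image_iff imageI image_is_empty)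
  have "\<forall>\<^sub>F a in zariski_generic J. \<forall>c\<in>C. card (linear_form I c ` fiber X J a) = e c"
    using e by (intro eventually_ball_finite C(1)) blast
  with bound have "\<forall>\<^sub>F a in zariski_generic J. finite (fiber X J a) \<and> card (fiber X J a) = e c0 \<and>
    inj_on (linear_form I c0) (fiber X J a)"
  proof eventually_elim
    case (elim a)
    then obtain c where c: "c \<in> C" "inj_on (linear_form I c) (fiber X J a)" using C(2)[OF fib] by blast
    then have "card (fiber X J a) = e c" using elim card_image by metis
    then have "card (fiber X J a) \<le> card (linear_form I c0 ` fiber X J a)" using c0 c(1) elim by simp
    then have "card (linear_form I c0 ` fiber X J a) = card (fiber X J a)"
      using elim card_image_le[of "fiber X J a" "linear_form I c0"] by simp
    then show ?case using elim c0(1) eq_card_imp_inj_on[of "fiber X J a" "linear_form I c0"] by auto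
  qed
  then show ?thesis by blast
qed

section \<open>Generic fibers of matrix Schubert varieties\<close>

lemma constructible_factors_through:
  assumes "p \<le> n" "q \<le> n"
  shows "constructible (grid n) (factors_through r p q)"
proof -
  \<comment> \<open>The entries of the two factors are stored outside the grid: beyond column
    \<open>n\<close> for the left factor, beyond row \<open>n\<close> for the right one.\<close>
  let ?K = "(\<lambda>(i, l). (i, n + 1 + l)) ` ({1..p} \<times> {..<r}) \<union> (\<lambda>(l, j). (n + 1 + l, j)) ` ({..<r} \<times> {1..q})"
  define S :: "(nat \<times> nat \<Rightarrow> complex) \<Rightarrow> bool" where
    "S b \<longleftrightarrow> (\<forall>i\<in>{1..p}. \<forall>j\<in>{1..q}. b (i, j) = (\<Sum>l<r. b (i, n + 1 + l) * b (n + 1 + l, j)))" for b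
  have "constructible (grid n \<union> ?K) S"
    unfolding S_def
    by (intro constructible_ball constructible_eq cfun.sum_mem cfun_mult cfun_coord)
      (use assms in \<open>force simp: grid_def\<close>)+
  then have "constructible (grid n) (\<lambda>a. \<exists>f. S (override_on a f ?K))"
    by (intro constructible_projection) auto
  moreover have "(\<exists>f. S (override_on a f ?K)) \<longleftrightarrow> factors_through r p q a" for a
  proof -
    have base: "override_on a f ?K (i, j) = a (i, j)" if "i \<in> {1..p}" "j \<in> {1..q}" for f i j
      using that assms by (intro override_on_apply_notin) auto
    have left: "override_on a f ?K (i, n + 1 + l) = f (i, n + 1 + l)" if "i \<in> {1..p}" "l < r" for f i l
      using that by (intro override_on_apply_in) force
    have right: "override_on a f ?K (n + 1 + l, j) = f (n + 1 + l, j)" if "j \<in> {1..q}" "l < r" for f j l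
      using that by (intro override_on_apply_in) force
    have S: "S (override_on a f ?K) \<longleftrightarrow>
      (\<forall>i\<in>{1..p}. \<forall>j\<in>{1..q}. a (i, j) = (\<Sum>l<r. f (i, n + 1 + l) * f (n + 1 + l, j)))" for f
      unfolding S_def by (intro ball_cong refl arg_cong2[of _ _ _ _ "(=)"] sum.cong arg_cong2[of _ _ _ _ "(*)"]
          base left right) auto
    show ?thesis
    proof
      assume "\<exists>f. S (override_on a f ?K)"
      then obtain f where "S (override_on a f ?K)" ..
      then show "factors_through r p q a"
        unfolding S factors_through_def
        by (intro exI[of _ "\<lambda>i l. f (i, n + 1 + l)"] exI[of _ "\<lambda>l j. f (n + 1 + l, j)"])
    next
      assume "factors_through r p q a"
      then obtain B C where BC: "\<forall>i\<in>{1..p}. \<forall>j\<in>{1..q}. a (i, j) = (\<Sum>l<r. B i l * C l j)"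
        unfolding factors_through_def by blast
      define f where "f x = (if fst x \<le> n then B (fst x) (snd x - n - 1) else C (fst x - n - 1) (snd x))" for x
      have "S (override_on a f ?K)"
        unfolding S
      proof (intro ballI)
        fix i j assume ij: "i \<in> {1..p}" "j \<in> {1..q}"
        then have "f (i, n + 1 + l) = B i l" "f (n + 1 + l, j) = C l j" for l
          using assms by (auto simp: f_def)
        then show "a (i, j) = (\<Sum>l<r. f (i, n + 1 + l) * f (n + 1 + l, j))" using BC ij by simp
      qed
      then show "\<exists>f. S (override_on a f ?K)" by (rule exI[where x = f])
    qed
  qed
  ultimately show ?thesis by simp
qed

definition schubert_condition :: "nat \<Rightarrow> (nat \<Rightarrow> nat) \<Rightarrow> (nat \<times> nat \<Rightarrow> complex) \<Rightarrow> bool" where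
  "schubert_condition n w A \<longleftrightarrow> (\<forall>p\<in>{1..n}. \<forall>q\<in>{1..n}. factors_through (rank_fun n w p q) p q A)"

lemma matrix_schubert_variety_eq:
  "matrix_schubert_variety n w = {A \<in> affine_space (grid n). schubert_condition n w A}"
  using matrix_schubert_variety_iff by (auto simp: schubert_condition_def)

lemma constructible_schubert_condition: "constructible (grid n) (schubert_condition n w)"
  unfolding schubert_condition_def[abs_def]
  by (intro constructible_ball constructible_factors_through) auto

text \<open>By the dimension bound, each coordinate outside \<open>J\<close> satisfies an equation
  over the coordinates in \<open>J\<close>. Over a generic base point these equations are nonzero,
  and the fiber embeds into the product of their root sets.\<close>

lemma schubert_generic_fiber_finite:
  assumes w: "w permutes {1..n}" and J: "J \<subseteq> grid n" "n * n \<le> card J + card (rothe_diagram n w)"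
  shows "\<exists>M. \<forall>\<^sub>F a in zariski_generic J. finite (fiber (matrix_schubert_variety n w) J a) \<and>
    card (fiber (matrix_schubert_variety n w) J a) \<le> M"
proof -
  let ?X = "matrix_schubert_variety n w"
  have finJ: "finite J" by (rule finite_subset[OF J(1) finite_grid])
  have "\<exists>P. P \<in> poly_family (polyfun J) \<and> (\<exists>a. P a \<noteq> 0) \<and> (\<forall>A\<in>?X. poly (P A) (A i) = 0)"
    if i: "i \<in> grid n - J" for i
  proof -
    have "n * n < card (insert i J) + card (rothe_diagram n w)" using J i finJ by simp
    then obtain g a0 where g: "g \<in> polyfun (insert i J)" "g a0 \<noteq> 0" "\<And>A. A \<in> ?X \<Longrightarrow> g A = 0"
      using schubert_coordinates_dependent[OF w, of "insert i J"] J(1) i by blast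
    obtain P where P: "P \<in> poly_family (polyfun J)" "\<And>a t. g (a(i := t)) = poly (P a) t"
      using polyfun_upd_family[OF g(1)] by blast
    have "P a0 \<noteq> 0" using P(2)[of a0 "a0 i"] g(2) by auto
    moreover have "poly (P A) (A i) = 0" if "A \<in> ?X" for A
      using P(2)[of A "A i"] g(3)[OF that] by simp
    ultimately show ?thesis using P(1) by blast
  qed
  then have "\<forall>i\<in>grid n - J. \<exists>P. P \<in> poly_family (polyfun J) \<and> (\<exists>a. P a \<noteq> 0) \<and> (\<forall>A\<in>?X. poly (P A) (A i) = 0)"
    by blast
  from bchoice[OF this] obtain P where P: "\<forall>i\<in>grid n - J. P i \<in> poly_family (polyfun J) \<and> (\<exists>a. P i a \<noteq> 0) \<and>
    (\<forall>A\<in>?X. poly (P i A) (A i) = 0)" ..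
  have "\<forall>i\<in>grid n - J. \<exists>d. \<forall>a. degree (P i a) \<le> d"
    using P unfolding poly_family_def by blast
  from bchoice[OF this] obtain d where d: "\<forall>i\<in>grid n - J. \<forall>a. degree (P i a) \<le> d i" ..
  have "\<forall>\<^sub>F a in zariski_generic J. \<forall>i\<in>grid n - J. P i a \<noteq> 0"
  proof (intro eventually_ball_finite ballI)
    fix i assume i: "i \<in> grid n - J"
    with P obtain a0 where "P i a0 \<noteq> 0" by blast
    then have nz: "coeff (P i a0) (degree (P i a0)) \<noteq> 0" by simp
    have pf: "P i \<in> poly_family (polyfun J)" using P i by blast
    have "\<forall>\<^sub>F a in zariski_generic J. coeff (P i a) (degree (P i a0)) \<noteq> 0"
      by (rule generic_nonzero[OF poly_family_coeff[OF pf] nz])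
    then show "\<forall>\<^sub>F a in zariski_generic J. P i a \<noteq> 0" by eventually_elim auto
  qed (simp add: finite_grid)
  then have "\<forall>\<^sub>F a in zariski_generic J. finite (fiber ?X J a) \<and> card (fiber ?X J a) \<le> (\<Prod>i\<in>grid n - J. d i)"
  proof eventually_elim
    case (elim a)
    define R where "R i = {t. poly (P i a) t = 0}" for i
    have R: "finite (R i)" "card (R i) \<le> d i" if i: "i \<in> grid n - J" for i
    proof -
      have nz: "P i a \<noteq> 0" using elim i by blast
      show "finite (R i)" unfolding R_def by (rule poly_roots_finite[OF nz])
      show "card (R i) \<le> d i" unfolding R_def
        using card_poly_roots_bound[OF nz] d i by (meson le_trans)
    qed
    let ?f = "\<lambda>A. restrict A (grid n - J)"
    have inj: "inj_on ?f (fiber ?X J a)"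
    proof (rule inj_onI)
      fix A B assume A: "A \<in> fiber ?X J a" and B: "B \<in> fiber ?X J a" and eq: "?f A = ?f B"
      have "A \<in> grid n \<rightarrow>\<^sub>E UNIV" "B \<in> grid n \<rightarrow>\<^sub>E UNIV"
        using A B by (auto simp: fiber_def matrix_schubert_variety_eq affine_space_def)
      then show "A = B"
      proof (rule PiE_ext)
        fix i assume "i \<in> grid n"
        show "A i = B i"
        proof (cases "i \<in> J")
          case True
          then show ?thesis using A B by (simp add: fiber_def)
        next
          case False
          then show ?thesis using fun_cong[OF eq, of i] \<open>i \<in> grid n\<close> by simp
        qed
      qed
    qed
    have sub: "?f ` fiber ?X J a \<subseteq> (\<Pi>\<^sub>E i\<in>grid n - J. R i)"
    proof
      fix B assume "B \<in> ?f ` fiber ?X J a"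
      then obtain A where A: "A \<in> ?X" "\<And>j. j \<in> J \<Longrightarrow> A j = a j" "B = ?f A" by (auto simp: fiber_def)
      have "A i \<in> R i" if i: "i \<in> grid n - J" for i
      proof -
        have pf: "P i \<in> poly_family (polyfun J)" using P i by blast
        have "P i A = P i a"
          by (rule poly_eqI, rule polyfun_local[OF poly_family_coeff[OF pf]]) (rule A(2))
        moreover have "poly (P i A) (A i) = 0" using P i A(1) by blast
        ultimately show ?thesis by (simp add: R_def)
      qed
      then show "B \<in> (\<Pi>\<^sub>E i\<in>grid n - J. R i)" by (auto simp: A(3))
    qed
    have fin: "finite (\<Pi>\<^sub>E i\<in>grid n - J. R i)" by (rule finite_PiE) (auto simp: finite_grid R)
    have "card (fiber ?X J a) \<le> card (\<Pi>\<^sub>E i\<in>grid n - J. R i)"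
      by (rule card_inj_on_le[OF inj sub fin])
    also have "\<dots> = (\<Prod>i\<in>grid n - J. card (R i))" by (rule card_PiE) (simp add: finite_grid)
    also have "\<dots> \<le> (\<Prod>i\<in>grid n - J. d i)" by (rule prod_mono) (use R in auto)
    finally show ?case using inj_on_finite[OF inj sub fin] by simp
  qed
  then show ?thesis by blast
qed

section \<open>Deleting a row and a column\<close>

definition unskip :: "nat \<Rightarrow> nat \<Rightarrow> nat" where
  "unskip k i = (if k < i then i - 1 else i)"

lemma skip_simps [simp]: "skip k i \<noteq> k" "k \<noteq> skip k i" "unskip k (skip k i) = i"
  "skip k i < skip k j \<longleftrightarrow> i < j" "skip k i = skip k j \<longleftrightarrow> i = j"
  by (auto simp: skip_def unskip_def)

lemma skip_unskip: "x \<noteq> k \<Longrightarrow> skip k (unskip k x) = x"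
  by (auto simp: skip_def unskip_def)

lemma skip_in: "k \<in> {1..n} \<Longrightarrow> skip k i \<in> {1..n} \<longleftrightarrow> i \<in> {1..n - 1}"
  by (auto simp: skip_def)

lemma unskip_in: "k \<in> {1..n} \<Longrightarrow> x \<noteq> k \<Longrightarrow> unskip k x \<in> {1..n - 1} \<longleftrightarrow> x \<in> {1..n}"
  by (auto simp: unskip_def)

lemma card_rank_of:
  fixes f :: "nat \<Rightarrow> nat"
  assumes "inj_on f {1..n}" "f ` {1..n} = {1..n}" "i \<in> {1..n}"
  shows "card {j \<in> {1..n}. f j \<le> f i} = f i"
proof -
  have "f ` {j \<in> {1..n}. f j \<le> f i} = {1..f i}"
  proof (rule equalityI; rule subsetI)
    fix y assume "y \<in> f ` {j \<in> {1..n}. f j \<le> f i}"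
    then obtain j where "j \<in> {1..n}" "y = f j" "f j \<le> f i" by blast
    moreover have "f j \<in> {1..n}" using calculation(1) assms(2) by blast
    ultimately show "y \<in> {1..f i}" by simp
  next
    fix y assume y: "y \<in> {1..f i}"
    have "f i \<in> {1..n}" using assms(2,3) by blast
    with y have "y \<in> f ` {1..n}" unfolding assms(2) by simp
    with y show "y \<in> f ` {j \<in> {1..n}. f j \<le> f i}" by auto
  qed
  moreover have "inj_on f {j \<in> {1..n}. f j \<le> f i}" by (rule inj_on_subset[OF assms(1)]) auto
  ultimately have "card {j \<in> {1..n}. f j \<le> f i} = card {1..f i}" by (metis card_image)
  then show ?thesis by simp
qed

locale deletion =
  fixes n :: nat and w :: "nat \<Rightarrow> nat" and k :: nat and v :: "nat \<Rightarrow> nat"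
  assumes w: "w permutes {1..n}" and k: "k \<in> {1..n}" and rel: "relative_ordering_omitting n w k v"
begin

abbreviation m :: nat where "m \<equiv> w k"

abbreviation sk :: "nat \<times> nat \<Rightarrow> nat \<times> nat" where "sk \<equiv> \<lambda>(i, j). (skip k i, skip m j)"

lemma m: "m \<in> {1..n}"
  using permutes_in_image[OF w] k by blast

lemma w_in: "w i \<in> {1..n} \<longleftrightarrow> i \<in> {1..n}"
  by (rule permutes_in_image[OF w])

lemma w_eq_m: "w i = m \<longleftrightarrow> i = k"
  using permutes_inj[OF w] by (auto dest: injD)

lemma v: "v permutes {1..n - 1}"
  using rel by (simp add: relative_ordering_omitting_def)

text \<open>Both \<open>v\<close> and the compressed word \<open>u\<close> are bijections of
  \<open>{1..n - 1}\<close> with the same relative order, and a value of such a bijection is the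
  number of values not exceeding it.\<close>

lemma skip_v:
  assumes i: "i \<in> {1..n - 1}"
  shows "skip m (v i) = w (skip k i)"
proof -
  define u where "u i = unskip m (w (skip k i))" for i
  have su: "skip m (u i) = w (skip k i)" for i
    unfolding u_def by (rule skip_unskip) (simp add: w_eq_m)
  have inj: "inj_on u {1..n - 1}"
  proof (rule inj_onI)
    fix i j assume "u i = u j"
    then have "skip m (u i) = skip m (u j)" by simp
    then have "w (skip k i) = w (skip k j)" unfolding su .
    then have "skip k i = skip k j" by (rule injD[OF permutes_inj[OF w]])
    then show "i = j" by simp
  qed
  have "u j \<in> {1..n - 1}" if "j \<in> {1..n - 1}" for j
    using that skip_in[OF m, of "u j"] skip_in[OF k, of j] w_in[of "skip k j"] by (simp add: su)
  then have im: "u ` {1..n - 1} = {1..n - 1}"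
    using inj by (intro endo_inj_surj) auto
  have "u i = card {j \<in> {1..n - 1}. u j \<le> u i}" by (rule card_rank_of[OF inj im i, symmetric])
  also have "{j \<in> {1..n - 1}. u j \<le> u i} = {j \<in> {1..n - 1}. v j \<le> v i}"
  proof (rule Collect_cong, rule conj_cong[OF refl])
    fix j assume j: "j \<in> {1..n - 1}"
    have "u j \<le> u i \<longleftrightarrow> \<not> skip m (u i) < skip m (u j)" by (simp add: not_less)
    also have "\<dots> \<longleftrightarrow> \<not> v i < v j"
      unfolding su using rel i j unfolding relative_ordering_omitting_def by blast
    finally show "u j \<le> u i \<longleftrightarrow> v j \<le> v i" by (simp add: not_less)
  qed
  also have "card \<dots> = v i"
    by (rule card_rank_of[OF permutes_inj_on[OF v] permutes_image[OF v] i])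
  finally show ?thesis using su[of i] by simp
qed

lemma skip_inv_v:
  assumes "j \<in> {1..n - 1}"
  shows "inv_into UNIV w (skip m j) = skip k (inv_into UNIV v j)"
proof -
  have "inv_into UNIV v j \<in> {1..n - 1}"
    using permutes_in_image[OF permutes_inv[OF v]] assms by blast
  from skip_v[OF this] have "w (skip k (inv_into UNIV v j)) = skip m j"
    by (simp add: permutes_inverses[OF v])
  then show ?thesis by (simp add: permutes_inv_eq[OF w])
qed

lemma inj_sk: "inj_on sk A"
  by (auto simp: inj_on_def)

lemma sk_grid: "x \<in> grid (n - 1) \<Longrightarrow> sk x \<in> grid n"
  using skip_in[OF k] skip_in[OF m] by (auto simp: grid_def)

text \<open>Indexes the variables of \<open>M\<close>.\<close>

definition cross_diagram :: "(nat \<times> nat) set" where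
  "cross_diagram = {(i, j) \<in> rothe_diagram n w. i = k \<or> j = m}"

lemma sk_rothe_diagram:
  assumes "(i, j) \<in> grid (n - 1)"
  shows "sk (i, j) \<in> rothe_diagram n w \<longleftrightarrow> (i, j) \<in> rothe_diagram (n - 1) v"
proof -
  have ij: "i \<in> {1..n - 1}" "j \<in> {1..n - 1}" using assms by (auto simp: grid_def)
  have "sk (i, j) \<in> grid n" using sk_grid[OF assms] .
  moreover have "w (skip k i) > skip m j \<longleftrightarrow> v i > j" 
    unfolding skip_v[OF ij(1), symmetric] by simp
  moreover have "inv_into UNIV w (skip m j) > skip k i \<longleftrightarrow> inv_into UNIV v j > i"
    using skip_inv_v[OF ij(2)] by simp
  ultimately show ?thesis using assms by (simp add: rothe_diagram_def)
qed

lemma rothe_diagram_split: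
  "rothe_diagram n w = cross_diagram \<union> sk ` rothe_diagram (n - 1) v"
proof (rule equalityI; rule subsetI)
  fix x assume x: "x \<in> rothe_diagram n w"
  obtain i j where ij: "x = (i, j)" by (cases x)
  show "x \<in> cross_diagram \<union> sk ` rothe_diagram (n - 1) v"
  proof (cases "i = k \<or> j = m")
    case True
    then show ?thesis using x ij by (simp add: cross_diagram_def)
  next
    case False
    then have "x = sk (unskip k i, unskip m j)" by (simp add: ij skip_unskip)
    moreover have g: "(unskip k i, unskip m j) \<in> grid (n - 1)"
      using x ij False unskip_in[OF k] unskip_in[OF m] by (simp add: rothe_diagram_def grid_def)
    ultimately have "(unskip k i, unskip m j) \<in> rothe_diagram (n - 1) v"
      using sk_rothe_diagram[OF g] x by simp
    with \<open>x = sk (unskip k i, unskip m j)\<close> show ?thesis by blast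
  qed
next
  fix x assume "x \<in> cross_diagram \<union> sk ` rothe_diagram (n - 1) v"
  then show "x \<in> rothe_diagram n w"
  proof
    assume "x \<in> sk ` rothe_diagram (n - 1) v"
    then obtain i j where "(i, j) \<in> rothe_diagram (n - 1) v" "x = sk (i, j)" by auto
    then show ?thesis using sk_rothe_diagram[of i j] by (simp add: rothe_diagram_def)
  qed (auto simp: cross_diagram_def)
qed

lemma cross_sk_disjoint: "cross_diagram \<inter> sk ` A = {}"
  by (auto simp: cross_diagram_def)

lemma finite_rothe_diagram: "finite (rothe_diagram n w)"
  by (rule finite_subset[OF _ finite_grid[of n]]) (auto simp: rothe_diagram_def)

lemma finite_cross_diagram: "finite cross_diagram"
  by (rule finite_subset[OF _ finite_rothe_diagram]) (auto simp: cross_diagram_def)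

lemma cross_diagram_grid: "cross_diagram \<subseteq> grid n"
  by (auto simp: cross_diagram_def rothe_diagram_def)

lemma card_rothe_split: "card (rothe_diagram n w) = card cross_diagram + card (rothe_diagram (n - 1) v)"
proof -
  have "finite (rothe_diagram (n - 1) v)"
    by (rule finite_subset[OF _ finite_grid[of "n - 1"]]) (auto simp: rothe_diagram_def)
  then show ?thesis
    unfolding rothe_diagram_split
    by (subst card_Un_disjoint[OF finite_cross_diagram _ cross_sk_disjoint]) (simp_all add: card_image[OF inj_sk])
qed

text \<open>The dots of \<open>v\<close> in the smaller rectangle map to dots of \<open>w\<close> in
  the larger one, and none of them to \<open>(k, w k)\<close>, which accounts for the additional
  one.\<close>

lemma rank_fun_deletion:
  assumes "P \<in> {1..n}" "Q \<in> {1..n}"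
  shows "rank_fun (n - 1) v (if k \<le> P then P - 1 else P) (if m \<le> Q then Q - 1 else Q) +
    (if k \<le> P \<and> m \<le> Q then 1 else 0) \<le> rank_fun n w P Q"
proof -
  let ?V = "{(i, j) \<in> grid (n - 1). i \<le> (if k \<le> P then P - 1 else P) \<and> j \<le> (if m \<le> Q then Q - 1 else Q) \<and> v i = j}"
  let ?W = "{(i, j) \<in> grid n. i \<le> P \<and> j \<le> Q \<and> w i = j}"
  let ?S = "if k \<le> P \<and> m \<le> Q then {(k, m)} else {}"
  have finV: "finite ?V" by (rule finite_subset[OF _ finite_grid[of "n - 1"]]) auto
  have finW: "finite ?W" by (rule finite_subset[OF _ finite_grid[of n]]) auto
  have "sk ` ?V \<subseteq> ?W"
  proof
    fix x assume "x \<in> sk ` ?V"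
    then obtain i where i: "(i, v i) \<in> grid (n - 1)" "i \<le> (if k \<le> P then P - 1 else P)"
      "v i \<le> (if m \<le> Q then Q - 1 else Q)" "x = sk (i, v i)" by blast
    have "skip k i \<le> P" using i(2) assms by (auto simp: skip_def split: if_splits)
    moreover have "skip m (v i) \<le> Q" using i(3) assms by (auto simp: skip_def split: if_splits)
    moreover have "w (skip k i) = skip m (v i)" using skip_v[of i] i(1) by (simp add: grid_def)
    ultimately show "x \<in> ?W" using sk_grid[OF i(1)] i(4) by simp
  qed
  moreover have "?S \<subseteq> ?W" using k m by (simp add: grid_def)
  ultimately have "card (sk ` ?V \<union> ?S) \<le> card ?W" using finW by (intro card_mono) auto
  moreover have "card (sk ` ?V \<union> ?S) = card ?V + card ?S"
    using finV by (subst card_Un_disjoint) (auto simp: card_image[OF inj_sk])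
  ultimately show ?thesis unfolding rank_fun_def by (auto split: if_splits)
qed

end

section \<open>Extending points of \<open>X\<^sub>v\<close> to points of
  \<open>X\<^sub>w\<close>\<close>

lemma factors_through_mono:
  assumes "factors_through r p q A" "r \<le> s"
  shows "factors_through s p q A"
proof -
  obtain B C where BC: "\<forall>i\<in>{1..p}. \<forall>j\<in>{1..q}. A (i, j) = (\<Sum>l<r. B i l * C l j)"
    using assms(1) unfolding factors_through_def by blast
  have "(\<Sum>l<r. B i l * C l j) = (\<Sum>l<s. (if l < r then B i l else 0) * C l j)" for i j
    by (rule sum.mono_neutral_cong_left) (use assms(2) in auto)
  with BC show ?thesis unfolding factors_through_def
    by (intro exI[of _ "\<lambda>i l. if l < r then B i l else 0"] exI[of _ C]) simp
qed

lemma factors_through_cong: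
  assumes "factors_through r p q A" "\<And>i j. i \<in> {1..p} \<Longrightarrow> j \<in> {1..q} \<Longrightarrow> A (i, j) = B (i, j)"
  shows "factors_through r p q B"
  using assms unfolding factors_through_def by metis

context deletion
begin

text \<open>The rows of the dots strictly northwest of \<open>(k, w k)\<close>. An entry of row
  \<open>k\<close> left of that dot and outside the diagram has the dot of its column in one of
  these rows; an entry of column \<open>w k\<close> above the dot and outside the diagram lies in
  one of them.\<close>

definition nw_rows :: "nat set" where
  "nw_rows = {i \<in> {1..<k}. w i < m}"

lemma nw_rows: "finite nw_rows" "i \<in> nw_rows \<Longrightarrow> i \<in> {1..n} \<and> i < k \<and> w i < m \<and> w i \<in> {1..n}"
  using k w_in[of i] by (auto simp: nw_rows_def)

definition spread :: "(nat \<times> nat \<Rightarrow> complex) \<Rightarrow> nat \<times> nat \<Rightarrow> complex" where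
  "spread A = (\<lambda>(i, j). A (unskip k i, unskip m j))"

text \<open>A point of \<open>X\<^sub>v\<close> is extended to a point of \<open>X\<^sub>w\<close>: first the new row and column are filled with
  combinations of the rows and columns of \<^const>\<open>nw_rows\<close> and a pivot \<open>p\<close>, then multiples of
  the new column are added to the right, and multiples of the new row are added below.\<close>

definition new_row :: "(nat \<times> nat \<Rightarrow> complex) \<Rightarrow> (nat \<Rightarrow> complex) \<Rightarrow> nat \<Rightarrow> complex" where
  "new_row A c j = (\<Sum>i\<in>nw_rows. c i * spread A (i, j))"

definition new_col :: "(nat \<times> nat \<Rightarrow> complex) \<Rightarrow> (nat \<Rightarrow> complex) \<Rightarrow> nat \<Rightarrow> complex" where
  "new_col A d i = (\<Sum>i'\<in>nw_rows. d i' * spread A (i, w i'))"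

definition base_matrix where
  "base_matrix A c d p = (\<lambda>(i, j). if i = k then (if j = m then p else new_row A c j)
     else if j = m then new_col A d i else spread A (i, j))"

definition extension where
  "extension A c d p r l = (\<lambda>(i, j). base_matrix A c d p (i, j)
     + (if m < j then r j else 0) * base_matrix A c d p (i, m)
     + (if k < i then l i else 0) * base_matrix A c d p (k, j)
     + (if k < i then l i else 0) * (if m < j then r j else 0) * base_matrix A c d p (k, m))"

text \<open>The rows in \<open>nw_rows\<close> lie above \<open>k\<close> and their dots left of
  \<open>w k\<close>, so a northwest block meeting the new row or column contains what that is
  combined from; up to the pivot, it still factors through \<open>R\<close>. Additions go only right
  and down, so the pivot affects a block only if it lies in it, at the cost of one in the
  rank.\<close>

lemma extension_factors:
  assumes A: "factors_through R (if k \<le> P then P - 1 else P) (if m \<le> Q then Q - 1 else Q) A"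
    and PQ: "P \<in> {1..n}" "Q \<in> {1..n}"
  shows "factors_through (R + (if k \<le> P \<and> m \<le> Q then 1 else 0)) P Q (extension A c d p r l)"
proof -
  obtain B C where BC: "\<And>i j. i \<in> {1..if k \<le> P then P - 1 else P} \<Longrightarrow> j \<in> {1..if m \<le> Q then Q - 1 else Q} \<Longrightarrow>
    A (i, j) = (\<Sum>t<R. B i t * C t j)"
    using A unfolding factors_through_def by blast
  have sp: "spread A (i, j) = (\<Sum>t<R. B (unskip k i) t * C t (unskip m j))"
    if "i \<in> {1..P}" "i \<noteq> k" "j \<in> {1..Q}" "j \<noteq> m" for i j
    unfolding spread_def prod.case using that k m by (intro BC) (auto simp: unskip_def)
  define B' where "B' i t = (if i = k then \<Sum>i'\<in>nw_rows. c i' * B (unskip k i') t else B (unskip k i) t)" for i t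
  define C' where "C' t j = (if j = m then \<Sum>i'\<in>nw_rows. d i' * C t (unskip m (w i')) else C t (unskip m j))" for t j
  define E where "E i j = (\<Sum>t<R. B' i t * C' t j)" for i j
  \<comment> \<open>The excess of the pivot over the value given by the extended factors; it
    contributes a matrix of rank at most one.\<close>
  define p0 where "p0 = p - E k m"
  have base: "base_matrix A c d p (i, j) = E i j + p0 * (of_bool (i = k) * of_bool (j = m))"
    if i: "i \<in> {1..P}" and j: "j \<in> {1..Q}" for i j
  proof -
    consider "i = k" "j = m" | "i = k" "j \<noteq> m" | "i \<noteq> k" "j = m" | "i \<noteq> k" "j \<noteq> m" by blast
    then show ?thesis
    proof cases
      case 1
      then show ?thesis by (simp add: base_matrix_def p0_def)
    next
      case 2
      have "new_row A c j = (\<Sum>i'\<in>nw_rows. c i' * (\<Sum>t<R. B (unskip k i') t * C t (unskip m j)))"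
        unfolding new_row_def
      proof (intro sum.cong refl arg_cong[of _ _ "(*) _"])
        fix i' assume "i' \<in> nw_rows"
        with nw_rows(2)[of i'] i 2 have "i' \<in> {1..P}" "i' \<noteq> k" by auto
        then show "spread A (i', j) = (\<Sum>t<R. B (unskip k i') t * C t (unskip m j))"
          using sp j 2 by blast
      qed
      also have "\<dots> = E i j"
        unfolding E_def B'_def C'_def using 2
        by (simp add: sum_distrib_left sum_distrib_right mult_ac sum.swap[of _ "nw_rows"])
      finally show ?thesis using 2 by (simp add: base_matrix_def)
    next
      case 3
      have "new_col A d i = (\<Sum>i'\<in>nw_rows. d i' * (\<Sum>t<R. B (unskip k i) t * C t (unskip m (w i'))))"
        unfolding new_col_def
      proof (intro sum.cong refl arg_cong[of _ _ "(*) _"])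
        fix i' assume "i' \<in> nw_rows"
        with nw_rows(2)[of i'] j 3 have "w i' \<in> {1..Q}" "w i' \<noteq> m" by auto
        then show "spread A (i, w i') = (\<Sum>t<R. B (unskip k i) t * C t (unskip m (w i')))"
          using sp i 3 by blast
      qed
      also have "\<dots> = E i j"
        unfolding E_def B'_def C'_def using 3
        by (simp add: sum_distrib_left sum_distrib_right mult_ac sum.swap[of _ "nw_rows"])
      finally show ?thesis using 3 by (simp add: base_matrix_def)
    next
      case 4
      then show ?thesis using sp i j by (simp add: base_matrix_def E_def B'_def C'_def)
    qed
  qed
  define \<alpha> where "\<alpha> i = (if k < i then l i else 0)" for i
  define \<beta> where "\<beta> j = (if m < j then r j else 0)" for j
  let ?x = "\<lambda>i. of_bool (i = k) + \<alpha> i" and ?y = "\<lambda>j. of_bool (j = m) + \<beta> j"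
  have expand: "(e + p0 * (x * y)) + b * (e1 + p0 * x) + a * (e2 + p0 * y) + a * b * (e3 + p0) =
      (e + b * e1 + a * e2 + a * b * e3) + p0 * ((x + a) * (y + b))" for e e1 e2 e3 a b x y :: complex
    by (simp add: algebra_simps)
  have ext: "extension A c d p r l (i, j) =
      (\<Sum>t<R. (B' i t + \<alpha> i * B' k t) * (C' t j + \<beta> j * C' t m)) + p0 * (?x i * ?y j)"
    if i: "i \<in> {1..P}" and j: "j \<in> {1..Q}" for i j
  proof -
    have 1: "\<beta> j * base_matrix A c d p (i, m) = \<beta> j * (E i m + p0 * of_bool (i = k))"
      using base[OF i, of m] j m by (auto simp: \<beta>_def)
    have 2: "\<alpha> i * base_matrix A c d p (k, j) = \<alpha> i * (E k j + p0 * of_bool (j = m))"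
      using base[OF _ j, of k] i k by (auto simp: \<alpha>_def)
    have 3: "\<alpha> i * \<beta> j * base_matrix A c d p (k, m) = \<alpha> i * \<beta> j * (E k m + p0)"
      by (simp add: base_matrix_def p0_def)
    have "extension A c d p r l (i, j) = base_matrix A c d p (i, j) + \<beta> j * base_matrix A c d p (i, m) +
        \<alpha> i * base_matrix A c d p (k, j) + \<alpha> i * \<beta> j * base_matrix A c d p (k, m)"
      by (simp add: extension_def \<alpha>_def \<beta>_def)
    also have "\<dots> = (E i j + \<beta> j * E i m + \<alpha> i * E k j + \<alpha> i * \<beta> j * E k m) + p0 * (?x i * ?y j)"
      unfolding 1 2 3 base[OF i j] by (rule expand)
    also have "E i j + \<beta> j * E i m + \<alpha> i * E k j + \<alpha> i * \<beta> j * E k m =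
        (\<Sum>t<R. (B' i t + \<alpha> i * B' k t) * (C' t j + \<beta> j * C' t m))"
    proof -
      have "(\<Sum>t<R. (B' i t + \<alpha> i * B' k t) * (C' t j + \<beta> j * C' t m)) =
        (\<Sum>t<R. B' i t * C' t j + \<beta> j * (B' i t * C' t m) + \<alpha> i * (B' k t * C' t j) + \<alpha> i * \<beta> j * (B' k t * C' t m))"
        by (intro sum.cong refl) (simp add: algebra_simps)
      then show ?thesis unfolding E_def by (simp only: sum.distrib sum_distrib_left)
    qed
    finally show ?thesis .
  qed
  show ?thesis
  proof (cases "k \<le> P \<and> m \<le> Q")
    case True
    have "extension A c d p r l (i, j) = (\<Sum>t<Suc R. (if t = R then p0 * ?x i else B' i t + \<alpha> i * B' k t) *
        (if t = R then ?y j else C' t j + \<beta> j * C' t m))" if "i \<in> {1..P}" "j \<in> {1..Q}" for i j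
      unfolding ext[OF that] by (simp add: mult.assoc)
    then have "factors_through (Suc R) P Q (extension A c d p r l)"
      unfolding factors_through_def
      by (intro exI[of _ "\<lambda>i t. if t = R then p0 * ?x i else B' i t + \<alpha> i * B' k t"]
          exI[of _ "\<lambda>t j. if t = R then ?y j else C' t j + \<beta> j * C' t m"]) blast
    with True show ?thesis by simp
  next
    case False
    have "extension A c d p r l (i, j) = (\<Sum>t<R. (B' i t + \<alpha> i * B' k t) * (C' t j + \<beta> j * C' t m))"
      if "i \<in> {1..P}" "j \<in> {1..Q}" for i j
    proof -
      have "?x i * ?y j = 0" using that False by (auto simp: \<alpha>_def \<beta>_def)
      then show ?thesis unfolding ext[OF that] by simp
    qed
    then have "factors_through R P Q (extension A c d p r l)"
      unfolding factors_through_def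
      by (intro exI[of _ "\<lambda>i t. B' i t + \<alpha> i * B' k t"] exI[of _ "\<lambda>t j. C' t j + \<beta> j * C' t m"]) blast
    with False show ?thesis by auto
  qed
qed

lemma extension_in_schubert:
  assumes A: "A \<in> matrix_schubert_variety (n - 1) v"
  shows "restrict (extension A c d p r l) (grid n) \<in> matrix_schubert_variety n w"
  unfolding matrix_schubert_variety_iff
proof (intro conjI ballI)
  show "restrict (extension A c d p r l) (grid n) \<in> affine_space (grid n)" by (rule restrict_affine_space)
  fix P Q assume PQ: "P \<in> {1..n}" "Q \<in> {1..n}"
  let ?P = "if k \<le> P then P - 1 else P" and ?Q = "if m \<le> Q then Q - 1 else Q"
  have "factors_through (rank_fun (n - 1) v ?P ?Q) ?P ?Q A"
  proof (cases "?P \<in> {1..n - 1} \<and> ?Q \<in> {1..n - 1}")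
    case True
    with A show ?thesis unfolding matrix_schubert_variety_iff by blast
  next
    case False
    then have "?P = 0 \<or> ?Q = 0" using PQ k m by (auto split: if_splits)
    then show ?thesis unfolding factors_through_def by auto
  qed
  from factors_through_mono[OF extension_factors[OF this PQ] rank_fun_deletion[OF PQ]]
  have "factors_through (rank_fun n w P Q) P Q (extension A c d p r l)" .
  then show "factors_through (rank_fun n w P Q) P Q (restrict (extension A c d p r l) (grid n))"
    by (rule factors_through_cong) (use PQ in \<open>auto simp: grid_def\<close>)
qed

text \<open>The square block with rows \<open>nw_rows\<close> and the columns of their dots, padded
  by the identity to size \<open>n\<close> to avoid renumbering; \<open>Suc\<close> passes from
  indices starting at 0 to those starting at 1.\<close>

definition nw_matrix :: "(nat \<times> nat \<Rightarrow> complex) \<Rightarrow> complex mat" where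
  "nw_matrix A = mat n n (\<lambda>(a, b). if Suc a \<in> nw_rows \<and> Suc b \<in> nw_rows then spread A (Suc a, w (Suc b))
     else of_bool (a = b))"

definition nw_minor :: "(nat \<times> nat \<Rightarrow> complex) \<Rightarrow> complex" where
  "nw_minor A = det (nw_matrix A)"

lemma nw_minor_polyfun: "nw_minor \<in> polyfun (grid (n - 1))"
proof -
  have "(\<lambda>A. \<Sum>q\<in>{q. q permutes {0..<n}}. signof q * (\<Prod>a = 0..<n.
      if Suc a \<in> nw_rows \<and> Suc (q a) \<in> nw_rows then spread A (Suc a, w (Suc (q a))) else of_bool (a = q a)))
      \<in> polyfun (grid (n - 1))"
  proof (intro polyfun.sum_mem polyfun_mult polyfun_const polyfun.prod_mem polyfun.if_mem)
    fix q a assume "Suc a \<in> nw_rows \<and> Suc (q a) \<in> nw_rows"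
    then have *: "Suc a \<in> {1..n}" "Suc a \<noteq> k" "w (Suc (q a)) \<in> {1..n}" "w (Suc (q a)) \<noteq> m"
      using nw_rows(2)[of "Suc a"] nw_rows(2)[of "Suc (q a)"] by auto
    then have "(unskip k (Suc a), unskip m (w (Suc (q a)))) \<in> grid (n - 1)"
      using unskip_in[OF k *(2)] unskip_in[OF m *(4)] unfolding grid_def by blast
    then show "(\<lambda>A. spread A (Suc a, w (Suc (q a)))) \<in> polyfun (grid (n - 1))"
      unfolding spread_def prod.case by (rule polyfun_coord)
  qed
  moreover have "nw_minor = (\<lambda>A. \<Sum>q\<in>{q. q permutes {0..<n}}. signof q * (\<Prod>a = 0..<n.
      if Suc a \<in> nw_rows \<and> Suc (q a) \<in> nw_rows then spread A (Suc a, w (Suc (q a))) else of_bool (a = q a)))"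
  proof
    fix A
    have "nw_matrix A \<in> carrier_mat n n" by (simp add: nw_matrix_def)
    then have "nw_minor A = (\<Sum>q\<in>{q. q permutes {0..<n}}. signof q * (\<Prod>a = 0..<n. nw_matrix A $$ (a, q a)))"
      unfolding nw_minor_def by (rule det_def')
    also have "\<dots> = (\<Sum>q\<in>{q. q permutes {0..<n}}. signof q * (\<Prod>a = 0..<n.
        if Suc a \<in> nw_rows \<and> Suc (q a) \<in> nw_rows then spread A (Suc a, w (Suc (q a))) else of_bool (a = q a)))"
    proof (intro sum.cong refl arg_cong[of _ _ "(*) _"] prod.cong)
      fix q a assume q: "q \<in> {q. q permutes {0..<n}}" and a: "a \<in> {0..<n}"
      then have "q a < n" using permutes_in_image[of q "{0..<n}" a] by simp
      with a show "nw_matrix A $$ (a, q a) = (if Suc a \<in> nw_rows \<and> Suc (q a) \<in> nw_rows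
          then spread A (Suc a, w (Suc (q a))) else of_bool (a = q a))"
        by (simp add: nw_matrix_def)
    qed
    finally show "nw_minor A = (\<Sum>q\<in>{q. q permutes {0..<n}}. signof q * (\<Prod>a = 0..<n.
        if Suc a \<in> nw_rows \<and> Suc (q a) \<in> nw_rows then spread A (Suc a, w (Suc (q a))) else of_bool (a = q a)))" .
  qed
  ultimately show ?thesis by simp
qed

text \<open>The padded block of the permutation matrix of \<open>v\<close> is the identity. This is
  the nonvanishing required for \<open>schubert_hypersurface_dependent\<close>.\<close>

lemma nw_minor_permutation: "nw_minor (\<lambda>(i, j). of_bool (v i = j)) \<noteq> 0"
proof -
  have "nw_matrix (\<lambda>(i, j). of_bool (v i = j)) = 1\<^sub>m n"
  proof (rule eq_matI)
    fix a b assume "a < dim_row (1\<^sub>m n :: complex mat)" "b < dim_col (1\<^sub>m n :: complex mat)"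
    then have ab: "a < n" "b < n" by auto
    have "v (unskip k (Suc a)) = unskip m (w (Suc b)) \<longleftrightarrow> a = b" if "Suc a \<in> nw_rows" "Suc b \<in> nw_rows"
    proof -
      have *: "Suc a \<in> {1..n}" "Suc a \<noteq> k" "w (Suc b) \<noteq> m" using nw_rows(2)[of "Suc a"] nw_rows(2)[of "Suc b"] that by auto
      have "v (unskip k (Suc a)) = unskip m (w (Suc b)) \<longleftrightarrow> skip m (v (unskip k (Suc a))) = w (Suc b)"
      proof
        assume "skip m (v (unskip k (Suc a))) = w (Suc b)"
        then have "unskip m (skip m (v (unskip k (Suc a)))) = unskip m (w (Suc b))" by (rule arg_cong)
        then show "v (unskip k (Suc a)) = unskip m (w (Suc b))" by simp
      qed (simp add: skip_unskip[OF *(3)])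
      also have "skip m (v (unskip k (Suc a))) = w (Suc a)"
        using skip_v[of "unskip k (Suc a)"] unskip_in[OF k *(2)] * skip_unskip[OF *(2)] by simp
      also have "w (Suc a) = w (Suc b) \<longleftrightarrow> a = b" using permutes_inj[OF w] by (auto dest: injD)
      finally show ?thesis .
    qed
    then show "nw_matrix (\<lambda>(i, j). of_bool (v i = j)) $$ (a, b) = 1\<^sub>m n $$ (a, b)"
      using ab by (auto simp: nw_matrix_def spread_def)
  qed (auto simp: nw_matrix_def)
  then show ?thesis by (simp add: nw_minor_def)
qed

lemma nw_sum_shift: "(\<Sum>b = 0..<n. if Suc b \<in> nw_rows then f (Suc b) else 0) = (\<Sum>i\<in>nw_rows. f i)"
proof -
  have "(\<Sum>b = 0..<n. if Suc b \<in> nw_rows then f (Suc b) else 0) = (\<Sum>i\<in>{1..n}. if i \<in> nw_rows then f i else 0)"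
    by (rule sum.reindex_bij_witness[of _ "\<lambda>i. i - 1" Suc]) auto
  also have "\<dots> = (\<Sum>i\<in>nw_rows. f i)"
    by (rule sum.mono_neutral_cong_right) (use nw_rows in auto)
  finally show ?thesis .
qed

lemma nw_solvable:
  assumes "nw_minor A \<noteq> 0"
  shows "\<exists>c. \<forall>i\<in>nw_rows. new_row A c (w i) = u i" "\<exists>d. \<forall>i\<in>nw_rows. new_col A d i = u i"
proof -
  let ?M = "nw_matrix A"
  have M: "?M \<in> carrier_mat n n" by (simp add: nw_matrix_def)
  from det_non_zero_imp_unit[OF M, of "()"] assms obtain B where
    B: "B \<in> carrier_mat n n" "B * ?M = 1\<^sub>m n" "?M * B = 1\<^sub>m n"
    unfolding nw_minor_def Units_def ring_mat_def by auto
  have BM: "(\<Sum>b = 0..<n. B $$ (a, b) * ?M $$ (b, c)) = of_bool (a = c)" if "a < n" "c < n" for a c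
    using arg_cong[OF B(2), of "\<lambda>X. X $$ (a, c)"] that B(1) M by (simp add: scalar_prod_def)
  have MB: "(\<Sum>b = 0..<n. ?M $$ (a, b) * B $$ (b, c)) = of_bool (a = c)" if "a < n" "c < n" for a c
    using arg_cong[OF B(3), of "\<lambda>X. X $$ (a, c)"] that B(1) M by (simp add: scalar_prod_def)
  have entry: "?M $$ (a, b) = (if Suc b \<in> nw_rows then spread A (Suc a, w (Suc b)) else 0)"
    if "Suc a \<in> nw_rows" "a < n" "b < n" for a b
    using that by (auto simp: nw_matrix_def)
  have entry': "?M $$ (a, b) = (if Suc a \<in> nw_rows then spread A (Suc a, w (Suc b)) else 0)"
    if "Suc b \<in> nw_rows" "a < n" "b < n" for a b
    using that by (auto simp: nw_matrix_def)
  show "\<exists>d. \<forall>i\<in>nw_rows. new_col A d i = u i"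
  proof (intro exI[of _ "\<lambda>i. \<Sum>a = 0..<n. B $$ (i - 1, a) * u (Suc a)"] ballI)
    fix i assume i: "i \<in> nw_rows"
    define a where "a = i - 1"
    have a: "i = Suc a" "a < n" using nw_rows(2)[OF i] by (auto simp: a_def)
    have "new_col A (\<lambda>i. \<Sum>a = 0..<n. B $$ (i - 1, a) * u (Suc a)) i =
        (\<Sum>b = 0..<n. if Suc b \<in> nw_rows then (\<Sum>c = 0..<n. B $$ (b, c) * u (Suc c)) * spread A (i, w (Suc b)) else 0)"
      unfolding new_col_def by (subst nw_sum_shift[symmetric]) (intro sum.cong refl, simp)
    also have "\<dots> = (\<Sum>b = 0..<n. \<Sum>c = 0..<n. ?M $$ (a, b) * B $$ (b, c) * u (Suc c))"
      using i a by (intro sum.cong refl) (auto simp: entry sum_distrib_left sum_distrib_right mult_ac)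
    also have "\<dots> = (\<Sum>c = 0..<n. (\<Sum>b = 0..<n. ?M $$ (a, b) * B $$ (b, c)) * u (Suc c))"
      unfolding sum_distrib_right by (rule sum.swap)
    also have "\<dots> = (\<Sum>c = 0..<n. if c = a then u (Suc c) else 0)"
      using a by (intro sum.cong refl) (auto simp: MB)
    also have "\<dots> = u i" using a by simp
    finally show "new_col A (\<lambda>i. \<Sum>a = 0..<n. B $$ (i - 1, a) * u (Suc a)) i = u i" .
  qed
  show "\<exists>c. \<forall>i\<in>nw_rows. new_row A c (w i) = u i"
  proof (intro exI[of _ "\<lambda>i. \<Sum>a = 0..<n. u (Suc a) * B $$ (a, i - 1)"] ballI)
    fix i assume i: "i \<in> nw_rows"
    define a where "a = i - 1"
    have a: "i = Suc a" "a < n" using nw_rows(2)[OF i] by (auto simp: a_def)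
    have "new_row A (\<lambda>i. \<Sum>a = 0..<n. u (Suc a) * B $$ (a, i - 1)) (w i) =
        (\<Sum>b = 0..<n. if Suc b \<in> nw_rows then (\<Sum>c = 0..<n. u (Suc c) * B $$ (c, b)) * spread A (Suc b, w i) else 0)"
      unfolding new_row_def by (subst nw_sum_shift[symmetric]) (intro sum.cong refl, simp)
    also have "\<dots> = (\<Sum>b = 0..<n. \<Sum>c = 0..<n. B $$ (c, b) * ?M $$ (b, a) * u (Suc c))"
      using i a by (intro sum.cong refl) (auto simp: entry' sum_distrib_left sum_distrib_right mult_ac)
    also have "\<dots> = (\<Sum>c = 0..<n. (\<Sum>b = 0..<n. B $$ (c, b) * ?M $$ (b, a)) * u (Suc c))"
      unfolding sum_distrib_right by (rule sum.swap)
    also have "\<dots> = (\<Sum>c = 0..<n. if c = a then u (Suc c) else 0)"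
      using a by (intro sum.cong refl) (auto simp: BM)
    also have "\<dots> = u i" using a by simp
    finally show "new_row A (\<lambda>i. \<Sum>a = 0..<n. u (Suc a) * B $$ (a, i - 1)) (w i) = u i" .
  qed
qed

end

section \<open>Deformation and specialization\<close>

lemma continuous_zero_at:
  fixes f :: "complex \<Rightarrow> complex"
  assumes "continuous_on UNIV f" "\<And>s. s \<noteq> 0 \<Longrightarrow> f s = 0"
  shows "f 0 = 0"
proof -
  have "f \<midarrow>0\<rightarrow> f 0"
    using assms(1) by (simp add: continuous_on_eq_continuous_at isCont_def)
  moreover have "f \<midarrow>0\<rightarrow> 0"
    by (rule tendsto_eventually) (use assms(2) in \<open>auto simp: eventually_at_filter\<close>)
  ultimately show ?thesis by (rule LIM_unique)
qed

context deletion
begin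

text \<open>The extension of \<open>A\<close> with the parameters \<open>c, d, r, l\<close> scaled by \<open>s\<close>, after dividing the
  coordinates in the new row and column, except the pivot, by \<open>s\<close>.\<close>

definition deform where
  "deform A c d p r l s = (\<lambda>(i, j).
     if i = k then (if j = m then p else new_row A c j + (if m < j then r j * p else 0))
     else if j = m then new_col A d i + (if k < i then l i * p else 0)
     else spread A (i, j) + s\<^sup>2 * ((if m < j then r j * new_col A d i else 0)
       + (if k < i then l i * new_row A c j else 0) + (if k < i \<and> m < j then l i * r j * p else 0)))"

definition scale :: "complex \<Rightarrow> (nat \<times> nat \<Rightarrow> complex) \<Rightarrow> nat \<times> nat \<Rightarrow> complex" where
  "scale s a x = (if (fst x = k) \<noteq> (snd x = m) then s * a x else a x)"

text \<open>Off the pivot, the new row and column have degree one in the parameters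
  \<open>c, d, r, l\<close>; the pivot has degree zero, and each correction to an old entry has
  degree two, whence the factor \<open>s\<^sup>2\<close> in \<open>deform\<close>.\<close>

lemma scale_deform:
  "extension A (\<lambda>i. s * c i) (\<lambda>i. s * d i) p (\<lambda>j. s * r j) (\<lambda>i. s * l i) = scale s (deform A c d p r l s)"
proof
  fix x :: "nat \<times> nat"
  obtain i j where x: "x = (i, j)" by (cases x)
  have row: "new_row A (\<lambda>i. s * c i) j = s * new_row A c j" for j
    by (simp add: new_row_def sum_distrib_left mult.assoc)
  have col: "new_col A (\<lambda>i. s * d i) i = s * new_col A d i" for i
    by (simp add: new_col_def sum_distrib_left mult.assoc)
  consider "i = k" "j = m" | "i = k" "j \<noteq> m" | "i \<noteq> k" "j = m" | "i \<noteq> k" "j \<noteq> m" by blast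
  then show "extension A (\<lambda>i. s * c i) (\<lambda>i. s * d i) p (\<lambda>j. s * r j) (\<lambda>i. s * l i) x
      = scale s (deform A c d p r l s) x"
    by cases (simp_all add: x extension_def base_matrix_def scale_def deform_def row col
        power2_eq_square algebra_simps)
qed

lemma deform_zero_sk: "deform A c d p r l 0 (sk y) = A y"
  by (cases y) (simp add: deform_def spread_def)

text \<open>A relation on \<open>X\<^sub>w\<close> is pulled back along \<^const>\<open>deform\<close>; after cancelling the power of \<open>s\<close> that
  divides all its coefficients, it specialises to a relation at \<open>s = 0\<close>.\<close>

lemma relation_specializes:
  assumes u: "\<And>t. u t \<in> polyfun J" "\<exists>a. u e a \<noteq> 0" and L: "L \<in> polyfun (grid (n - 1))"
    and J: "J \<subseteq> grid n"
    and rel: "\<And>x. x \<in> matrix_schubert_variety n w \<Longrightarrow> (\<Sum>t\<le>e. u t x * L (\<lambda>y. x (sk y)) ^ t) = 0"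
  obtains q where "\<And>t. q t \<in> polyfun J" "\<exists>t\<le>e. \<exists>a. q t a \<noteq> 0"
    "\<And>A c d p r l. A \<in> matrix_schubert_variety (n - 1) v \<Longrightarrow>
      (\<Sum>t\<le>e. q t (deform A c d p r l 0) * L A ^ t) = 0"
proof -
  \<comment> \<open>Scaling as a substitution of polynomials in \<open>s\<close>:
    \<open>[:0, a x:]\<close> is \<open>s * a x\<close>.\<close>
  let ?\<sigma> = "\<lambda>x a. if (fst x = k) \<noteq> (snd x = m) then [:0, a x:] else [:a x:]"
  have \<sigma>: "?\<sigma> x \<in> poly_family (polyfun J)" if "x \<in> J" for x
  proof (cases "(fst x = k) \<noteq> (snd x = m)")
    case True
    have eq: "(\<lambda>a. [:0, a x:]) = (\<lambda>a. monom (a x) 1)" by (simp add: fun_eq_iff monom_Suc monom_0)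
    have "(\<lambda>a. [:0, a x:]) \<in> poly_family (polyfun J)"
      unfolding eq by (rule polyfun.family_monom[OF polyfun_coord[OF that]])
    then show ?thesis using True by simp
  next
    case False
    then show ?thesis using polyfun.family_const[OF polyfun_coord[OF that]] by simp
  qed
  have sc: "(\<lambda>x. poly (?\<sigma> x a) s) = scale s a" for a s by (auto simp: scale_def fun_eq_iff)
  have "\<forall>t. \<exists>P. P \<in> poly_family (polyfun J) \<and> (\<forall>a s. u t (scale s a) = poly (P a) s)"
  proof
    fix t
    from polyfun_family[OF polyfun.function_ring_axioms u(1)[of t], of ?\<sigma>, OF \<sigma>]
    show "\<exists>P. P \<in> poly_family (polyfun J) \<and> (\<forall>a s. u t (scale s a) = poly (P a) s)"
      unfolding sc by blast
  qed
  from choice[OF this] obtain P where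
    "\<forall>t. P t \<in> poly_family (polyfun J) \<and> (\<forall>a s. u t (scale s a) = poly (P t a) s)" ..
  then have P: "P t \<in> poly_family (polyfun J)" "u t (scale s a) = poly (P t a) s" for t a s by auto
  have "scale 1 a = a" for a by (auto simp: scale_def)
  then have P1: "u t a = poly (P t a) 1" for t a using P(2)[of t 1 a] by simp
  \<comment> \<open>The same power of \<open>s\<close> is cancelled in all coefficients
    \<open>u t\<close>: the lowest one that occurs in any of them. So at least one coefficient
    survives at \<open>s = 0\<close>.\<close>
  define Z where "Z i \<longleftrightarrow> (\<exists>t\<le>e. \<exists>a. coeff (P t a) i \<noteq> 0)" for i
  have ex: "\<exists>i. Z i"
  proof -
    obtain a where "u e a \<noteq> 0" using u(2) by blast
    then have "P e a \<noteq> 0" using P1 by auto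
    then have "coeff (P e a) (degree (P e a)) \<noteq> 0" by simp
    then have "Z (degree (P e a))" unfolding Z_def by blast
    then show ?thesis by (rule exI[where x = "degree (P e a)"])
  qed
  define i0 where "i0 = (LEAST i. Z i)"
  have i0: "Z i0" unfolding i0_def by (rule LeastI_ex[OF ex])
  have below: "coeff (P t a) i = 0" if "i < i0" "t \<le> e" for t a i
    using not_less_Least[of i Z] that unfolding i0_def Z_def by blast
  define R where "R t a = poly_shift i0 (P t a)" for t a
  have PR: "poly (P t a) s = s ^ i0 * poly (R t a) s" if "t \<le> e" for t a s
  proof -
    have "P t a = monom 1 i0 * R t a"
      unfolding R_def by (rule poly_eqI) (auto simp: coeff_monom_mult coeff_poly_shift below that)
    then show ?thesis by (simp add: poly_monom)
  qed
  have cont: "continuous_on UNIV (\<lambda>s. poly (R t (f s)) s)"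
    if f: "\<And>x. continuous_on UNIV (\<lambda>s. f s x)" for t and f :: "complex \<Rightarrow> nat \<times> nat \<Rightarrow> complex"
  proof -
    obtain N where N: "\<And>a. degree (P t a) \<le> N" using P(1) by (metis poly_family_degree)
    have "degree (R t a) \<le> N" for a
    proof (intro degree_le allI impI)
      fix i assume "N < i"
      with N[of a] have "coeff (P t a) (i + i0) = 0" by (intro coeff_eq_0) simp
      then show "coeff (R t a) i = 0" by (simp add: R_def coeff_poly_shift)
    qed
    then have eq: "(\<lambda>s. poly (R t (f s)) s) = (\<lambda>s. \<Sum>i\<le>N. coeff (P t (f s)) (i + i0) * s ^ i)"
      by (auto simp: poly_eq_sum_coeff[of _ N] R_def coeff_poly_shift)
    show ?thesis
      unfolding eq by (intro continuous_intros polyfun_continuous[OF poly_family_coeff[OF P(1)] f])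
  qed
  define q where "q t a = coeff (P t a) i0" for t a
  show ?thesis
  proof (rule that[of q])
    show "q t \<in> polyfun J" for t unfolding q_def by (rule poly_family_coeff[OF P(1)])
    show "\<exists>t\<le>e. \<exists>a. q t a \<noteq> 0" using i0 unfolding Z_def q_def .
    fix A :: "nat \<times> nat \<Rightarrow> complex" and c d :: "nat \<Rightarrow> complex" and p and r l :: "nat \<Rightarrow> complex"
    assume A: "A \<in> matrix_schubert_variety (n - 1) v"
    define D where "D s = deform A c d p r l s" for s
    \<comment> \<open>The pulled back relation divided by \<open>s ^ i0\<close>. It vanishes for
      \<open>s \<noteq> 0\<close>, hence by continuity also at \<open>s = 0\<close>.\<close>
    define F where "F s = (\<Sum>t\<le>e. poly (R t (D s)) s * L (\<lambda>y. D s (sk y)) ^ t)" for s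
    have D_cont: "continuous_on UNIV (\<lambda>s. D s x)" for x
    proof (cases x)
      case (Pair i j)
      show ?thesis
        unfolding D_def deform_def Pair prod.case
        by (cases "i = k"; cases "j = m") (simp_all add: continuous_intros)
    qed
    have "continuous_on UNIV F"
      unfolding F_def[abs_def]
      by (intro continuous_intros cont D_cont polyfun_continuous[OF L])
    moreover have "F s = 0" if s: "s \<noteq> 0" for s
    proof -
      let ?x = "restrict (scale s (D s)) (grid n)"
      have "?x \<in> matrix_schubert_variety n w"
        unfolding D_def scale_deform[symmetric] by (rule extension_in_schubert[OF A])
      from rel[OF this] have "0 = (\<Sum>t\<le>e. u t ?x * L (\<lambda>y. ?x (sk y)) ^ t)" by simp
      also have "\<dots> = (\<Sum>t\<le>e. s ^ i0 * (poly (R t (D s)) s * L (\<lambda>y. D s (sk y)) ^ t))"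
      proof (intro sum.cong refl)
        fix t assume t: "t \<in> {..e}"
        have "u t ?x = u t (scale s (D s))"
          by (rule polyfun_local[OF u(1)]) (use J in auto)
        also have "\<dots> = s ^ i0 * poly (R t (D s)) s" using P(2) PR t by simp
        finally have 1: "u t ?x = s ^ i0 * poly (R t (D s)) s" .
        \<comment> \<open>\<open>L\<close> reads only entries off the new row and column, which
          \<open>scale\<close> leaves alone.\<close>
        have 2: "L (\<lambda>y. ?x (sk y)) = L (\<lambda>y. D s (sk y))"
        proof (rule polyfun_local[OF L])
          fix y assume "y \<in> grid (n - 1)"
          then have "sk y \<in> grid n" by (rule sk_grid)
          then show "?x (sk y) = D s (sk y)" by (cases y) (simp add: scale_def)
        qed
        show "u t ?x * L (\<lambda>y. ?x (sk y)) ^ t = s ^ i0 * (poly (R t (D s)) s * L (\<lambda>y. D s (sk y)) ^ t)"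
          unfolding 1 2 by simp
      qed
      also have "\<dots> = s ^ i0 * F s" by (simp add: F_def sum_distrib_left)
      finally show ?thesis using s by simp
    qed
    ultimately have "F 0 = 0" by (rule continuous_zero_at)
    moreover have "F 0 = (\<Sum>t\<le>e. q t (D 0) * L A ^ t)"
    proof -
      have "(\<lambda>y. D 0 (sk y)) = A" unfolding D_def by (rule ext) (rule deform_zero_sk)
      then show ?thesis by (simp add: F_def q_def poly_0_coeff_0 R_def coeff_poly_shift)
    qed
    ultimately show "(\<Sum>t\<le>e. q t (deform A c d p r l 0) * L A ^ t) = 0" by (simp add: D_def)
  qed
qed

text \<open>At \<open>s = 0\<close> the equations decouple: old entries are those of
  \<open>A\<close>, the pivot is \<open>p\<close>, the entries right of it and below it are solved
  for \<open>r\<close> and \<open>l\<close> by division by the pivot, and the other prescribed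
  entries of the new row and column for \<open>c\<close> and \<open>d\<close> by inverting the
  northwest block.\<close>

lemma deform_onto:
  assumes minor: "nw_minor A \<noteq> 0" and p: "a (k, m) \<noteq> 0"
    and T: "T \<subseteq> grid (n - 1)" and A: "\<And>y. y \<in> grid (n - 1) - T \<Longrightarrow> A y = a (sk y)"
  shows "\<exists>c d p r l. \<forall>x\<in>grid n - (cross_diagram \<union> sk ` T). deform A c d p r l 0 x = a x"
proof -
  obtain c where c: "\<And>i. i \<in> nw_rows \<Longrightarrow> new_row A c (w i) = a (k, w i)"
    using nw_solvable(1)[OF minor, of "\<lambda>i. a (k, w i)"] by blast
  obtain d where d: "\<And>i. i \<in> nw_rows \<Longrightarrow> new_col A d i = a (i, m)"
    using nw_solvable(2)[OF minor, of "\<lambda>i. a (i, m)"] by blast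
  let ?r = "\<lambda>j. (a (k, j) - new_row A c j) / a (k, m)"
  let ?l = "\<lambda>i. (a (i, m) - new_col A d i) / a (k, m)"
  have "deform A c d (a (k, m)) ?r ?l 0 x = a x" if x: "x \<in> grid n - (cross_diagram \<union> sk ` T)" for x
  proof -
    obtain i j where ij: "x = (i, j)" "i \<in> {1..n}" "j \<in> {1..n}" using x by (auto simp: grid_def)
    have notD: "i = k \<or> j = m \<Longrightarrow> \<not> (j < w i \<and> i < inv_into UNIV w j)"
      using x ij by (auto simp: cross_diagram_def rothe_diagram_def)
    consider "i = k" "j = m" | "i = k" "j > m" | "i = k" "j < m" | "i > k" "j = m" | "i < k" "j = m" | "i \<noteq> k" "j \<noteq> m"
      by linarith
    then show ?thesis
    proof cases
      case 1
      then show ?thesis by (simp add: ij deform_def)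
    next
      case 2
      then show ?thesis using p by (simp add: ij deform_def)
    next
      case 3
      define i' where "i' = inv_into UNIV w j"
      have i': "w i' = j" unfolding i'_def by (rule permutes_inverses(1)[OF w])
      have "i' \<le> k" using notD 3 by (auto simp: i'_def)
      moreover have "i' \<noteq> k" using i' 3 by auto
      moreover have "i' \<in> {1..n}" using w_in[of i'] i' ij by simp
      ultimately have "i' \<in> nw_rows" using i' 3 by (auto simp: nw_rows_def)
      from c[OF this] show ?thesis using 3 i' by (simp add: ij deform_def)
    next
      case 4
      then show ?thesis using p by (simp add: ij deform_def)
    next
      case 5
      have inv: "inv_into UNIV w m = k" by (rule permutes_inverses(2)[OF w])
      have "w i \<le> m" using notD 5 inv by auto
      moreover have "w i \<noteq> m" using 5 w_eq_m by simp
      ultimately have "i \<in> nw_rows" using 5 ij by (auto simp: nw_rows_def)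
      from d[OF this] show ?thesis using 5 by (simp add: ij deform_def)
    next
      case 6
      define y where "y = (unskip k i, unskip m j)"
      have sy: "sk y = x" using 6 by (simp add: y_def ij skip_unskip)
      have "y \<in> grid (n - 1)"
        using unskip_in[OF k 6(1)] unskip_in[OF m 6(2)] ij unfolding y_def grid_def by blast
      moreover have "y \<notin> T" using x sy by blast
      ultimately have "A y = a x" using A[of y] sy by simp
      moreover have "deform A c d (a (k, m)) ?r ?l 0 (sk y) = A y" by (rule deform_zero_sk)
      ultimately show ?thesis using sy by simp
    qed
  qed
  then show ?thesis by blast
qed

text \<open>Semicontinuity of the degree: the generic fiber of \<open>X\<^sub>w\<close> cannot satisfy a relation of degree less than
  the number of points of the generic fiber of \<open>X\<^sub>v\<close>.\<close>

lemma projection_degree_mono: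
  assumes T: "T \<subseteq> grid (n - 1)" "card T = coxeter_length (n - 1) v"
  shows "projection_degree (matrix_schubert_variety (n - 1) v) (grid (n - 1) - T) \<le>
    projection_degree (matrix_schubert_variety n w) (grid n - (cross_diagram \<union> sk ` T))"
proof -
  let ?Xv = "matrix_schubert_variety (n - 1) v" and ?Xw = "matrix_schubert_variety n w"
  let ?J' = "grid (n - 1) - T" and ?J = "grid n - (cross_diagram \<union> sk ` T)"
  define d where "d = projection_degree ?Xv ?J'"
  show ?thesis
  proof (cases "d = 0")
    case True
    then show ?thesis by (simp add: d_def)
  next
    case False
    have finJ': "finite ?J'" and finJ: "finite ?J" by (auto simp: finite_grid)
    have finT: "finite T" by (rule finite_subset[OF T(1) finite_grid])
    have cardT: "card T = card (rothe_diagram (n - 1) v)" using T(2) coxeter_length_eq[OF v] by simp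
    have cJ': "(n - 1) * (n - 1) \<le> card ?J' + card (rothe_diagram (n - 1) v)"
      using card_Diff_subset[OF finT T(1)] card_mono[OF finite_grid T(1)] cardT
      by (simp add: grid_def card_cartesian_product)
    have S: "cross_diagram \<union> sk ` T \<subseteq> grid n" using cross_diagram_grid sk_grid T(1) by blast
    have finS: "finite (cross_diagram \<union> sk ` T)" by (rule finite_subset[OF S finite_grid])
    have cS: "card (cross_diagram \<union> sk ` T) = card (rothe_diagram n w)"
      using finT by (subst card_Un_disjoint[OF finite_cross_diagram _ cross_sk_disjoint])
        (simp_all add: card_image[OF inj_sk] cardT card_rothe_split)
    have cJ: "n * n \<le> card ?J + card (rothe_diagram n w)"
      using card_Diff_subset[OF finS S] card_mono[OF finite_grid S] cS
      by (simp add: grid_def card_cartesian_product)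
    have d_gen: "\<forall>\<^sub>F b in zariski_generic ?J'. finite (fiber ?Xv ?J' b) \<and> card (fiber ?Xv ?J' b) = d"
      using projection_degree_generic[OF finJ'] False unfolding d_def by blast
    \<comment> \<open>The index \<open>(0, 0)\<close> lies outside every grid and serves as the
      fresh coordinate for values of linear forms.\<close>
    have fresh: "(0, 0) \<notin> grid N" for N by (simp add: grid_def)
    have "\<forall>\<^sub>F b in zariski_generic ?J'. finite (fiber ?Xv ?J' b) \<and> card (fiber ?Xv ?J' b) \<le> d"
      using d_gen by eventually_elim simp
    from generic_fiber_card[OF finite_grid Diff_subset fresh matrix_schubert_variety_eq
        constructible_schubert_condition this]
    obtain e' cv where lin: "\<forall>\<^sub>F b in zariski_generic ?J'. finite (fiber ?Xv ?J' b) \<and> card (fiber ?Xv ?J' b) = e' \<and>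
        inj_on (linear_form (grid (n - 1)) cv) (fiber ?Xv ?J' b)" by blast
    define L where "L = linear_form (grid (n - 1)) cv"
    \<comment> \<open>Points of \<open>X\<^sub>v\<close> with vanishing minor lie over a proper
      closed subset of the base, so generic fibers avoid them.\<close>
    obtain g0 where g0: "g0 \<in> polyfun ?J'" "\<exists>a. g0 a \<noteq> 0" "\<forall>A\<in>?Xv. nw_minor A = 0 \<longrightarrow> g0 A = 0"
      using schubert_hypersurface_dependent[OF v Diff_subset cJ' nw_minor_polyfun nw_minor_permutation] by blast
    from g0(2) obtain a0 where "g0 a0 \<noteq> 0" ..
    from generic_nonzero[OF g0(1) this]
    have good: "\<forall>\<^sub>F b in zariski_generic ?J'. card (L ` fiber ?Xv ?J' b) = d \<and>
        (\<forall>A\<in>fiber ?Xv ?J' b. nw_minor A \<noteq> 0)"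
      using lin d_gen
    proof eventually_elim
      case (elim b)
      have "card (L ` fiber ?Xv ?J' b) = d" using elim by (simp add: card_image L_def)
      moreover have "nw_minor A \<noteq> 0" if "A \<in> fiber ?Xv ?J' b" for A
      proof
        assume "nw_minor A = 0"
        with g0(3) that have "g0 A = 0" by (simp add: fiber_def)
        moreover have "g0 A = g0 b" by (rule polyfun_local[OF g0(1)]) (use that in \<open>simp add: fiber_def\<close>)
        ultimately show False using elim by simp
      qed
      ultimately show ?case by blast
    qed
    obtain M where M: "\<forall>\<^sub>F a in zariski_generic ?J. finite (fiber ?Xw ?J a) \<and> card (fiber ?Xw ?J a) \<le> M"
      using schubert_generic_fiber_finite[OF w Diff_subset cJ] by blast
    from generic_fiber_card[OF finite_grid Diff_subset fresh matrix_schubert_variety_eq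
        constructible_schubert_condition M]
    obtain ew c' where "\<forall>\<^sub>F a in zariski_generic ?J. finite (fiber ?Xw ?J a) \<and> card (fiber ?Xw ?J a) = ew \<and>
        inj_on (linear_form (grid n) c') (fiber ?Xw ?J a)" by blast
    then have ew: "\<forall>\<^sub>F a in zariski_generic ?J. finite (fiber ?Xw ?J a) \<and> card (fiber ?Xw ?J a) = ew"
      by eventually_elim blast
    \<comment> \<open>The form separating the generic fiber of \<open>X\<^sub>v\<close>, read on the
      old entries of a matrix in \<open>X\<^sub>w\<close>.\<close>
    define \<mu> where "\<mu> x = (if x \<in> sk ` grid (n - 1) then cv (unskip k (fst x), unskip m (snd x)) else 0)" for x
    have L\<mu>: "linear_form (grid n) \<mu> x = L (\<lambda>y. x (sk y))" for x
    proof -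
      have "linear_form (grid n) \<mu> x = (\<Sum>i\<in>sk ` grid (n - 1). \<mu> i * x i)"
        unfolding linear_form_def
        by (rule sum.mono_neutral_right) (use sk_grid in \<open>auto simp: finite_grid \<mu>_def\<close>)
      also have "\<dots> = (\<Sum>y\<in>grid (n - 1). \<mu> (sk y) * x (sk y))"
        by (subst sum.reindex[OF inj_sk]) (simp add: comp_def)
      also have "\<dots> = L (\<lambda>y. x (sk y))"
        unfolding L_def linear_form_def by (intro sum.cong refl) (auto simp: \<mu>_def)
      finally show ?thesis .
    qed
    have ew_fin: "\<forall>\<^sub>F a in zariski_generic ?J. finite (fiber ?Xw ?J a)" using ew by eventually_elim simp
    obtain e u where u: "\<And>t. u t \<in> polyfun ?J" "\<exists>a. u e a \<noteq> 0"
      "\<forall>\<^sub>F a in zariski_generic ?J. card (linear_form (grid n) \<mu> ` fiber ?Xw ?J a) = e"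
      "\<And>x. x \<in> ?Xw \<Longrightarrow> (\<Sum>t\<le>e. u t x * linear_form (grid n) \<mu> x ^ t) = 0"
      by (rule linear_form_relation[OF finite_grid Diff_subset fresh matrix_schubert_variety_eq
          constructible_schubert_condition ew_fin]) (rule that; assumption)
    have "\<forall>\<^sub>F a in zariski_generic ?J. e \<le> ew"
      using u(3) ew by eventually_elim (use card_image_le in blast)
    from generic_happens[OF this] have "e \<le> ew" by blast
    moreover have "d \<le> e"
    proof (rule ccontr)
      assume "\<not> d \<le> e"
      have Lp: "L \<in> polyfun (grid (n - 1))" unfolding L_def by (rule linear_form_polyfun)
      obtain q where q: "\<And>t. q t \<in> polyfun ?J" "\<exists>t\<le>e. \<exists>a. q t a \<noteq> 0"
        "\<And>A c d p r l. A \<in> ?Xv \<Longrightarrow> (\<Sum>t\<le>e. q t (deform A c d p r l 0) * L A ^ t) = 0"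
        by (rule relation_specializes[OF u(1,2) Lp Diff_subset u(4)[unfolded L\<mu>]], assumption) (rule that; assumption)
      \<comment> \<open>The leading coefficient may be lost at \<open>s = 0\<close>; any surviving
        coefficient makes the relation nontrivial and of degree at most \<open>e\<close>.\<close>
      obtain t0 a0 where t0: "t0 \<le> e" "q t0 a0 \<noteq> 0" using q(2) by blast
      have kmJ: "(k, m) \<in> ?J" using k m by (auto simp: grid_def cross_diagram_def rothe_diagram_def)
      have g1: "\<forall>\<^sub>F a in zariski_generic ?J. q t0 a \<noteq> 0" by (rule generic_nonzero[OF q(1) t0(2)])
      have g2: "\<forall>\<^sub>F a in zariski_generic ?J. a (k, m) \<noteq> 0"
        by (rule generic_nonzero[OF polyfun_coord[OF kmJ], of "\<lambda>_. 1"]) simp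
      have g3: "\<forall>\<^sub>F a in zariski_generic ?J. card (L ` fiber ?Xv ?J' (\<lambda>y. a (sk y))) = d \<and>
          (\<forall>A\<in>fiber ?Xv ?J' (\<lambda>y. a (sk y)). nw_minor A \<noteq> 0)"
      proof (rule generic_subst[OF good])
        fix y assume y: "y \<in> ?J'"
        then have "sk y \<notin> sk ` T" using inj_image_mem_iff[OF inj_sk, of y T] by blast
        moreover have "sk y \<notin> cross_diagram" using cross_sk_disjoint[of "{y}"] by blast
        ultimately show "sk y \<in> ?J" using sk_grid y by blast
      next
        fix a b :: "nat \<times> nat \<Rightarrow> complex"
        assume "\<And>x. x \<in> ?J' \<Longrightarrow> a x = b x"
        then have "fiber ?Xv ?J' a = fiber ?Xv ?J' b" by (rule fiber_local)
        then show "card (L ` fiber ?Xv ?J' a) = d \<and> (\<forall>A\<in>fiber ?Xv ?J' a. nw_minor A \<noteq> 0) \<Longrightarrow>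
          card (L ` fiber ?Xv ?J' b) = d \<and> (\<forall>A\<in>fiber ?Xv ?J' b. nw_minor A \<noteq> 0)" by simp
      qed (rule inj_sk)
      from g1 g2 g3 have "\<forall>\<^sub>F a in zariski_generic ?J. q t0 a \<noteq> 0 \<and> a (k, m) \<noteq> 0 \<and>
          card (L ` fiber ?Xv ?J' (\<lambda>y. a (sk y))) = d \<and> (\<forall>A\<in>fiber ?Xv ?J' (\<lambda>y. a (sk y)). nw_minor A \<noteq> 0)"
        by eventually_elim blast
      from generic_happens[OF this] obtain a where a: "q t0 a \<noteq> 0" "a (k, m) \<noteq> 0"
        "card (L ` fiber ?Xv ?J' (\<lambda>y. a (sk y))) = d" "\<And>A. A \<in> fiber ?Xv ?J' (\<lambda>y. a (sk y)) \<Longrightarrow> nw_minor A \<noteq> 0"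
        by blast
      \<comment> \<open>One polynomial for the whole fiber: the parameters from
        \<open>deform_onto\<close> depend on \<open>A\<close>, but they always move the base point
        to the same \<open>a\<close>. All \<open>d\<close> values of \<open>L\<close> are then roots
        of \<open>G\<close>.\<close>
      define G where "G = (\<Sum>t\<le>e. monom (q t a) t)"
      have G: "poly G (L A) = 0" if A: "A \<in> fiber ?Xv ?J' (\<lambda>y. a (sk y))" for A
      proof -
        have "\<And>y. y \<in> grid (n - 1) - T \<Longrightarrow> A y = a (sk y)" using A by (simp add: fiber_def)
        from deform_onto[OF a(4)[OF A] a(2) T(1) this] obtain c d p r l where
          def: "\<forall>x\<in>?J. deform A c d p r l 0 x = a x" by blast
        have "q t (deform A c d p r l 0) = q t a" for t
          by (rule polyfun_local[OF q(1)]) (use def in blast)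
        then have "(\<Sum>t\<le>e. q t a * L A ^ t) = 0" using q(3)[of A c d p r l] A by (simp add: fiber_def)
        then show ?thesis by (simp add: G_def poly_sum poly_monom)
      qed
      have "coeff G t0 = q t0 a" using t0(1) by (simp add: G_def coeff_sum)
      with a(1) have nz: "G \<noteq> 0" by auto
      have deg: "degree G \<le> e" unfolding G_def
        by (rule degree_sum_le) (auto intro: order_trans[OF degree_monom_le])
      have "L ` fiber ?Xv ?J' (\<lambda>y. a (sk y)) \<subseteq> {t. poly G t = 0}" using G by auto
      then have "d \<le> card {t. poly G t = 0}"
        using card_mono[OF poly_roots_finite[OF nz]] a(3) by metis
      also have "\<dots> \<le> e" using card_poly_roots_bound[OF nz] deg by simp
      finally show False using \<open>\<not> d \<le> e\<close> by simp
    qed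
    ultimately have "d \<le> ew" by simp
    moreover have "projection_degree ?Xw ?J = ew"
      by (rule generic_projection_degree[OF finJ _ ew]) (use \<open>d \<le> ew\<close> False in simp)
    ultimately show ?thesis by (simp add: d_def)
  qed
qed

end

section \<open>Comparison of coefficients\<close>

definition indicator_exponent :: "'x set \<Rightarrow> 'x \<Rightarrow>\<^sub>0 nat" where
  "indicator_exponent S = (\<Sum>s\<in>S. Poly_Mapping.single s 1)"

lemma lookup_indicator_exponent:
  "finite S \<Longrightarrow> Poly_Mapping.lookup (indicator_exponent S) x = of_bool (x \<in> S)"
  unfolding indicator_exponent_def by (simp add: lookup_sum lookup_single when_def)

lemma keys_indicator_exponent: "finite S \<Longrightarrow> Poly_Mapping.keys (indicator_exponent S) = S"
  by (auto simp: in_keys_iff lookup_indicator_exponent)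

lemma prod_var: "(\<Prod>s\<in>S. var s) = (Poly_Mapping.single (indicator_exponent S) 1 :: ('x, 'r::comm_ring_1) mpolynomial)"
  unfolding indicator_exponent_def
  by (induction S rule: infinite_finite_induct) (simp_all add: var_def mult_single)

lemma const_prod_var: "const c * (\<Prod>s\<in>S. var s) = Poly_Mapping.single (indicator_exponent S) c"
  by (simp add: prod_var const_def mult_single)

text \<open>Distinct sets have distinct squarefree exponents, so terms do not merge and each
  coefficient can be read off.\<close>

lemma rename_vars_squarefree:
  fixes a :: "'x set \<Rightarrow> 'r::comm_ring_1" and f :: "'x \<Rightarrow> 'y"
  assumes "finite I" "\<And>S. S \<in> I \<Longrightarrow> finite S"
  shows "rename_vars f (\<Sum>S\<in>I. const (a S) * (\<Prod>s\<in>S. var s)) = (\<Sum>S\<in>I. const (a S) * (\<Prod>s\<in>S. var (f s)))"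
proof -
  define F where "F = (\<Sum>S\<in>I. const (a S) * (\<Prod>s\<in>S. var s))"
  have F: "F = (\<Sum>S\<in>I. Poly_Mapping.single (indicator_exponent S) (a S))"
    by (simp add: F_def const_prod_var)
  have inj: "inj_on indicator_exponent I"
    by (rule inj_onI) (metis assms(2) keys_indicator_exponent)
  have lookup_F: "Poly_Mapping.lookup F (indicator_exponent S) = a S" if "S \<in> I" for S
  proof -
    have "Poly_Mapping.lookup F (indicator_exponent S) = (\<Sum>T\<in>I. if T = S then a T else 0)"
      unfolding F lookup_sum lookup_single when_def
      by (rule sum.cong) (use inj that in \<open>auto dest: inj_onD\<close>)
    then show ?thesis using that assms(1) by simp
  qed
  have keys_F: "Poly_Mapping.keys F \<subseteq> indicator_exponent ` I"
    unfolding F by (rule order_trans[OF keys_sum]) auto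
  have "rename_vars f F = (\<Sum>m\<in>indicator_exponent ` I. const (Poly_Mapping.lookup F m) *
      (\<Prod>x\<in>Poly_Mapping.keys m. var (f x) ^ Poly_Mapping.lookup m x))"
    unfolding rename_vars_def eval_with_def
    by (rule sum.mono_neutral_left) (use keys_F assms(1) in \<open>auto simp: in_keys_iff const_def\<close>)
  also have "\<dots> = (\<Sum>S\<in>I. const (Poly_Mapping.lookup F (indicator_exponent S)) *
      (\<Prod>x\<in>Poly_Mapping.keys (indicator_exponent S). var (f x) ^ Poly_Mapping.lookup (indicator_exponent S) x))"
    by (rule sum.reindex[OF inj, unfolded comp_def])
  also have "\<dots> = (\<Sum>S\<in>I. const (a S) * (\<Prod>s\<in>S. var (f s)))"
  proof (rule sum.cong[OF refl])
    fix S assume S: "S \<in> I"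
    have "(\<Prod>x\<in>S. var (f x) ^ Poly_Mapping.lookup (indicator_exponent S) x) = (\<Prod>s\<in>S. var (f s) :: ('y, 'r) mpolynomial)"
      by (rule prod.cong) (simp_all add: lookup_indicator_exponent assms(2)[OF S])
    then show "const (Poly_Mapping.lookup F (indicator_exponent S)) *
      (\<Prod>x\<in>Poly_Mapping.keys (indicator_exponent S). var (f x) ^ Poly_Mapping.lookup (indicator_exponent S) x) =
      (const (a S) * (\<Prod>s\<in>S. var (f s)) :: ('y, 'r) mpolynomial)"
      by (simp add: lookup_F[OF S] keys_indicator_exponent[OF assms(2)[OF S]])
  qed
  finally show ?thesis unfolding F_def .
qed

theorem proposition1p11:
  fixes n k :: nat and w v :: "nat \<Rightarrow> nat" and M :: "(nat \<times> nat, int) mpolynomial"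
  assumes "w permutes {1..n}"
    and "k \<in> {1..n}"
    and "relative_ordering_omitting n w k v"
    and "M = (\<Prod>(i, j)\<in>{(i, j) \<in> rothe_diagram n w. i = k \<or> j = w k}. var (i, j))"
  shows "\<exists>E :: (nat \<times> nat, int) mpolynomial.
           (\<forall>m. Poly_Mapping.lookup E m \<ge> 0) \<and>
           fine_schubert n w =
             M * rename_vars (\<lambda>(i, j). (skip k i, skip (w k) j)) (fine_schubert (n - 1) v) + E"
proof -
  interpret deletion n w k v using assms(1-3) by unfold_locales
  let ?D = cross_diagram
  let ?Iv = "{T. T \<subseteq> grid (n - 1) \<and> card T = coxeter_length (n - 1) v}"
  let ?Iw = "{S. S \<subseteq> grid n \<and> card S = coxeter_length n w}"
  \<comment> \<open>Multiplication by \<open>M\<close> after renaming takes the monomial of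
    \<open>T\<close> to that of \<open>\<phi> T\<close>. The degrees match because the diagram of
    \<open>w\<close> consists of the cross part and the image of the diagram of
    \<open>v\<close>.\<close>
  define \<phi> where "\<phi> T = ?D \<union> sk ` T" for T
  define dv where "dv T = int (projection_degree (matrix_schubert_variety (n - 1) v) (grid (n - 1) - T))" for T
  define dw where "dw S = int (projection_degree (matrix_schubert_variety n w) (grid n - S))" for S
  have finIv: "finite ?Iv" and finIw: "finite ?Iw"
    by (rule finite_subset[of _ "Pow (grid N)" for N], auto simp: finite_grid)+
  have finT: "finite T" if "T \<in> ?Iv" for T using that finite_subset[OF _ finite_grid] by blast
  have mono: "dv T \<le> dw (\<phi> T)" if "T \<in> ?Iv" for T
    using projection_degree_mono[of T] that unfolding dv_def dw_def \<phi>_def by simp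
  have \<phi>_in: "\<phi> T \<in> ?Iw" if T: "T \<in> ?Iv" for T
  proof -
    have "\<phi> T \<subseteq> grid n" using T cross_diagram_grid sk_grid unfolding \<phi>_def by blast
    moreover have "card (\<phi> T) = card ?D + card T"
      unfolding \<phi>_def using finT[OF T]
      by (subst card_Un_disjoint[OF finite_cross_diagram _ cross_sk_disjoint]) (simp_all add: card_image[OF inj_sk])
    ultimately show ?thesis
      using T coxeter_length_eq[OF w] coxeter_length_eq[OF v] card_rothe_split by simp
  qed
  have inj_\<phi>: "inj_on \<phi> ?Iv"
  proof (rule inj_onI)
    fix T U assume "\<phi> T = \<phi> U"
    then have "sk ` T = sk ` U"
      unfolding \<phi>_def using cross_sk_disjoint[of T] cross_sk_disjoint[of U] by blast
    then show "T = U" by (simp add: inj_image_eq_iff[OF inj_sk])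
  qed
  \<comment> \<open>The excess of degrees on the monomials of the form \<open>\<phi> T\<close>, and
    the full coefficients of all others, which are degrees themselves and so nonnegative.\<close>
  define E where "E = (\<Sum>T\<in>?Iv. const (dw (\<phi> T) - dv T) * (\<Prod>s\<in>\<phi> T. var s)) +
    (\<Sum>S\<in>?Iw - \<phi> ` ?Iv. const (dw S) * (\<Prod>s\<in>S. var s))"
  have M_v: "M * rename_vars sk (fine_schubert (n - 1) v) = (\<Sum>T\<in>?Iv. const (dv T) * (\<Prod>s\<in>\<phi> T. var s))"
  proof -
    have M: "M = (\<Prod>s\<in>?D. var s)"
      unfolding assms(4) cross_diagram_def by (rule prod.cong) auto
    have "rename_vars sk (fine_schubert (n - 1) v) = (\<Sum>T\<in>?Iv. const (dv T) * (\<Prod>s\<in>T. var (sk s)))"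
      unfolding fine_schubert_def dv_def by (rule rename_vars_squarefree[OF finIv]) (rule finT)
    then have "M * rename_vars sk (fine_schubert (n - 1) v) =
        (\<Sum>T\<in>?Iv. M * (const (dv T) * (\<Prod>s\<in>T. var (sk s))))"
      by (simp add: sum_distrib_left)
    also have "\<dots> = (\<Sum>T\<in>?Iv. const (dv T) * (\<Prod>s\<in>\<phi> T. var s))"
    proof (rule sum.cong[OF refl])
      fix T assume T: "T \<in> ?Iv"
      have "(\<Prod>s\<in>\<phi> T. var s :: (nat \<times> nat, int) mpolynomial) = (\<Prod>s\<in>?D. var s) * (\<Prod>s\<in>sk ` T. var s)"
        unfolding \<phi>_def using finT[OF T]
        by (intro prod.union_disjoint finite_cross_diagram cross_sk_disjoint) simp
      also have "(\<Prod>s\<in>sk ` T. var s :: (nat \<times> nat, int) mpolynomial) = (\<Prod>s\<in>T. var (sk s))"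
        by (rule prod.reindex[OF inj_sk, unfolded comp_def])
      finally show "M * (const (dv T) * (\<Prod>s\<in>T. var (sk s))) = const (dv T) * (\<Prod>s\<in>\<phi> T. var s)"
        unfolding M by (simp only: mult_ac)
    qed
    finally show ?thesis .
  qed
  have F_w: "fine_schubert n w = (\<Sum>T\<in>?Iv. const (dv T) * (\<Prod>s\<in>\<phi> T. var s)) + E"
  proof -
    have "fine_schubert n w = (\<Sum>S\<in>?Iw. const (dw S) * (\<Prod>s\<in>S. var s))"
      unfolding fine_schubert_def dw_def ..
    also have "\<dots> = (\<Sum>S\<in>\<phi> ` ?Iv. const (dw S) * (\<Prod>s\<in>S. var s)) + (\<Sum>S\<in>?Iw - \<phi> ` ?Iv. const (dw S) * (\<Prod>s\<in>S. var s))"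
      by (subst add.commute, rule sum.subset_diff[OF _ finIw]) (use \<phi>_in in blast)
    also have "(\<Sum>S\<in>\<phi> ` ?Iv. const (dw S) * (\<Prod>s\<in>S. var s)) =
        (\<Sum>T\<in>?Iv. const (dw (\<phi> T)) * (\<Prod>s\<in>\<phi> T. var s))"
      by (rule sum.reindex[OF inj_\<phi>, unfolded comp_def])
    also have "\<dots> = (\<Sum>T\<in>?Iv. const (dv T) * (\<Prod>s\<in>\<phi> T. var s) + const (dw (\<phi> T) - dv T) * (\<Prod>s\<in>\<phi> T. var s))"
      by (rule sum.cong[OF refl]) (simp add: const_prod_var single_add[symmetric])
    finally show ?thesis by (simp add: E_def sum.distrib add.assoc)
  qed
  have nonneg: "Poly_Mapping.lookup E m \<ge> 0" for m
  proof -
    have "Poly_Mapping.lookup (const c * (\<Prod>s\<in>S. var s)) m \<ge> 0" if "c \<ge> 0" for c :: int and S :: "(nat \<times> nat) set"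
      using that by (simp add: const_prod_var lookup_single when_def)
    then show ?thesis
      unfolding E_def lookup_add lookup_sum
      by (intro add_nonneg_nonneg sum_nonneg) (use mono in \<open>auto simp: dw_def\<close>)
  qed
  show ?thesis
    by (rule exI[where x = E], intro conjI allI nonneg) (simp only: M_v F_w)
qed

end
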